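(* Let $\mathbb{K}$ be an infinite field and let $q \ge 1$. Let $X \subset (\mathbb{P}^1)^q$ be a zero-dimensional ACM subscheme over $\mathbb{K}$. Then there exists a quasi-rectangular domain $Q(X) \subset \mathbb{Z}^q$ such that $\Delta \mathcal{H}_X = \chi_{Q(X)}$, the characteristic function of $Q(X)$. Conversely, for any nonempty quasi-rectangular domain $Q \subset \mathbb{Z}^q$ there exists a zero-dimensional ACM subscheme $X \subset (\mathbb{P}^1)^q$ such that $\Delta \mathcal{H}_X = \chi_Q$.
   Context: The coordinate ring of $(\mathbb{P}^1)^q$ is $\mathbb{S} = \mathbb{K}[x_{i0}, x_{i1} \mid 1 \le i \le q]$, $\mathbb{Z}^q$-graded by $\deg(x_{ij}) = e_i$, the $i$-th standard basis element of $\mathbb{Z}^q$. For a zero-dimensional subscheme $X$, $I(X) \subset \mathbb{S}$ is the ideal generated by the $\mathbb{Z}^q$-homogeneous forms vanishing on $X$, and $\mathcal{H}_X(a) = \dim_{\mathbb{K}} (\mathbb{S}/I(X))_a$ for $a \in \mathbb{Z}^q$. $X$ is arithmetically Cohen-Macaulay (ACM) if $\operatorname{depth}(\mathbb{S}/I(X)) = \dim(\mathbb{S}/I(X)) = q$, where depth is the maximal length of a regular sequence contained in the ideal generated by all the variables. For $\mathcal{F}\colon \mathbb{Z}^q \to \mathbb{Z}$, the difference function is $$\Delta \mathcal{F}(a) = \mathcal{F}(a) + \sum_{1 \le p \le q} (-1)^p \sum_{1 \le i_1 < \dots < i_p \le q} \mathcal{F}(a - e_{i_1} - \dots - e_{i_p}).$$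 A rectangular domain in $\mathbb{Z}^q$ is a set $[0,r] = \{a \in \mathbb{Z}^q \mid 0 \le a \le r\}$ with $r \ge 0$ (componentwise order); a quasi-rectangular domain is a finite union of rectangular domains. For $T \subset \mathbb{Z}^q$, $\chi_T(a) = 1$ if $a \in T$ and $\chi_T(a) = 0$ otherwise. *)

theory Defs
  imports "HOL-Analysis.Finite_Cartesian_Product" "HOL-Library.Poly_Mapping"
    "HOL-Library.Extended_Nat" "HOL-Library.Indicator_Function"
begin

section \<open>Ideals, Krull dimension and depth\<close>

text \<open>
  \<open>R\<close> is a subring of an ambient commutative ring type, given as a set; this lets all coordinate
  rings of affine patches live in a single Laurent polynomial ring.
\<close>

definition ideal_of :: "'a::comm_ring_1 set \<Rightarrow> 'a set \<Rightarrow> bool" where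
  "ideal_of R I \<longleftrightarrow> I \<subseteq> R \<and> 0 \<in> I \<and> (\<forall>x\<in>I. \<forall>y\<in>I. x + y \<in> I) \<and> (\<forall>r\<in>R. \<forall>x\<in>I. r * x \<in> I)"

definition gen_ideal :: "'a::comm_ring_1 set \<Rightarrow> 'a set \<Rightarrow> 'a set" where
  "gen_ideal R B = \<Inter>{I. ideal_of R I \<and> B \<subseteq> I}"

definition prime_ideal_of :: "'a::comm_ring_1 set \<Rightarrow> 'a set \<Rightarrow> bool" where
  "prime_ideal_of R P \<longleftrightarrow>
     ideal_of R P \<and> P \<noteq> R \<and> (\<forall>a\<in>R. \<forall>b\<in>R. a * b \<in> P \<longrightarrow> a \<in> P \<or> b \<in> P)"

text \<open>
  Krull dimension of the quotient \<open>R/I\<close>, whose primes are the primes of \<open>R\<close> containing \<open>I\<close>.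
  The zero ring gets the value 0 (the supremum of the empty set).
\<close>

definition krull_dim :: "'a::comm_ring_1 set \<Rightarrow> 'a set \<Rightarrow> enat" where
  "krull_dim R I = Sup {enat n | n. \<exists>P :: nat \<Rightarrow> 'a set.
     (\<forall>k\<le>n. prime_ideal_of R (P k) \<and> I \<subseteq> P k) \<and> (\<forall>k<n. P k \<subset> P (Suc k))}"

text \<open>
  \<open>fs\<close> is a regular sequence on the quotient by \<open>I\<close>: each entry is a nonzerodivisor modulo \<open>I\<close>
  and the preceding entries, and the final quotient is nonzero.
\<close>

definition regular_seq :: "'a::comm_ring_1 set \<Rightarrow> 'a list \<Rightarrow> bool" where
  "regular_seq I fs \<longleftrightarrow>
     (\<forall>k<length fs. \<forall>g. fs ! k * g \<in> gen_ideal UNIV (I \<union> set (take k fs))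
        \<longrightarrow> g \<in> gen_ideal UNIV (I \<union> set (take k fs))) \<and>
     gen_ideal UNIV (I \<union> set fs) \<noteq> UNIV"

text \<open>Depth of the quotient by \<open>I\<close> with respect to the ideal \<open>m\<close>.\<close>

definition depth :: "'a::comm_ring_1 set \<Rightarrow> 'a set \<Rightarrow> enat" where
  "depth m I = Sup {enat (length fs) | fs. set fs \<subseteq> m \<and> regular_seq I fs}"

section \<open>The coordinate ring of a product of projective lines\<close>

text \<open>
  The factors are indexed by the finite type \<open>'q\<close>, so \<open>q = CARD('q)\<close> and the grading group is
  \<open>int ^ 'q\<close>, with standard basis \<open>axis i 1\<close> and the componentwise order.
  The variable \<open>(i, False)\<close> is $x_{i0}$ and \<open>(i, True)\<close> is $x_{i1}$.
\<close>

type_synonym ('q, 'k) cox = "('q \<times> bool \<Rightarrow>\<^sub>0 nat) \<Rightarrow>\<^sub>0 'k"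

definition var :: "'q \<times> bool \<Rightarrow> ('q, 'k::field) cox" where
  "var v = Poly_Mapping.single (Poly_Mapping.single v 1) 1"

definition const :: "'k::field \<Rightarrow> ('q, 'k) cox" where
  "const c = Poly_Mapping.single 0 c"

definition mdeg :: "('q::finite \<times> bool \<Rightarrow>\<^sub>0 nat) \<Rightarrow> int ^ 'q" where
  "mdeg m = (\<chi> i. int (Poly_Mapping.lookup m (i, False) + Poly_Mapping.lookup m (i, True)))"

definition forms :: "int ^ 'q \<Rightarrow> ('q::finite, 'k::field) cox set" where
  "forms a = {F. \<forall>m\<in>Poly_Mapping.keys F. mdeg m = a}"

definition var_ideal :: "('q::finite, 'k::field) cox set" where
  "var_ideal = gen_ideal UNIV (range var)"

section \<open>Closed subschemes\<close>

text \<open>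
  Put $t_i = x_{i1}/x_{i0}$. For \<open>\<sigma> :: 'q \<Rightarrow> bool\<close> let $U_\sigma$ be the standard affine open set where
  all $x_{i,\sigma(i)}$ are invertible. All rings of sections over the $U_\sigma$ and their
  intersections are subrings of the Laurent polynomial ring in the $t_i$, whose monomials are
  indexed by \<open>int ^ 'q\<close>: \<open>patch \<sigma> \<tau>\<close> is the ring of $U_\sigma \cap U_\tau$, generated by $t_i$ (unless
  \<open>\<sigma> i\<close> and \<open>\<tau> i\<close> both hold) and $t_i^{-1}$ (unless both fail). In particular \<open>patch \<sigma> \<sigma>\<close> is the
  polynomial ring of $U_\sigma$.
\<close>

type_synonym ('q, 'k) laurent = "(int ^ 'q) \<Rightarrow>\<^sub>0 'k"

definition patch :: "('q::finite \<Rightarrow> bool) \<Rightarrow> ('q \<Rightarrow> bool) \<Rightarrow> ('q, 'k::field) laurent set" where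
  "patch \<sigma> \<tau> = {f. \<forall>u\<in>Poly_Mapping.keys f. \<forall>i.
     (\<not> \<sigma> i \<and> \<not> \<tau> i \<longrightarrow> 0 \<le> u $ i) \<and> (\<sigma> i \<and> \<tau> i \<longrightarrow> u $ i \<le> 0)}"

text \<open>
  A closed subscheme is a quasi-coherent sheaf of ideals, that is, an ideal over each $U_\sigma$ such
  that the ideals over $U_\sigma$ and $U_\tau$ have the same extension to $U_\sigma \cap U_\tau$.
\<close>

type_synonym ('q, 'k) ideal_sheaf = "('q \<Rightarrow> bool) \<Rightarrow> ('q, 'k) laurent set"

definition closed_subscheme :: "('q::finite, 'k::field) ideal_sheaf \<Rightarrow> bool" where
  "closed_subscheme X \<longleftrightarrow> (\<forall>\<sigma>. ideal_of (patch \<sigma> \<sigma>) (X \<sigma>)) \<and>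
     (\<forall>\<sigma> \<tau>. gen_ideal (patch \<sigma> \<tau>) (X \<sigma>) = gen_ideal (patch \<sigma> \<tau>) (X \<tau>))"

definition scheme_dim :: "('q::finite, 'k::field) ideal_sheaf \<Rightarrow> enat" where
  "scheme_dim X = (SUP \<sigma>. krull_dim (patch \<sigma> \<sigma>) (X \<sigma>))"

text \<open>Nonemptiness is stated separately because \<open>scheme_dim\<close> is 0 on the empty scheme.\<close>

definition zero_dimensional :: "('q::finite, 'k::field) ideal_sheaf \<Rightarrow> bool" where
  "zero_dimensional X \<longleftrightarrow> closed_subscheme X \<and> (\<exists>\<sigma>. X \<sigma> \<noteq> patch \<sigma> \<sigma>) \<and> scheme_dim X = 0"

text \<open>
  For a form \<open>F\<close> of degree \<open>a\<close>, \<open>restrict_form \<sigma> F\<close> is the regular function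
  $F / \prod_i x_{i,\sigma(i)}^{a_i}$ on $U_\sigma$, written in the $t_i$.
\<close>

definition restrict_form :: "('q::finite \<Rightarrow> bool) \<Rightarrow> ('q, 'k::field) cox \<Rightarrow> ('q, 'k) laurent" where
  "restrict_form \<sigma> F = (\<Sum>m\<in>Poly_Mapping.keys F. Poly_Mapping.single
     (\<chi> i. if \<sigma> i then - int (Poly_Mapping.lookup m (i, False))
           else int (Poly_Mapping.lookup m (i, True)))
     (Poly_Mapping.lookup F m))"

definition vanishes_on :: "('q::finite, 'k::field) cox \<Rightarrow> ('q, 'k) ideal_sheaf \<Rightarrow> bool" where
  "vanishes_on F X \<longleftrightarrow> (\<forall>\<sigma>. restrict_form \<sigma> F \<in> X \<sigma>)"

definition vanishing_ideal :: "('q::finite, 'k::field) ideal_sheaf \<Rightarrow> ('q, 'k) cox set" where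
  "vanishing_ideal X = gen_ideal UNIV {F. \<exists>a. F \<in> forms a \<and> vanishes_on F X}"

definition ACM :: "('q::finite, 'k::field) ideal_sheaf \<Rightarrow> bool" where
  "ACM X \<longleftrightarrow> depth var_ideal (vanishing_ideal X) = krull_dim UNIV (vanishing_ideal X) \<and>
     krull_dim UNIV (vanishing_ideal X) = enat CARD('q)"

section \<open>Hilbert functions\<close>

text \<open>\<open>B\<close> represents a basis of the image of the linear subspace \<open>V\<close> in the quotient by \<open>I\<close>.\<close>

definition basis_mod ::
  "('q::finite, 'k::field) cox set \<Rightarrow> ('q, 'k) cox set \<Rightarrow> ('q, 'k) cox set \<Rightarrow> bool" where
  "basis_mod V I B \<longleftrightarrow> finite B \<and> B \<subseteq> V \<and>
     (\<forall>f\<in>V. \<exists>c. f - (\<Sum>b\<in>B. const (c b) * b) \<in> I) \<and>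
     (\<forall>c. (\<Sum>b\<in>B. const (c b) * b) \<in> I \<longrightarrow> (\<forall>b\<in>B. c b = 0))"

definition dim_mod :: "('q::finite, 'k::field) cox set \<Rightarrow> ('q, 'k) cox set \<Rightarrow> nat" where
  "dim_mod V I = (THE n. \<exists>B. basis_mod V I B \<and> card B = n)"

definition hilbert_fun :: "('q::finite, 'k::field) ideal_sheaf \<Rightarrow> int ^ 'q \<Rightarrow> int" where
  "hilbert_fun X a = int (dim_mod (forms a) (vanishing_ideal X))"

definition difference :: "(int ^ 'q::finite \<Rightarrow> int) \<Rightarrow> int ^ 'q \<Rightarrow> int" where
  "difference F a = F a +
     (\<Sum>p = 1..CARD('q). (-1) ^ p * (\<Sum>P | card P = p. F (a - (\<Sum>i\<in>P. axis i 1))))"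

definition quasi_rectangular :: "(int ^ 'q::finite) set \<Rightarrow> bool" where
  "quasi_rectangular Q \<longleftrightarrow> (\<exists>R. finite R \<and> (\<forall>r\<in>R. 0 \<le> r) \<and> Q = (\<Union>r\<in>R. {0..r}))"

end

theory Submission
  imports Defs "HOL-Library.Sublist" "HOL-Algebra.Algebraic_Closure_Type"
begin

text \<open>
  Let \<open>X\<close> be zero-dimensional and ACM with ideal \<open>I\<close>. By a form of the Nullstellensatz each affine
  coordinate satisfies a polynomial equation on \<open>X\<close>, so there are linear forms $l_i$ of degree $e_i$
  such that every variable is nilpotent modulo $J = I + (l_1, \dots, l_q)$. As the depth is \<open>q\<close>, the
  Koszul complex of the $l_i$ on $S/I$ is acyclic, and by a graded Nakayama argument the $l_i$ form a
  regular sequence. Hence $\Delta H_X$ is the Hilbert function of $S/J$, a quotient of a polynomial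
  ring with one variable in each degree $e_i$ by a monomial ideal of finite colength.

  Conversely let \<open>X\<close> be the set of the points $(c_{u_1}, \dots, c_{u_q})$ for \<open>u \<in> Q\<close>, with
  distinct nonzero $c_j$. Its ideal is obtained from the monomial ideal of the complement of \<open>Q\<close> in
  the variables $x_{i1}$ by replacing $x_{i1}^n$ by $\prod_{j<n} (x_{i1} - c_j x_{i0})$. Hence the
  $x_{i0}$ form a regular sequence, and the quotient by them is the quotient by that monomial ideal.
\<close>

text \<open>The depth hypothesis supplies a regular sequence of length q in the ideal of the
  variables whose members need be neither linear nor homogeneous, while the Hilbert function is
  computed with the l_i; the Koszul complex mediates between the two. Each member f has a power in I
  + (l_1, ..., l_q), so f acts nilpotently on the Koszul homology of the l_i, and therefore every
  member lowers by one the degree from which this homology is known to vanish. With q members it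
  vanishes from degree 1 on; with q + 1 it would vanish in degree 0 too, putting 1 into I + (l_1,
  ..., l_q). The latter remark bounds the depth from above in the converse. That the field is
  infinite serves twice: l_i = x_{i1} - c_i x_{i0} has to miss all points of X, also those over the
  algebraic closure, and grids of every size need enough values c_j. The converse also asks for the
  Krull dimension of S/I. There the upper bound comes from counting monomials, which replaces
  transcendence degrees.\<close>

no_notation Polynomials.var (\<open>X\<index>\<close>)
hide_const (open) Polynomials.var

abbreviation lookup :: "('a \<Rightarrow>\<^sub>0 'b::zero) \<Rightarrow> 'a \<Rightarrow> 'b" where
  "lookup \<equiv> Poly_Mapping.lookup"

abbreviation single :: "'a \<Rightarrow> 'b \<Rightarrow> 'a \<Rightarrow>\<^sub>0 'b::zero" where
  "single \<equiv> Poly_Mapping.single"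

abbreviation keys :: "('a \<Rightarrow>\<^sub>0 'b::zero) \<Rightarrow> 'a set" where
  "keys \<equiv> Poly_Mapping.keys"

section \<open>Ideals\<close>

lemma ideal_ofD:
  assumes "ideal_of R I"
  shows "I \<subseteq> R" "0 \<in> I" "\<And>x y. x \<in> I \<Longrightarrow> y \<in> I \<Longrightarrow> x + y \<in> I"
    "\<And>r x. r \<in> R \<Longrightarrow> x \<in> I \<Longrightarrow> r * x \<in> I"
  using assms by (auto simp: ideal_of_def)

lemma ideal_UNIV_uminus: "ideal_of UNIV I \<Longrightarrow> x \<in> I \<Longrightarrow> - x \<in> I"
  using ideal_ofD(4)[of UNIV I "-1" x] by simp

lemma ideal_UNIV_diff: "ideal_of UNIV I \<Longrightarrow> x \<in> I \<Longrightarrow> y \<in> I \<Longrightarrow> x - y \<in> I"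
  using ideal_ofD(3)[of UNIV I x "-y"] ideal_UNIV_uminus[of I y] by simp

lemma ideal_sum:
  assumes "ideal_of R I" "\<And>x. x \<in> A \<Longrightarrow> f x \<in> I"
  shows "sum f A \<in> I"
  using assms(2) by (induction A rule: infinite_finite_induct) (auto simp: ideal_ofD[OF assms(1)])

lemma ideal_UNIV_mult:
  assumes "ideal_of UNIV I" "x \<in> I"
  shows "r * x \<in> I" "x * r \<in> I"
  using ideal_ofD(4)[OF assms(1) UNIV_I assms(2), of r] by (simp_all add: mult.commute)

lemma ideal_UNIV_mem_cong:
  assumes "ideal_of UNIV I" "x - y \<in> I"
  shows "x \<in> I \<longleftrightarrow> y \<in> I"
proof
  assume "x \<in> I" then have "x - (x - y) \<in> I" using assms ideal_UNIV_diff by blast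
  then show "y \<in> I" by simp
next
  assume "y \<in> I" then have "(x - y) + y \<in> I" using assms ideal_ofD(3) by blast
  then show "x \<in> I" by simp
qed

lemma ideal_of_gen_ideal [simp]: "ideal_of UNIV (gen_ideal UNIV B)"
  unfolding ideal_of_def gen_ideal_def by blast

lemma gen_ideal_superset: "B \<subseteq> gen_ideal R B"
  unfolding gen_ideal_def by blast

lemma gen_ideal_least: "ideal_of R I \<Longrightarrow> B \<subseteq> I \<Longrightarrow> gen_ideal R B \<subseteq> I"
  unfolding gen_ideal_def by blast

lemma gen_ideal_mono: "B \<subseteq> C \<Longrightarrow> gen_ideal R B \<subseteq> gen_ideal R C"
  unfolding gen_ideal_def by blast

lemma gen_ideal_idem: "ideal_of R I \<Longrightarrow> gen_ideal R I = I"
  using gen_ideal_superset gen_ideal_least by blast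

lemma gen_ideal_insert:
  "gen_ideal UNIV (insert f B) = {x + f * r | x r. x \<in> gen_ideal UNIV B}" (is "?L = ?R")
proof
  have "ideal_of UNIV ?R"
    unfolding ideal_of_def
  proof (intro conjI ballI)
    have "0 + f * 0 \<in> ?R" using ideal_ofD(2)[OF ideal_of_gen_ideal] by blast
    then show "0 \<in> ?R" by simp
  next
    fix u v assume "u \<in> ?R" "v \<in> ?R"
    then obtain x r y s where *: "u = x + f * r" "v = y + f * s" "x \<in> gen_ideal UNIV B" "y \<in> gen_ideal UNIV B"
      by blast
    then have "u + v = (x + y) + f * (r + s)" "x + y \<in> gen_ideal UNIV B"
      using ideal_ofD(3)[OF ideal_of_gen_ideal] by (auto simp: algebra_simps)
    then show "u + v \<in> ?R" by blast
  next
    fix r u assume "u \<in> ?R"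
    then obtain x s where *: "u = x + f * s" "x \<in> gen_ideal UNIV B"
      by blast
    then have "r * u = r * x + f * (r * s)" "r * x \<in> gen_ideal UNIV B"
      using ideal_ofD(4)[OF ideal_of_gen_ideal] by (auto simp: algebra_simps)
    then show "r * u \<in> ?R" by blast
  qed simp
  moreover have "insert f B \<subseteq> ?R"
  proof -
    have "0 + f * 1 \<in> ?R" using ideal_ofD(2)[OF ideal_of_gen_ideal] by blast
    moreover have "x + f * 0 \<in> ?R" if "x \<in> B" for x
      using that gen_ideal_superset[of B UNIV] by blast
    ultimately show ?thesis by auto
  qed
  ultimately show "?L \<subseteq> ?R" by (rule gen_ideal_least)
next
  show "?R \<subseteq> ?L"
  proof safe
    fix x r assume "x \<in> gen_ideal UNIV B"
    then have "x \<in> ?L" using gen_ideal_mono[of B "insert f B"] by blast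
    moreover have "f * r \<in> ?L" using gen_ideal_superset[of "insert f B" UNIV]
      by (auto intro!: ideal_UNIV_mult)
    ultimately show "x + f * r \<in> ?L" by (simp add: ideal_ofD(3)[of UNIV])
  qed
qed

definition nonzerodivisor_mod :: "'a::comm_ring_1 \<Rightarrow> 'a set \<Rightarrow> bool" where
  "nonzerodivisor_mod f I \<longleftrightarrow> (\<forall>g. f * g \<in> I \<longrightarrow> g \<in> I)"

section \<open>Koszul homology\<close>

text \<open>
  A chain of the Koszul complex of a sequence of length \<open>n\<close> is a function on \<open>bool list\<close>s of
  length \<open>n\<close>, a list encoding the subset of indices at which it is \<open>True\<close>. Writing
  $c = c_0 + e \wedge c_1$ with $e$ the first basis vector makes the differential a recursion on the
  sequence in which no sign depends on positions.
\<close>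

fun koszul :: "'a::comm_ring_1 list \<Rightarrow> (bool list \<Rightarrow> 'a) \<Rightarrow> bool list \<Rightarrow> 'a" where
  "koszul (x # xs) c (b # s) =
     (if b then - koszul xs (\<lambda>t. c (True # t)) s
      else koszul xs (\<lambda>t. c (False # t)) s + x * c (True # s))"
| "koszul _ c _ = 0"

text \<open>Left exterior multiplication by the degree-one chain with coordinates \<open>as\<close>;
  the minus sign comes from moving the first basis vector past the later ones. It serves as the
  homotopy below.\<close>

fun wedge :: "'a::comm_ring_1 list \<Rightarrow> (bool list \<Rightarrow> 'a) \<Rightarrow> bool list \<Rightarrow> 'a" where
  "wedge (a # as) c (b # s) =
     (if b then a * c (False # s) - wedge as (\<lambda>t. c (True # t)) s
      else wedge as (\<lambda>t. c (False # t)) s)"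
| "wedge _ c _ = 0"

lemma koszul_add: "koszul xs (\<lambda>t. c t + d t) s = koszul xs c s + koszul xs d s"
  by (induction xs c s arbitrary: d rule: koszul.induct) (auto simp: distrib_left)

lemma koszul_uminus: "koszul xs (\<lambda>t. - c t) s = - koszul xs c s"
  by (induction xs c s rule: koszul.induct) (auto simp: algebra_simps)

lemma koszul_diff: "koszul xs (\<lambda>t. c t - d t) s = koszul xs c s - koszul xs d s"
  using koszul_add[of xs c "\<lambda>t. - d t" s] by (simp add: koszul_uminus)

lemma koszul_mult: "koszul xs (\<lambda>t. r * c t) s = r * koszul xs c s"
  by (induction xs c s rule: koszul.induct) (auto simp: algebra_simps)

lemma koszul_zero: "koszul xs (\<lambda>t. 0) s = 0"
  using koszul_mult[of xs 0 "\<lambda>t. 0" s] by simp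

lemma koszul_sum: "koszul xs (\<lambda>t. \<Sum>e\<in>A. c e t) s = (\<Sum>e\<in>A. koszul xs (c e) s)"
  by (induction A rule: infinite_finite_induct) (auto simp: koszul_zero koszul_add)

text \<open>The differential lowers the number of \<open>True\<close>s by one, so only the values of
  \<open>c\<close> one degree above \<open>s\<close> enter. Congruences modulo \<open>I\<close> thus
  need to be known in a single degree only.\<close>

lemma koszul_mem:
  assumes I: "ideal_of UNIV I"
  shows "length s = length xs \<Longrightarrow>
    (\<And>t. length t = length xs \<Longrightarrow> count_list t True = Suc (count_list s True) \<Longrightarrow> c t \<in> I) \<Longrightarrow>
    koszul xs c s \<in> I"
proof (induction xs c s rule: koszul.induct)
  case (1 x xs c b s)
  show ?case
  proof (cases b)
    case True
    have "koszul xs (\<lambda>t. c (True # t)) s \<in> I"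
      using True 1 by auto
    then show ?thesis using True I by (simp add: ideal_UNIV_uminus)
  next
    case False
    have "koszul xs (\<lambda>t. c (False # t)) s \<in> I"
      using False 1 by auto
    moreover have "c (True # s) \<in> I"
      using False 1 by auto
    ultimately show ?thesis using False I
      by (simp add: ideal_UNIV_mult ideal_ofD(3))
  qed
qed (auto simp: ideal_ofD[OF I])

lemma wedge_mem:
  assumes I: "ideal_of UNIV I"
  shows "length s = length xs \<Longrightarrow>
    (\<And>t. length t = length xs \<Longrightarrow> Suc (count_list t True) = count_list s True \<Longrightarrow> c t \<in> I) \<Longrightarrow>
    wedge xs c s \<in> I"
proof (induction xs c s rule: wedge.induct)
  case (1 x xs c b s)
  show ?case
  proof (cases b)
    case True
    have "wedge xs (\<lambda>t. c (True # t)) s \<in> I"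
      using True 1 by auto
    moreover have "c (False # s) \<in> I"
      using True 1 by auto
    ultimately show ?thesis using True I by (simp add: ideal_UNIV_diff ideal_UNIV_mult)
  next
    case False
    have "wedge xs (\<lambda>t. c (False # t)) s \<in> I"
      using False 1 by auto
    then show ?thesis using False by simp
  qed
qed (auto simp: ideal_ofD[OF I])

lemma koszul_koszul: "length s = length xs \<Longrightarrow> koszul xs (koszul xs c) s = 0"
proof (induction xs c s rule: koszul.induct)
  case (1 x xs c b s)
  then show ?case by (auto simp: koszul_add koszul_mult koszul_uminus)
qed auto

lemma wedge_add: "wedge xs (\<lambda>t. c t + d t) s = wedge xs c s + wedge xs d s"
  by (induction xs c s arbitrary: d rule: wedge.induct) (auto simp: distrib_left)

lemma wedge_uminus: "wedge xs (\<lambda>t. - c t) s = - wedge xs c s"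
  by (induction xs c s rule: wedge.induct) (auto simp: algebra_simps)

lemma wedge_mult: "wedge xs (\<lambda>t. r * c t) s = r * wedge xs c s"
  by (induction xs c s rule: wedge.induct) (auto simp: algebra_simps)

text \<open>The differential is an antiderivation, so in the sum of both compositions only
  multiplication by its value on the chain \<open>as\<close> remains. Hence the ideal of
  \<open>xs\<close> acts as zero on Koszul homology.\<close>

lemma koszul_homotopy:
  "length as = length xs \<Longrightarrow> length s = length xs \<Longrightarrow>
   koszul xs (wedge as c) s + wedge as (koszul xs c) s = sum_list (map2 (*) as xs) * c s"
proof (induction as xs arbitrary: c s rule: list_induct2)
  case (Cons a as x xs)
  obtain b t where s: "s = b # t" "length t = length xs"
    using Cons.prems by (cases s) auto
  have IH: "wedge as (koszul xs d) t = sum_list (map2 (*) as xs) * d t - koszul xs (wedge as d) t" for d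
    using Cons.IH[OF s(2), of d] by (simp add: algebra_simps)
  show ?case
    by (cases b) (simp_all add: s koszul_add koszul_diff koszul_mult koszul_uminus
        wedge_add wedge_mult wedge_uminus IH algebra_simps)
qed auto

text \<open>Vanishing of the p-th Koszul homology of the quotient by \<open>I\<close>, expressed by
  representatives in the ring itself. For \<open>p = 0\<close> the cycle condition is empty, since
  no \<open>Suc\<close> is 0.\<close>

definition koszul_exact :: "'a::comm_ring_1 list \<Rightarrow> nat \<Rightarrow> 'a set \<Rightarrow> bool" where
  "koszul_exact xs p I \<longleftrightarrow> (\<forall>c.
     (\<forall>s. length s = length xs \<and> Suc (count_list s True) = p \<longrightarrow> koszul xs c s \<in> I) \<longrightarrow>
     (\<exists>b. \<forall>s. length s = length xs \<and> count_list s True = p \<longrightarrow> c s - koszul xs b s \<in> I))"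

lemma koszul_exact_gt_length: "length xs < p \<Longrightarrow> koszul_exact xs p I"
  unfolding koszul_exact_def using count_le_length[of _ True]
  by (metis not_le)

lemma gen_ideal_Un_list:
  assumes I: "ideal_of UNIV I"
  shows "x \<in> gen_ideal UNIV (I \<union> set xs) \<longleftrightarrow>
    (\<exists>as i. length as = length xs \<and> i \<in> I \<and> x = i + sum_list (map2 (*) as xs))"
proof (induction xs arbitrary: x)
  case Nil
  then show ?case using I by (auto simp: gen_ideal_idem)
next
  case (Cons y ys)
  have "x \<in> gen_ideal UNIV (I \<union> set (y # ys)) \<longleftrightarrow>
      (\<exists>z r. x = z + y * r \<and> z \<in> gen_ideal UNIV (I \<union> set ys))"
    by (simp add: gen_ideal_insert)
  also have "\<dots> \<longleftrightarrow> (\<exists>as i r. length as = length ys \<and> i \<in> I \<and> x = i + (r * y + sum_list (map2 (*) as ys)))"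
    (is "?L = ?R")
  proof
    assume ?L
    then obtain as i z r where "length as = length ys" "i \<in> I" "z = i + sum_list (map2 (*) as ys)" "x = z + y * r"
      unfolding Cons.IH by blast
    then show ?R by (intro exI[of _ as] exI[of _ i] exI[of _ r]) (simp add: algebra_simps)
  next
    assume ?R
    then obtain as i r where "length as = length ys" "i \<in> I" "x = i + (r * y + sum_list (map2 (*) as ys))"
      by blast
    then show ?L unfolding Cons.IH
      by (intro exI[of _ "i + sum_list (map2 (*) as ys)"] exI[of _ r]) (auto simp: algebra_simps)
  qed
  also have "\<dots> \<longleftrightarrow> (\<exists>as i. length as = length (y # ys) \<and> i \<in> I \<and> x = i + sum_list (map2 (*) as (y # ys)))"
    (is "?L = ?R")
  proof
    assume ?L
    then obtain as i r where "length as = length ys" "i \<in> I" "x = i + (r * y + sum_list (map2 (*) as ys))"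
      by blast
    then show ?R by (intro exI[of _ "r # as"] exI[of _ i]) simp
  next
    assume ?R
    then obtain as i where *: "length as = length (y # ys)" "i \<in> I" "x = i + sum_list (map2 (*) as (y # ys))"
      by blast
    then obtain r bs where "as = r # bs" by (cases as) auto
    with * show ?L by (intro exI[of _ bs] exI[of _ i] exI[of _ r]) simp
  qed
  finally show ?case .
qed

text \<open>The long exact sequence for multiplication by \<open>f\<close>, of which a power is null-homotopic.\<close>

lemma koszul_exact_descend:
  assumes I: "ideal_of UNIV I"
    and f: "nonzerodivisor_mod f I" "f ^ N \<in> gen_ideal UNIV (I \<union> set xs)"
    and ex: "koszul_exact xs (Suc p) (gen_ideal UNIV (insert f I))"
  shows "koszul_exact xs p I"
  unfolding koszul_exact_def
proof (intro allI impI)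
  fix z assume z: "\<forall>s. length s = length xs \<and> Suc (count_list s True) = p \<longrightarrow> koszul xs z s \<in> I"
  let ?bd = "\<lambda>z. \<exists>b. \<forall>s. length s = length xs \<and> count_list s True = p \<longrightarrow> z s - koszul xs b s \<in> I"
  have fI: "gen_ideal UNIV (insert f I) = {x + f * r | x r. x \<in> I}"
    using I by (simp add: gen_ideal_insert gen_ideal_idem)
  \<comment> \<open>If \<open>f z = d w\<close> modulo \<open>I\<close>, then \<open>w\<close> is a
    cycle modulo \<open>I + (f)\<close>, so exactness one degree higher gives
    \<open>w = d v + f u\<close> modulo \<open>I\<close>. Applying \<open>d\<close> yields
    \<open>f z = f d u\<close>, and \<open>f\<close> cancels.\<close>
  have step: "?bd z" if cyc: "\<forall>s. length s = length xs \<and> Suc (count_list s True) = p \<longrightarrow> koszul xs z s \<in> I"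
    and fz: "?bd (\<lambda>s. f * z s)" for z
  proof -
    obtain w where w: "\<And>s. length s = length xs \<Longrightarrow> count_list s True = p \<Longrightarrow> f * z s - koszul xs w s \<in> I"
      using fz by blast
    have "koszul xs w s \<in> gen_ideal UNIV (insert f I)"
      if "length s = length xs" "Suc (count_list s True) = Suc p" for s
    proof -
      have "koszul xs w s = - (f * z s - koszul xs w s) + f * z s" by simp
      moreover have "- (f * z s - koszul xs w s) \<in> I"
        using w[of s] that I ideal_UNIV_uminus by blast
      ultimately show ?thesis unfolding fI by blast
    qed
    then obtain v where v: "\<And>s. length s = length xs \<Longrightarrow> count_list s True = Suc p \<Longrightarrow>
        w s - koszul xs v s \<in> gen_ideal UNIV (insert f I)"
      using ex unfolding koszul_exact_def by metis
    have "\<exists>u. length s = length xs \<longrightarrow> count_list s True = Suc p \<longrightarrow>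
        w s - koszul xs v s - f * u \<in> I" for s
    proof (cases "length s = length xs \<and> count_list s True = Suc p")
      case True
      then obtain i u where "i \<in> I" "w s - koszul xs v s = i + f * u"
        using v[of s] unfolding fI by blast
      then show ?thesis by (intro exI[of _ u]) simp
    qed auto
    then obtain u where u: "\<And>s. length s = length xs \<Longrightarrow> count_list s True = Suc p \<Longrightarrow>
        w s - koszul xs v s - f * u s \<in> I" by metis
    have "z s - koszul xs u s \<in> I" if s: "length s = length xs" "count_list s True = p" for s
    proof -
      have "koszul xs (\<lambda>t. w t - koszul xs v t - f * u t) s \<in> I"
        by (rule koszul_mem[OF I]) (use u s in auto)
      then have "koszul xs w s - f * koszul xs u s \<in> I"
        by (simp add: koszul_diff koszul_mult koszul_koszul s)
      with w[OF s] have "(f * z s - koszul xs w s) + (koszul xs w s - f * koszul xs u s) \<in> I"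
        by (rule ideal_ofD(3)[OF I])
      then have "f * (z s - koszul xs u s) \<in> I" by (simp add: algebra_simps)
      then show ?thesis using f(1) by (simp add: nonzerodivisor_mod_def)
    qed
    then show ?thesis by blast
  qed
  have "?bd z" if "?bd (\<lambda>s. f ^ n * z s)" for n
    using that
  proof (induction n)
    case (Suc n)
    have "?bd (\<lambda>s. f ^ n * z s)"
    proof (rule step)
      show "\<forall>s. length s = length xs \<and> Suc (count_list s True) = p \<longrightarrow> koszul xs (\<lambda>s. f ^ n * z s) s \<in> I"
        using z I by (auto simp: koszul_mult intro: ideal_UNIV_mult)
      show "?bd (\<lambda>s. f * (f ^ n * z s))" using Suc.prems by (simp add: mult.assoc)
    qed
    then show ?case by (rule Suc.IH)
  qed simp
  moreover have "?bd (\<lambda>s. f ^ N * z s)"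
  proof -
    obtain as i where as: "length as = length xs" "i \<in> I" "f ^ N = i + sum_list (map2 (*) as xs)"
      using f(2) gen_ideal_Un_list[OF I] by blast
    have "f ^ N * z s - koszul xs (wedge as z) s \<in> I"
      if s: "length s = length xs" "count_list s True = p" for s
    proof -
      have "f ^ N * z s - koszul xs (wedge as z) s = i * z s + wedge as (koszul xs z) s"
        using koszul_homotopy[OF as(1) s(1), of z] as(3) by (simp add: algebra_simps)
      moreover have "wedge as (koszul xs z) s \<in> I"
        by (rule wedge_mem[OF I]) (use s z as in auto)
      ultimately show ?thesis using as(2) I by (auto intro!: ideal_ofD(3)[OF I] ideal_UNIV_mult)
    qed
    then show ?thesis by blast
  qed
  ultimately show "?bd z" by blast
qed

text \<open>Every 0-chain is a cycle, so the constant chain 1 is a boundary, and values of the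
  differential are combinations of \<open>xs\<close>. This is what refutes a regular sequence longer
  than \<open>xs\<close>.\<close>

lemma koszul_exact_0: "ideal_of UNIV I \<Longrightarrow> koszul_exact xs 0 I \<Longrightarrow> 1 \<in> gen_ideal UNIV (I \<union> set xs)"
proof -
  assume I: "ideal_of UNIV I" and "koszul_exact xs 0 I"
  then have "\<exists>b. \<forall>s. length s = length xs \<and> count_list s True = 0 \<longrightarrow> 1 - koszul xs b s \<in> I"
    unfolding koszul_exact_def by (auto dest: spec[of _ "\<lambda>_. 1"])
  then obtain b where b: "\<And>s. length s = length xs \<Longrightarrow> count_list s True = 0 \<Longrightarrow> 1 - koszul xs b s \<in> I"
    by blast
  have "koszul xs b s \<in> gen_ideal UNIV (I \<union> set xs)" for s
  proof (induction xs b s rule: koszul.induct)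
    case (1 x xs c b s)
    have "gen_ideal UNIV (I \<union> set xs) \<subseteq> gen_ideal UNIV (I \<union> set (x # xs))"
      by (rule gen_ideal_mono) auto
    moreover have "x \<in> gen_ideal UNIV (I \<union> set (x # xs))"
      using gen_ideal_superset[of "I \<union> set (x # xs)" UNIV] by auto
    ultimately show ?case using 1
      by (auto intro!: ideal_ofD(3)[OF ideal_of_gen_ideal] ideal_UNIV_uminus ideal_UNIV_mult)
  qed (auto simp: ideal_ofD(2)[OF ideal_of_gen_ideal])
  moreover have "1 - koszul xs b (replicate (length xs) False) \<in> gen_ideal UNIV (I \<union> set xs)"
    using b[of "replicate (length xs) False"] gen_ideal_superset[of "I \<union> set xs" UNIV]
    by (auto simp: count_list_0_iff)
  ultimately show ?thesis
    by (metis diff_add_cancel ideal_ofD(3) ideal_of_gen_ideal)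
qed

text \<open>The all-\<open>False\<close> list is the only index in degree 0. The witness takes at a
  list the coefficient that belongs to the position of its first \<open>True\<close>.\<close>

lemma koszul_replicate_False:
  assumes "length as = length xs"
  obtains c where "koszul xs c (replicate (length xs) False) = sum_list (map2 (*) as xs)"
proof -
  have "\<exists>c. koszul xs c (replicate (length xs) False) = sum_list (map2 (*) as xs)"
    using assms
  proof (induction as xs rule: list_induct2)
    case (Cons a as x xs)
    then obtain c where "koszul xs c (replicate (length xs) False) = sum_list (map2 (*) as xs)" by blast
    then show ?case
      by (intro exI[of _ "\<lambda>s. if hd s then a else c (tl s)"]) (simp add: algebra_simps)
  qed simp
  then show ?thesis using that by blast
qed

lemma koszul_replicate_False_mem:
  assumes I: "ideal_of UNIV I" "I \<subseteq> J" "ideal_of UNIV J" "set xs \<subseteq> J"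
  shows "koszul xs c s \<in> J"
  using assms(4)
proof (induction xs c s rule: koszul.induct)
  case (1 x xs c b s)
  then show ?case using I(3)
    by (auto intro!: ideal_ofD(3)[OF I(3)] ideal_UNIV_uminus ideal_UNIV_mult)
qed (auto simp: ideal_ofD(2)[OF I(3)])

text \<open>A relation between \<open>x g\<close> and the members of \<open>xs\<close> modulo
  \<open>I\<close> is a 1-cycle whose coordinate at \<open>x\<close> is \<open>g\<close>. As the
  cycle is a boundary, this coordinate is, up to sign and modulo \<open>I\<close>, a Koszul
  differential for \<open>xs\<close>, hence in the ideal of \<open>xs\<close>.\<close>

lemma koszul_exact_1_nonzerodivisor:
  assumes I: "ideal_of UNIV I" and ex: "koszul_exact (x # xs) 1 I"
  shows "nonzerodivisor_mod x (gen_ideal UNIV (I \<union> set xs))"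
  unfolding nonzerodivisor_mod_def
proof (intro allI impI)
  let ?J = "gen_ideal UNIV (I \<union> set xs)"
  let ?F = "replicate (length xs) False"
  fix g assume "x * g \<in> ?J"
  then obtain as i where as: "length as = length xs" "i \<in> I" "x * g = i + sum_list (map2 (*) as xs)"
    using gen_ideal_Un_list[OF I] by blast
  obtain c where c: "koszul xs c ?F = sum_list (map2 (*) as xs)"
    using koszul_replicate_False[OF as(1)] by blast
  define z where "z = (\<lambda>s. if hd s then g else - c (tl s))"
  have 0: "s = False # ?F" if "length s = length (x # xs)" "count_list s True = 0" for s
  proof -
    have "True \<notin> set s" using that by (simp add: count_list_0_iff)
    then have "s = replicate (length (x # xs)) False"
      using that(1) by (intro replicate_eqI) auto
    then show ?thesis by simp
  qed
  have "koszul (x # xs) z (False # ?F) = i"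
    using as(3) c by (simp add: z_def koszul_uminus)
  then have "\<forall>s. length s = length (x # xs) \<and> Suc (count_list s True) = 1 \<longrightarrow> koszul (x # xs) z s \<in> I"
    using 0 as(2) by force
  then obtain b where b: "\<And>s. length s = length (x # xs) \<Longrightarrow> count_list s True = 1 \<Longrightarrow>
      z s - koszul (x # xs) b s \<in> I"
    using ex unfolding koszul_exact_def by metis
  have "z (True # ?F) - koszul (x # xs) b (True # ?F) \<in> I"
    by (rule b) (auto simp: count_list_0_iff)
  then have "g + koszul xs (\<lambda>t. b (True # t)) ?F \<in> I" by (simp add: z_def)
  then have "g + koszul xs (\<lambda>t. b (True # t)) ?F \<in> ?J"
    using gen_ideal_superset[of "I \<union> set xs" UNIV] by auto
  moreover have "koszul xs (\<lambda>t. b (True # t)) ?F \<in> ?J"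
    by (rule koszul_replicate_False_mem[OF I]) (use gen_ideal_superset[of "I \<union> set xs" UNIV] in auto)
  ultimately show "g \<in> ?J"
    by (metis add_diff_cancel_right' ideal_UNIV_diff ideal_of_gen_ideal)
qed

section \<open>Monoid algebras\<close>

lemma poly_mapping_sum_single:
  fixes f :: "'m \<Rightarrow>\<^sub>0 'k::comm_monoid_add"
  shows "f = (\<Sum>m\<in>keys f. single m (lookup f m))"
proof (rule poly_mapping_eqI)
  fix k
  have "lookup (\<Sum>m\<in>keys f. single m (lookup f m)) k
      = (\<Sum>m\<in>keys f. if m = k then lookup f k else 0)"
    by (auto simp: lookup_sum lookup_single when_def intro!: sum.cong)
  then show "lookup f k =
      lookup (\<Sum>m\<in>keys f. single m (lookup f m)) k"
    by (simp add: in_keys_iff)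
qed

lemma poly_mapping_induct_sum [case_names single add]:
  fixes f :: "'m \<Rightarrow>\<^sub>0 'k::comm_monoid_add"
  assumes "\<And>m c. P (single m c)" "\<And>f g. P f \<Longrightarrow> P g \<Longrightarrow> P (f + g)"
  shows "P f"
proof -
  have "P (\<Sum>m\<in>A. single m (lookup f m))" if "finite A" for A
    using that
  proof induction
    case empty
    then show ?case using assms(1)[of undefined 0] by simp
  qed (auto intro: assms)
  then show ?thesis by (metis finite_keys poly_mapping_sum_single)
qed

definition lift :: "('k::comm_ring_1 \<Rightarrow> 'b::comm_ring_1) \<Rightarrow> ('m \<Rightarrow> 'b) \<Rightarrow> ('m \<Rightarrow>\<^sub>0 'k) \<Rightarrow> 'b" where
  "lift h \<mu> f = (\<Sum>m\<in>keys f. h (lookup f m) * \<mu> m)"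

text \<open>No multiplicativity is asked of \<open>\<mu>\<close> at this stage, because
  \<open>distract\<close> below is linear without being a ring homomorphism.\<close>

locale coefficient_hom =
  fixes h :: "'k::comm_ring_1 \<Rightarrow> 'b::comm_ring_1" and \<mu> :: "'m \<Rightarrow> 'b"
  assumes h_add: "h (x + y) = h x + h y" and h_mult: "h (x * y) = h x * h y" and h_1: "h 1 = 1"
begin

lemma h_0: "h 0 = 0"
  using h_add[of 0 0] by simp

lemma lift_superset:
  "finite A \<Longrightarrow> keys f \<subseteq> A \<Longrightarrow> lift h \<mu> f = (\<Sum>m\<in>A. h (lookup f m) * \<mu> m)"
  unfolding lift_def by (rule sum.mono_neutral_left) (auto simp: in_keys_iff h_0)

lemma lift_add: "lift h \<mu> (f + g) = lift h \<mu> f + lift h \<mu> g"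
proof -
  let ?A = "keys f \<union> keys g"
  have "lift h \<mu> (f + g) = (\<Sum>m\<in>?A. h (lookup (f + g) m) * \<mu> m)"
    by (rule lift_superset) (auto simp: in_keys_iff lookup_add)
  also have "\<dots> = (\<Sum>m\<in>?A. h (lookup f m) * \<mu> m) + (\<Sum>m\<in>?A. h (lookup g m) * \<mu> m)"
    by (simp add: lookup_add h_add distrib_right sum.distrib)
  also have "\<dots> = lift h \<mu> f + lift h \<mu> g"
    by (simp add: lift_superset[of ?A])
  finally show ?thesis .
qed

lemma lift_single: "lift h \<mu> (single m c) = h c * \<mu> m"
  by (subst lift_superset[of "{m}"]) auto

lemma lift_0: "lift h \<mu> 0 = 0"
  by (simp add: lift_def)

lemma lift_sum: "lift h \<mu> (sum f A) = (\<Sum>a\<in>A. lift h \<mu> (f a))"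
  by (induction A rule: infinite_finite_induct) (auto simp: lift_0 lift_add)

lemma lift_uminus: "lift h \<mu> (- f) = - lift h \<mu> f"
  using lift_add[of f "- f"] by (simp add: lift_0 eq_neg_iff_add_eq_0 add.commute)

lemma lift_diff: "lift h \<mu> (f - g) = lift h \<mu> f - lift h \<mu> g"
  using lift_add[of f "- g"] by (simp add: lift_uminus)

end

locale monoid_algebra_hom = coefficient_hom h \<mu>
  for h :: "'k::comm_ring_1 \<Rightarrow> 'b::comm_ring_1" and \<mu> :: "'m::comm_monoid_add \<Rightarrow> 'b" +
  assumes \<mu>_0: "\<mu> 0 = 1" and \<mu>_add: "\<mu> (m + n) = \<mu> m * \<mu> n"
begin

lemma lift_1: "lift h \<mu> 1 = 1"
  using lift_single[of 0 1] by (simp add: h_1 \<mu>_0)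

lemma lift_mult: "lift h \<mu> (f * g) = lift h \<mu> f * lift h \<mu> g"
proof (induction f rule: poly_mapping_induct_sum)
  case (single m c)
  show ?case
  proof (induction g rule: poly_mapping_induct_sum)
    case (single n d)
    then show ?case by (simp add: mult_single lift_single h_mult \<mu>_add)
  qed (simp add: distrib_left lift_add)
qed (simp add: distrib_right lift_add)

lemma lift_prod: "lift h \<mu> (prod f A) = (\<Prod>a\<in>A. lift h \<mu> (f a))"
  by (induction A rule: infinite_finite_induct) (auto simp: lift_1 lift_mult)

lemma lift_power: "lift h \<mu> (f ^ n) = lift h \<mu> f ^ n"
  by (induction n) (auto simp: lift_1 lift_mult)

end

section \<open>Gradings\<close>

definition component :: "('m \<Rightarrow> 'g) \<Rightarrow> 'g \<Rightarrow> ('m \<Rightarrow>\<^sub>0 'k::zero) \<Rightarrow> ('m \<Rightarrow>\<^sub>0 'k)" where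
  "component \<delta> a = Poly_Mapping.mapp (\<lambda>m c. if \<delta> m = a then c else 0)"

lemma lookup_component: "lookup (component \<delta> a f) m = (if \<delta> m = a then lookup f m else 0)"
  by (auto simp: component_def lookup_mapp when_def in_keys_iff)

definition homogeneous :: "('m \<Rightarrow> 'g) \<Rightarrow> 'g \<Rightarrow> ('m \<Rightarrow>\<^sub>0 'k::zero) \<Rightarrow> bool" where
  "homogeneous \<delta> a f \<longleftrightarrow> (\<forall>m\<in>keys f. \<delta> m = a)"

lemma homogeneous_component: "homogeneous \<delta> a (component \<delta> a f)"
  by (auto simp: homogeneous_def in_keys_iff lookup_component split: if_splits)

lemma component_homogeneous:
  "homogeneous \<delta> a f \<Longrightarrow> component \<delta> b f = (if a = b then f else 0)"
  by (rule poly_mapping_eqI) (auto simp: homogeneous_def in_keys_iff lookup_component)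

lemma component_0: "component \<delta> a 0 = 0"
  by (rule poly_mapping_eqI) (simp add: lookup_component)

lemma component_add: "component \<delta> a (f + g) = component \<delta> a f + component \<delta> a (g :: _ \<Rightarrow>\<^sub>0 'k::comm_ring_1)"
  by (rule poly_mapping_eqI) (simp add: lookup_component lookup_add)

lemma component_uminus: "component \<delta> a (- f) = - component \<delta> a (f :: _ \<Rightarrow>\<^sub>0 'k::comm_ring_1)"
  by (rule poly_mapping_eqI) (simp add: lookup_component)

lemma component_diff: "component \<delta> a (f - g) = component \<delta> a f - component \<delta> a (g :: _ \<Rightarrow>\<^sub>0 'k::comm_ring_1)"
  by (rule poly_mapping_eqI) (simp add: lookup_component lookup_minus)

lemma component_sum: "component \<delta> a (sum f A) = (\<Sum>x\<in>A. component \<delta> a (f x :: _ \<Rightarrow>\<^sub>0 'k::comm_ring_1))"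
  by (induction A rule: infinite_finite_induct) (auto simp: component_0 component_add)

lemma component_single:
  "component \<delta> a (single m c) = (if \<delta> m = a then single m c else 0)"
  by (rule poly_mapping_eqI) (auto simp: lookup_component lookup_single when_def)

lemma sum_components:
  assumes "finite A" "\<delta> ` keys f \<subseteq> A"
  shows "(\<Sum>a\<in>A. component \<delta> a f) = (f :: _ \<Rightarrow>\<^sub>0 'k::comm_ring_1)"
proof (rule poly_mapping_eqI)
  fix m
  have "lookup (\<Sum>a\<in>A. component \<delta> a f) m = (\<Sum>a\<in>A. if a = \<delta> m then lookup f m else 0)"
    by (auto simp: lookup_sum lookup_component intro!: sum.cong)
  also have "\<dots> = lookup f m"
    using assms by (auto simp: in_keys_iff image_subset_iff)
  finally show "lookup (\<Sum>a\<in>A. component \<delta> a f) m = lookup f m" .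
qed

locale grading =
  fixes \<delta> :: "'m::comm_monoid_add \<Rightarrow> 'g::ab_group_add"
  assumes \<delta>_add: "\<delta> (m + n) = \<delta> m + \<delta> n"
begin

lemma \<delta>_0: "\<delta> 0 = 0"
  using \<delta>_add[of 0 0] by simp

lemma component_single_mult:
  "component \<delta> a (single m c * f) = single m c * component \<delta> (a - \<delta> m) (f :: _ \<Rightarrow>\<^sub>0 'k::comm_ring_1)"
proof (induction f rule: poly_mapping_induct_sum)
  case (single n d)
  have "\<delta> m + \<delta> n = a \<longleftrightarrow> \<delta> n = a - \<delta> m" by (auto simp: algebra_simps)
  then show ?case by (simp add: mult_single component_single \<delta>_add)
qed (simp add: distrib_left component_add)

lemma component_homogeneous_mult:
  fixes f :: "_ \<Rightarrow>\<^sub>0 'k::comm_ring_1"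
  assumes "homogeneous \<delta> b l"
  shows "component \<delta> a (l * f) = l * component \<delta> (a - b) f"
proof -
  have "component \<delta> a (l * f) = (\<Sum>m\<in>keys l.
      component \<delta> a (single m (lookup l m) * f))"
    by (subst poly_mapping_sum_single[of l]) (simp add: sum_distrib_right component_sum)
  also have "\<dots> = (\<Sum>m\<in>keys l.
      single m (lookup l m) * component \<delta> (a - b) f)"
    using assms by (intro sum.cong) (auto simp: component_single_mult homogeneous_def)
  also have "\<dots> = l * component \<delta> (a - b) f"
    by (subst (3) poly_mapping_sum_single[of l]) (simp add: sum_distrib_right)
  finally show ?thesis .
qed

lemma homogeneous_mult:
  assumes "homogeneous \<delta> a f" "homogeneous \<delta> b g"
  shows "homogeneous \<delta> (a + b) (f * g :: _ \<Rightarrow>\<^sub>0 'k::comm_ring_1)"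
  using keys_mult[of f g] assms by (fastforce simp: homogeneous_def \<delta>_add)

definition graded_ideal :: "('m \<Rightarrow>\<^sub>0 'k::comm_ring_1) set \<Rightarrow> bool" where
  "graded_ideal I \<longleftrightarrow> ideal_of UNIV I \<and> (\<forall>f\<in>I. \<forall>a. component \<delta> a f \<in> I)"

text \<open>The elements all of whose components lie in the ideal form an ideal themselves, so
  looking at generators is enough.\<close>

lemma graded_ideal_gen_ideal:
  assumes "\<And>b a. b \<in> B \<Longrightarrow> component \<delta> a b \<in> gen_ideal UNIV B"
  shows "graded_ideal (gen_ideal UNIV B)"
proof -
  let ?I = "gen_ideal UNIV B"
  let ?J = "{f. \<forall>a. component \<delta> a f \<in> ?I}"
  have "ideal_of UNIV ?J"
    unfolding ideal_of_def
  proof (intro conjI ballI)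
    show "r * x \<in> ?J" if "x \<in> ?J" for r x
    proof (induction r rule: poly_mapping_induct_sum)
      case (single m c)
      then show ?case using that by (auto simp: component_single_mult intro: ideal_UNIV_mult)
    qed (auto simp: distrib_right component_add ideal_ofD(3)[OF ideal_of_gen_ideal])
  qed (auto simp: component_0 component_add ideal_ofD[OF ideal_of_gen_ideal])
  then have "?I \<subseteq> ?J" by (rule gen_ideal_least) (use assms in auto)
  then show ?thesis by (auto simp: graded_ideal_def)
qed

lemma graded_ideal_gen_ideal_homogeneous:
  assumes "\<And>b. b \<in> B \<Longrightarrow> \<exists>a. homogeneous \<delta> a b"
  shows "graded_ideal (gen_ideal UNIV B)"
proof (rule graded_ideal_gen_ideal)
  fix b a assume "b \<in> B"
  then obtain a' where "homogeneous \<delta> a' b" using assms by blast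
  then have "component \<delta> a b = b \<or> component \<delta> a b = 0" by (metis component_homogeneous)
  then show "component \<delta> a b \<in> gen_ideal UNIV B"
    using \<open>b \<in> B\<close> gen_ideal_superset[of B UNIV] ideal_ofD(2)[OF ideal_of_gen_ideal] by auto
qed

lemma graded_ideal_gen_ideal_Un:
  assumes "graded_ideal I" "\<And>b. b \<in> B \<Longrightarrow> \<exists>a. homogeneous \<delta> a b"
  shows "graded_ideal (gen_ideal UNIV (I \<union> B))"
proof (rule graded_ideal_gen_ideal)
  fix b a assume "b \<in> I \<union> B"
  moreover have "component \<delta> a b \<in> gen_ideal UNIV (I \<union> B)" if "b \<in> I"
    using assms(1) that gen_ideal_superset[of "I \<union> B" UNIV] by (auto simp: graded_ideal_def)
  moreover have "component \<delta> a b \<in> gen_ideal UNIV (I \<union> B)" if b: "b \<in> B"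
  proof -
    obtain a' where "homogeneous \<delta> a' b" using assms(2)[OF b] by blast
    then have "component \<delta> a b = b \<or> component \<delta> a b = 0" by (metis component_homogeneous)
    then show ?thesis
      using b gen_ideal_superset[of "I \<union> B" UNIV] ideal_ofD(2)[OF ideal_of_gen_ideal] by auto
  qed
  ultimately show "component \<delta> a b \<in> gen_ideal UNIV (I \<union> B)" by blast
qed

end

text \<open>Graded Nakayama: a cycle of the shorter sequence is, modulo boundaries, \<open>x\<close> times a cycle of
  smaller degree.\<close>

lemma koszul_exact_tl:
  fixes I :: "('m::comm_monoid_add \<Rightarrow>\<^sub>0 'k::comm_ring_1) set" and \<delta> :: "'m \<Rightarrow> int"
  assumes gr: "grading \<delta>" and nonneg: "\<And>m. 0 \<le> \<delta> m"
    and I: "grading.graded_ideal \<delta> I" and hom: "\<And>y. y \<in> set (x # xs) \<Longrightarrow> homogeneous \<delta> 1 y"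
    and ex: "koszul_exact (x # xs) p I"
  shows "koszul_exact xs p I"
proof -
  interpret grading \<delta> by fact
  have idI: "ideal_of UNIV I" and compI: "\<And>f a. f \<in> I \<Longrightarrow> component \<delta> a f \<in> I"
    using I by (auto simp: graded_ideal_def)
  define cyc where "cyc = (\<lambda>z. \<forall>s. length s = length xs \<and> Suc (count_list s True) = p \<longrightarrow> koszul xs z s \<in> I)"
  define bd where "bd = (\<lambda>z. \<exists>b. \<forall>s. length s = length xs \<and> count_list s True = p \<longrightarrow> z s - koszul xs b s \<in> I)"
  \<comment> \<open>The entries have degree 1, so the differential raises the internal degree by
    one.\<close>
  have comp_koszul: "component \<delta> e (koszul xs c s) = koszul xs (\<lambda>t. component \<delta> (e - 1) (c t)) s" for e c s
  proof -
    have "\<forall>y\<in>set xs. homogeneous \<delta> 1 y" using hom by simp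
    then show ?thesis
    proof (induction xs c s rule: koszul.induct)
      case (1 y ys c b s)
      then show ?case
        by (auto simp: component_add component_uminus component_homogeneous_mult)
    qed (auto simp: component_0)
  qed
  have homx: "homogeneous \<delta> 1 x" using hom by simp
  have neg: "component \<delta> e f = 0" if "e < 0" for e and f :: "'m \<Rightarrow>\<^sub>0 'k"
    by (rule poly_mapping_eqI) (use nonneg that in \<open>auto simp: lookup_component not_le[symmetric]\<close>)
  \<comment> \<open>Extend \<open>z\<close> by zero to a chain of the longer sequence, without
    component along the basis vector of \<open>x\<close>. When this cycle is written as a boundary,
    the indices starting with \<open>False\<close> read \<open>z = d b0 + x b1\<close>, and those
    starting with \<open>True\<close> say that \<open>b1\<close> is again a cycle.\<close>
  have decomp: "\<exists>b0 b1. cyc b1 \<and> (\<forall>s. length s = length xs \<and> count_list s True = p \<longrightarrow>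
      z s - (koszul xs b0 s + x * b1 s) \<in> I)" if z: "cyc z" for z
  proof -
    define c where "c = (\<lambda>s. if hd s then 0 else z (tl s))"
    have "koszul (x # xs) c s \<in> I" if "length s = length (x # xs)" "Suc (count_list s True) = p" for s
    proof -
      obtain b t where s: "s = b # t" using \<open>length s = _\<close> by (cases s) auto
      show ?thesis using that z idI
        by (cases b) (auto simp: s c_def koszul_zero cyc_def ideal_ofD(2))
    qed
    then obtain b where b: "\<And>s. length s = length (x # xs) \<Longrightarrow> count_list s True = p \<Longrightarrow>
        c s - koszul (x # xs) b s \<in> I"
      using ex unfolding koszul_exact_def by metis
    have "z s - (koszul xs (\<lambda>t. b (False # t)) s + x * b (True # s)) \<in> I"
      if "length s = length xs" "count_list s True = p" for s
      using b[of "False # s"] that by (simp add: c_def)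
    moreover have "cyc (\<lambda>t. b (True # t))"
      unfolding cyc_def using b[of "True # _"] by (auto simp: c_def)
    ultimately show ?thesis by blast
  qed
  \<comment> \<open>In degree \<open>n + 1\<close> the decomposition involves \<open>b1\<close> only
    in degree \<open>n\<close>, where induction applies; in degree 0 it involves components of
    negative degree only, which vanish.\<close>
  have main: "cyc z \<Longrightarrow> bd (\<lambda>s. component \<delta> (int n) (z s))" for n z
  proof (induction n arbitrary: z)
    case (0 z)
    obtain b0 b1 where "\<And>s. length s = length xs \<Longrightarrow> count_list s True = p \<Longrightarrow>
      z s - (koszul xs b0 s + x * b1 s) \<in> I" using decomp[OF 0] by blast
    then have "component \<delta> 0 (z s - (koszul xs b0 s + x * b1 s)) \<in> I"
      if "length s = length xs" "count_list s True = p" for s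
      using that compI by blast
    then have "component \<delta> 0 (z s) \<in> I" if "length s = length xs" "count_list s True = p" for s
      using that by (simp add: component_diff component_add comp_koszul
          component_homogeneous_mult[OF homx] neg koszul_zero)
    then show ?case unfolding bd_def by (intro exI[of _ "\<lambda>_. 0"]) (simp add: koszul_zero)
  next
    case (Suc n z)
    obtain b0 b1 where b: "cyc b1" "\<And>s. length s = length xs \<Longrightarrow> count_list s True = p \<Longrightarrow>
      z s - (koszul xs b0 s + x * b1 s) \<in> I" using decomp[OF Suc.prems] by blast
    obtain v where v: "\<And>s. length s = length xs \<Longrightarrow> count_list s True = p \<Longrightarrow>
      component \<delta> (int n) (b1 s) - koszul xs v s \<in> I" using Suc.IH[OF b(1)] unfolding bd_def by blast
    define w where "w = (\<lambda>t. component \<delta> (int n) (b0 t) + x * v t)"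
    have "component \<delta> (int (Suc n)) (z s) - koszul xs w s \<in> I"
      if s: "length s = length xs" "count_list s True = p" for s
    proof -
      have "component \<delta> (int (Suc n)) (z s - (koszul xs b0 s + x * b1 s)) \<in> I"
        using b(2)[OF s] compI by blast
      moreover have "x * (component \<delta> (int n) (b1 s) - koszul xs v s) \<in> I"
        using v[OF s] idI by (simp add: ideal_UNIV_mult)
      ultimately have "component \<delta> (int (Suc n)) (z s - (koszul xs b0 s + x * b1 s))
          + x * (component \<delta> (int n) (b1 s) - koszul xs v s) \<in> I"
        by (rule ideal_ofD(3)[OF idI])
      then show ?thesis
        by (simp add: w_def component_diff component_add comp_koszul koszul_add koszul_mult
          component_homogeneous_mult[OF homx] algebra_simps)
    qed
    then show ?case unfolding bd_def by blast
  qed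
  show ?thesis
    unfolding koszul_exact_def
  proof (intro allI impI)
    fix z assume "\<forall>s. length s = length xs \<and> Suc (count_list s True) = p \<longrightarrow> koszul xs z s \<in> I"
    then have z: "cyc z" by (simp add: cyc_def)
    \<comment> \<open>Only finitely many degrees occur in the values of \<open>z\<close>, so the
      boundaries found degree by degree can be summed.\<close>
    define S where "S = {s :: bool list. length s = length xs}"
    have "S = {s. set s \<subseteq> UNIV \<and> length s = length xs}" by (simp add: S_def)
    then have finS: "finite S" using finite_lists_length_eq[of "UNIV :: bool set" "length xs"] by simp
    define A where "A = (\<lambda>m. nat (\<delta> m)) ` (\<Union>s\<in>S. keys (z s))"
    have finA: "finite A" using finS by (simp add: A_def)
    have "\<exists>b. \<forall>n. \<forall>s. length s = length xs \<and> count_list s True = p \<longrightarrow>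
        component \<delta> (int n) (z s) - koszul xs (b n) s \<in> I"
      using main[OF z] unfolding bd_def by metis
    then obtain b where b: "\<And>n s. length s = length xs \<Longrightarrow> count_list s True = p \<Longrightarrow>
        component \<delta> (int n) (z s) - koszul xs (b n) s \<in> I" by blast
    have "z s - koszul xs (\<lambda>t. \<Sum>n\<in>A. b n t) s \<in> I"
      if s: "length s = length xs" "count_list s True = p" for s
    proof -
      have "\<delta> ` keys (z s) \<subseteq> int ` A"
      proof
        fix d assume "d \<in> \<delta> ` keys (z s)"
        then obtain m where m: "m \<in> keys (z s)" "d = \<delta> m" by blast
        then have "nat (\<delta> m) \<in> A" using s by (force simp: A_def S_def)
        then show "d \<in> int ` A" using m nonneg[of m] by (metis image_eqI int_nat_eq)
      qed
      then have "z s = (\<Sum>n\<in>A. component \<delta> (int n) (z s))"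
        using sum_components[of "int ` A" \<delta> "z s"] finA by (simp add: sum.reindex)
      then have "z s - koszul xs (\<lambda>t. \<Sum>n\<in>A. b n t) s =
          (\<Sum>n\<in>A. component \<delta> (int n) (z s) - koszul xs (b n) s)"
        by (simp add: koszul_sum sum_subtractf)
      also have "\<dots> \<in> I" by (rule ideal_sum[OF idI]) (use b s in blast)
      finally show ?thesis .
    qed
    then show "\<exists>b. \<forall>s. length s = length xs \<and> count_list s True = p \<longrightarrow> z s - koszul xs b s \<in> I"
      by blast
  qed
qed

section \<open>Graded pieces and Hilbert functions\<close>

lemma const_add: "const (x + y) = const x + const y"
  by (simp add: const_def single_add)

lemma const_mult: "const (x * y) = const x * const y"
  by (simp add: const_def mult_single)

lemma const_0 [simp]: "const 0 = 0" and const_1 [simp]: "const 1 = 1"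
  by (simp_all add: const_def)

lemma const_uminus: "const (- x) = - const x"
  by (simp add: const_def single_uminus)

lemma const_diff: "const (x - y) = const x - const y"
  by (simp add: const_def single_diff)

lemma const_mult_single: "const c * single m d = single m (c * d)"
  by (simp add: const_def mult_single)

lemma const_sum: "const (sum f A) = (\<Sum>x\<in>A. const (f x))"
  by (induction A rule: infinite_finite_induct) (auto simp: const_add)

interpretation cox: vector_space "\<lambda>(c::'k::field) (f::('q, 'k) cox). const c * f"
  by unfold_locales (auto simp: distrib_left distrib_right const_add const_mult mult.assoc)

interpretation mdeg: grading mdeg
  by unfold_locales (simp add: mdeg_def lookup_add vec_eq_iff)

text \<open>The Nakayama induction runs over an integer degree in which all the linear forms have
  degree 1, whatever their multidegrees.\<close>

definition tdeg :: "('q::finite \<times> bool \<Rightarrow>\<^sub>0 nat) \<Rightarrow> int" where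
  "tdeg m = (\<Sum>i\<in>UNIV. mdeg m $ i)"

interpretation tdeg: grading tdeg
  by unfold_locales (simp add: tdeg_def mdeg.\<delta>_add sum.distrib)

lemma tdeg_nonneg: "0 \<le> tdeg m"
  unfolding tdeg_def by (rule sum_nonneg) (simp add: mdeg_def)

lemma mdeg_nonneg: "0 \<le> mdeg m"
  by (simp add: mdeg_def less_eq_vec_def)

lemma forms_iff_homogeneous: "F \<in> forms a \<longleftrightarrow> homogeneous mdeg a F"
  by (simp add: forms_def homogeneous_def)

lemma component_in_forms: "component mdeg a F \<in> forms a"
  by (simp add: forms_iff_homogeneous homogeneous_component)

lemma component_forms: "F \<in> forms a \<Longrightarrow> component mdeg a F = F"
  by (simp add: forms_iff_homogeneous component_homogeneous)

lemma forms_mult: "F \<in> forms a \<Longrightarrow> G \<in> forms b \<Longrightarrow> F * G \<in> forms (a + b)"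
  by (simp add: forms_iff_homogeneous mdeg.homogeneous_mult)

lemma forms_add: "F \<in> forms a \<Longrightarrow> G \<in> forms a \<Longrightarrow> F + G \<in> forms a"
  using keys_add[of F G] by (auto simp: forms_def)

lemma zero_in_forms: "0 \<in> forms a"
  by (simp add: forms_def)

lemma const_in_forms: "const c \<in> forms 0"
  by (simp add: forms_def const_def mdeg.\<delta>_0)

lemma one_in_forms: "1 \<in> forms 0"
  using const_in_forms[of 1] by simp

lemma forms_const_mult: "F \<in> forms a \<Longrightarrow> const c * F \<in> forms a"
  using forms_mult[OF const_in_forms] by fastforce

lemma forms_diff: "F \<in> forms a \<Longrightarrow> G \<in> forms a \<Longrightarrow> F - G \<in> forms a"
  using forms_add[of F a "const (-1) * G"] forms_const_mult[of G a "-1"] by (simp add: const_uminus)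

lemma forms_sum: "(\<And>x. x \<in> A \<Longrightarrow> f x \<in> forms a) \<Longrightarrow> sum f A \<in> forms a"
  by (induction A rule: infinite_finite_induct) (auto simp: forms_add zero_in_forms)

lemma forms_prod: "(\<And>x. x \<in> A \<Longrightarrow> f x \<in> forms (g x)) \<Longrightarrow> prod f A \<in> forms (sum g A)"
  by (induction A rule: infinite_finite_induct) (auto simp: forms_mult one_in_forms)

lemma forms_power: "F \<in> forms a \<Longrightarrow> F ^ n \<in> forms (\<chi> i. int n * a $ i)"
proof (induction n)
  case 0
  have "(\<chi> i. int 0 * a $ i) = 0" by (simp add: vec_eq_iff)
  then show ?case using one_in_forms by (metis power_0)
next
  case (Suc n)
  have "(\<chi> i. int (Suc n) * a $ i) = a + (\<chi> i. int n * a $ i)" by (simp add: vec_eq_iff algebra_simps)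
  then show ?case using Suc forms_mult by (metis power_Suc)
qed

lemma mdeg_single: "mdeg (single (i, b) n) = (\<chi> j. if j = i then int n else 0)"
  by (cases b) (auto simp: mdeg_def vec_eq_iff lookup_single when_def)

lemma var_in_forms: "var (i, b) \<in> forms (axis i 1)"
  by (auto simp: forms_def Defs.var_def mdeg_single axis_def vec_eq_iff)

lemma forms_axis_tdeg: "F \<in> forms (axis i 1) \<Longrightarrow> homogeneous tdeg 1 F"
  by (auto simp: forms_def homogeneous_def tdeg_def axis_def if_distrib cong: if_cong)

lemma finite_bounded_exponents: "finite {m :: 'v::finite \<Rightarrow>\<^sub>0 nat. \<forall>v. lookup m v \<le> N}"
proof (rule finite_imageD)
  show "inj_on lookup {m :: 'v \<Rightarrow>\<^sub>0 nat. \<forall>v. lookup m v \<le> N}"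
    by (intro inj_onI poly_mapping_eqI) simp
  have "lookup ` {m :: 'v \<Rightarrow>\<^sub>0 nat. \<forall>v. lookup m v \<le> N} \<subseteq> (UNIV \<rightarrow>\<^sub>E {..N})"
    by (auto simp: PiE_def extensional_def)
  then show "finite (lookup ` {m :: 'v \<Rightarrow>\<^sub>0 nat. \<forall>v. lookup m v \<le> N})"
    by (rule finite_subset) (auto intro: finite_PiE)
qed

lemma finite_mdeg: "finite {m :: 'q::finite \<times> bool \<Rightarrow>\<^sub>0 nat. mdeg m = a}"
proof (rule finite_subset)
  define N where "N = Max (range (\<lambda>i. nat (a $ i)))"
  show "{m. mdeg m = a} \<subseteq> {m. \<forall>v. lookup m v \<le> N}"
  proof safe
    fix m :: "'q \<times> bool \<Rightarrow>\<^sub>0 nat" and i b assume "a = mdeg m"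
    then have "lookup m (i, b) \<le> nat (a $ i)" by (cases b) (auto simp: mdeg_def)
    also have "\<dots> \<le> N" by (simp add: N_def)
    finally show "lookup m (i, b) \<le> N" .
  qed
qed (rule finite_bounded_exponents)

lemma single_in_span: "m \<in> A \<Longrightarrow> single m c \<in> cox.span ((\<lambda>m. single m 1) ` A)"
  using cox.span_scale[OF cox.span_base, of "single m 1" _ c] by (simp add: const_mult_single)

lemma in_span_singles:
  assumes "keys F \<subseteq> A"
  shows "F \<in> cox.span ((\<lambda>m. single m 1) ` A)"
  by (subst poly_mapping_sum_single) (use assms in \<open>auto intro!: cox.span_sum single_in_span\<close>)

lemma forms_finite_span: "\<exists>T. finite T \<and> (forms a :: ('q::finite, 'k::field) cox set) \<subseteq> cox.span T"
proof (intro exI conjI)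
  show "finite ((\<lambda>m. single m 1) ` {m. mdeg m = a})" using finite_mdeg by blast
qed (auto simp: forms_def intro!: in_span_singles)

section \<open>Dimensions of graded pieces modulo an ideal\<close>

lemma subspace_forms: "cox.subspace (forms a)"
  by (auto simp: cox.subspace_def zero_in_forms forms_add forms_const_mult)

text \<open>A basis modulo \<open>I\<close> and a basis of \<open>V \<inter> I\<close> together form
  a basis of \<open>V\<close>. So the size of the former does not depend on choices, which makes
  \<open>dim_mod\<close> well defined.\<close>

lemma basis_mod_card:
  assumes V: "cox.subspace V" "finite T" "V \<subseteq> cox.span T" and I: "ideal_of UNIV I" and B: "basis_mod V I B"
  shows "card B + cox.dim (V \<inter> I) = cox.dim V"
proof -
  obtain D where D: "D \<subseteq> V \<inter> I" "cox.independent D" "V \<inter> I \<subseteq> cox.span D" "card D = cox.dim (V \<inter> I)"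
    using cox.basis_exists by blast
  have finD: "finite D"
    using cox.independent_span_bound[OF V(2) D(2)] D(1) V(3) by blast
  have B': "finite B" "B \<subseteq> V" and Bs: "\<And>f. f \<in> V \<Longrightarrow> \<exists>c. f - (\<Sum>b\<in>B. const (c b) * b) \<in> I"
    and Bi: "\<And>c b. (\<Sum>b\<in>B. const (c b) * b) \<in> I \<Longrightarrow> b \<in> B \<Longrightarrow> c b = 0"
    using B by (auto simp: basis_mod_def)
  have disj: "B \<inter> D = {}"
  proof (rule ccontr)
    assume "B \<inter> D \<noteq> {}"
    then obtain b where b: "b \<in> B" "b \<in> I" using D by blast
    have "(\<Sum>x\<in>B. const (if x = b then 1 else 0) * x) = (\<Sum>x\<in>B. if x = b then x else 0)"
      by (intro sum.cong) auto
    also have "\<dots> = b" using b B' by simp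
    finally show False using Bi[of "\<lambda>x. if x = b then 1 else 0" b] b by simp
  qed
  have ind: "cox.independent (B \<union> D)"
  proof (rule cox.independent_if_scalars_zero)
    show "finite (B \<union> D)" using B' finD by simp
    fix f x assume s: "(\<Sum>x\<in>B \<union> D. const (f x) * x) = 0" and x: "x \<in> B \<union> D"
    have s': "(\<Sum>x\<in>B. const (f x) * x) + (\<Sum>x\<in>D. const (f x) * x) = 0"
      using s B' finD disj by (simp add: sum.union_disjoint)
    have "(\<Sum>x\<in>D. const (f x) * x) \<in> I"
      by (rule ideal_sum[OF I]) (use D I in \<open>auto intro: ideal_UNIV_mult\<close>)
    then have "(\<Sum>x\<in>B. const (f x) * x) \<in> I"
      using s' ideal_UNIV_uminus[OF I] by (simp add: eq_neg_iff_add_eq_0[symmetric])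
    then have fB: "f b = 0" if "b \<in> B" for b using Bi that by blast
    then have "(\<Sum>x\<in>D. const (f x) * x) = 0" using s' by simp
    then have "f d = 0" if "d \<in> D" for d
      using cox.independentD[OF D(2) finD] that by blast
    with fB x show "f x = 0" by blast
  qed
  have "V \<subseteq> cox.span (B \<union> D)"
  proof
    fix f assume f: "f \<in> V"
    then obtain c where c: "f - (\<Sum>b\<in>B. const (c b) * b) \<in> I" using Bs by blast
    have sB: "(\<Sum>b\<in>B. const (c b) * b) \<in> cox.span B"
      by (intro cox.span_sum cox.span_scale cox.span_base)
    moreover have "(\<Sum>b\<in>B. const (c b) * b) \<in> V"
      using B' V(1) by (auto intro!: cox.subspace_sum cox.subspace_scale)
    ultimately have "f - (\<Sum>b\<in>B. const (c b) * b) \<in> cox.span D"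
      using c f V(1) D(3) by (auto intro: cox.subspace_diff)
    then have "(f - (\<Sum>b\<in>B. const (c b) * b)) + (\<Sum>b\<in>B. const (c b) * b) \<in> cox.span (B \<union> D)"
      using sB cox.span_mono[of D "B \<union> D"] cox.span_mono[of B "B \<union> D"]
      by (intro cox.span_add) auto
    then show "f \<in> cox.span (B \<union> D)" by simp
  qed
  then have "card (B \<union> D) = cox.dim V"
    using ind B' D by (intro cox.basis_card_eq_dim) auto
  then show ?thesis using D(4) B' finD disj by (simp add: card_Un_disjoint)
qed

lemma basis_mod_exists:
  assumes V: "cox.subspace V" "finite T" "V \<subseteq> cox.span T" and I: "ideal_of UNIV I"
  shows "\<exists>B. basis_mod V I B"
proof -
  obtain D where D: "D \<subseteq> V \<inter> I" "cox.independent D" "V \<inter> I \<subseteq> cox.span D" "card D = cox.dim (V \<inter> I)"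
    using cox.basis_exists by blast
  obtain B where B: "D \<subseteq> B" "B \<subseteq> V" "cox.independent B" "V \<subseteq> cox.span B"
    using cox.maximal_independent_subset_extend[of D V] D by blast
  have finB: "finite B"
    using cox.independent_span_bound[OF V(2) B(3)] B(2) V(3) by blast
  have split: "(\<Sum>b\<in>B. const (r b) * b) = (\<Sum>b\<in>B - D. const (r b) * b) + (\<Sum>b\<in>D. const (r b) * b)" for r
    using finB B(1) by (simp add: sum.subset_diff)
  have "basis_mod V I (B - D)"
    unfolding basis_mod_def
  proof (intro conjI ballI allI impI)
    fix f assume "f \<in> V"
    then obtain r where r: "f = (\<Sum>b\<in>B. const (r b) * b)"
      using B(4) cox.span_finite[OF finB] by blast
    have "(\<Sum>b\<in>D. const (r b) * b) \<in> I"
      by (rule ideal_sum[OF I]) (use D I in \<open>auto intro: ideal_UNIV_mult\<close>)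
    then have "f - (\<Sum>b\<in>B - D. const (r b) * b) \<in> I" unfolding r split by simp
    then show "\<exists>c. f - (\<Sum>b\<in>B - D. const (c b) * b) \<in> I" by blast
  next
    fix c b assume c: "(\<Sum>b\<in>B - D. const (c b) * b) \<in> I" and b: "b \<in> B - D"
    have "(\<Sum>b\<in>B - D. const (c b) * b) \<in> V"
      using B V(1) by (auto intro!: cox.subspace_sum cox.subspace_scale)
    then have "(\<Sum>b\<in>B - D. const (c b) * b) \<in> cox.span D" using c D by blast
    then obtain d where d: "(\<Sum>b\<in>B - D. const (c b) * b) = (\<Sum>b\<in>D. const (d b) * b)"
      using cox.span_finite[of D] finite_subset[OF B(1) finB] by blast
    define e where "e = (\<lambda>b. if b \<in> D then - d b else c b)"
    have "(\<Sum>b\<in>B. const (e b) * b) = (\<Sum>b\<in>B - D. const (c b) * b) + (\<Sum>b\<in>D. - (const (d b) * b))"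
      unfolding split by (intro arg_cong2[where f="(+)"] sum.cong) (auto simp: e_def const_uminus)
    also have "\<dots> = 0" using d by (simp add: sum_negf)
    finally have "e b = 0" using cox.independentD[OF B(3) finB] b by blast
    then show "c b = 0" using b by (simp add: e_def)
  qed (use finB B in auto)
  then show ?thesis by blast
qed

lemma dim_mod_eq:
  fixes I :: "('q::finite, 'k::field) cox set"
  assumes "ideal_of UNIV I" "basis_mod (forms a) I B"
  shows "dim_mod (forms a) I = card B"
proof -
  obtain T where T: "finite T" "(forms a :: ('q, 'k) cox set) \<subseteq> cox.span T" using forms_finite_span by blast
  note card = basis_mod_card[OF subspace_forms T assms(1)]
  show ?thesis unfolding dim_mod_def
  proof (rule the_equality)
    show "n = card B" if n: "\<exists>B. basis_mod (forms a) I B \<and> card B = n" for n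
    proof -
      obtain C where "basis_mod (forms a) I C" "card C = n" using n by blast
      then show ?thesis using card[of C] card[OF assms(2)] by simp
    qed
  qed (use assms(2) in blast)
qed

lemma forms_basis_mod_exists: "ideal_of UNIV I \<Longrightarrow> \<exists>B. basis_mod (forms a) I B"
  using forms_finite_span basis_mod_exists[OF subspace_forms] by metis

text \<open>The exact sequence given by multiplication by \<open>l\<close>, in terms of bases:
  \<open>l\<close> times a basis \<open>B\<close> for degree \<open>a - e\<close>, together with a
  basis \<open>C\<close> modulo the larger ideal, is a basis in degree \<open>a\<close> modulo
  \<open>N\<close>.\<close>

lemma dim_mod_insert:
  fixes N :: "('q::finite, 'k::field) cox set"
  assumes N: "mdeg.graded_ideal N" and l: "l \<in> forms e" and nzd: "nonzerodivisor_mod l N"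
  shows "int (dim_mod (forms a) (gen_ideal UNIV (insert l N))) =
    int (dim_mod (forms a) N) - int (dim_mod (forms (a - e)) N)"
proof -
  let ?M = "gen_ideal UNIV (insert l N)"
  have idN: "ideal_of UNIV N" and comp: "\<And>f a. f \<in> N \<Longrightarrow> component mdeg a f \<in> N"
    using N by (auto simp: mdeg.graded_ideal_def)
  have M: "?M = {x + l * r | x r. x \<in> N}" using idN by (simp add: gen_ideal_insert gen_ideal_idem)
  obtain B where B: "basis_mod (forms (a - e)) N B" using forms_basis_mod_exists[OF idN] by blast
  obtain C where C: "basis_mod (forms a) ?M C" using forms_basis_mod_exists[OF ideal_of_gen_ideal] by blast
  have B': "finite B" "B \<subseteq> forms (a - e)" and Bs: "\<And>f. f \<in> forms (a - e) \<Longrightarrow> \<exists>c. f - (\<Sum>b\<in>B. const (c b) * b) \<in> N"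
    and Bi: "\<And>c b. (\<Sum>b\<in>B. const (c b) * b) \<in> N \<Longrightarrow> b \<in> B \<Longrightarrow> c b = 0"
    using B by (auto simp: basis_mod_def)
  have C': "finite C" "C \<subseteq> forms a" and Cs: "\<And>f. f \<in> forms a \<Longrightarrow> \<exists>c. f - (\<Sum>b\<in>C. const (c b) * b) \<in> ?M"
    and Ci: "\<And>c b. (\<Sum>b\<in>C. const (c b) * b) \<in> ?M \<Longrightarrow> b \<in> C \<Longrightarrow> c b = 0"
    using C by (auto simp: basis_mod_def)
  have lM: "l * r \<in> ?M" for r
    using gen_ideal_superset[of "insert l N" UNIV] by (auto intro: ideal_UNIV_mult)
  have NM: "N \<subseteq> ?M" using gen_ideal_superset[of "insert l N" UNIV] by auto
  have inj: "inj_on ((*) l) B"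
  proof (rule inj_onI, rule ccontr)
    fix x y assume xy: "x \<in> B" "y \<in> B" "l * x = l * y" "x \<noteq> y"
    then have "l * (x - y) \<in> N" using ideal_ofD(2)[OF idN] by (simp add: algebra_simps)
    then have "x - y \<in> N" using nzd by (simp add: nonzerodivisor_mod_def)
    have "(\<Sum>b\<in>B. const (if b = x then 1 else if b = y then -1 else 0) * b) =
        (\<Sum>b\<in>B. (if b = x then b else 0) - (if b = y then b else 0))"
      using xy by (intro sum.cong) (auto simp: const_uminus)
    also have "\<dots> = x - y" using xy B' by (simp add: sum_subtractf)
    finally show False using Bi[of "\<lambda>b. if b = x then 1 else if b = y then -1 else 0" x] xy \<open>x - y \<in> N\<close> by simp
  qed
  have disj: "(*) l ` B \<inter> C = {}"
  proof (rule ccontr)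
    assume "(*) l ` B \<inter> C \<noteq> {}"
    then obtain b where b: "b \<in> C" "b \<in> ?M" using lM by auto
    have "(\<Sum>x\<in>C. const (if x = b then 1 else 0) * x) = (\<Sum>x\<in>C. if x = b then x else 0)"
      by (intro sum.cong) auto
    also have "\<dots> = b" using b C' by simp
    finally show False using Ci[of "\<lambda>x. if x = b then 1 else 0" b] b by simp
  qed
  have split: "(\<Sum>x\<in>(*) l ` B \<union> C. const (c x) * x) =
      l * (\<Sum>b\<in>B. const (c (l * b)) * b) + (\<Sum>x\<in>C. const (c x) * x)" for c
    using B' C' disj inj
    by (simp add: sum.union_disjoint sum.reindex sum_distrib_left mult.left_commute)
  have "basis_mod (forms a) N ((*) l ` B \<union> C)"
    unfolding basis_mod_def
  proof (intro conjI ballI allI impI)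
    show "(*) l ` B \<union> C \<subseteq> forms a"
      using B' C' forms_mult[OF l] by fastforce
  next
    fix f :: "('q, 'k) cox" assume f: "f \<in> forms a"
    then obtain d where "f - (\<Sum>b\<in>C. const (d b) * b) \<in> ?M" using Cs by blast
    then obtain x r where xr: "x \<in> N" "f - (\<Sum>b\<in>C. const (d b) * b) = x + l * r" using M by blast
    \<comment> \<open>Since everything else has degree \<open>a\<close> and \<open>N\<close> is
      graded, only the component of \<open>r\<close> in degree \<open>a - e\<close> matters.\<close>
    define g where "g = component mdeg (a - e) r"
    have "f - (\<Sum>b\<in>C. const (d b) * b) \<in> forms a"
      using f C' by (auto intro!: forms_diff forms_sum forms_const_mult)
    then have "f - (\<Sum>b\<in>C. const (d b) * b) = component mdeg a (x + l * r)"
      using component_forms xr(2) by metis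
    then have eq: "f - (\<Sum>b\<in>C. const (d b) * b) = component mdeg a x + l * g"
      using l by (simp add: component_add mdeg.component_homogeneous_mult forms_iff_homogeneous g_def)
    have "g \<in> forms (a - e)" by (simp add: g_def component_in_forms)
    then obtain c where c: "g - (\<Sum>b\<in>B. const (c b) * b) \<in> N" using Bs by blast
    define h where "h = (\<lambda>x. if x \<in> C then d x else c (the_inv_into B ((*) l) x))"
    have h1: "(\<Sum>b\<in>B. const (h (l * b)) * b) = (\<Sum>b\<in>B. const (c b) * b)"
      using disj inj by (intro sum.cong) (auto simp: h_def the_inv_into_f_f)
    have h2: "(\<Sum>x\<in>C. const (h x) * x) = (\<Sum>x\<in>C. const (d x) * x)"
      by (intro sum.cong) (auto simp: h_def)
    have "f - (\<Sum>x\<in>(*) l ` B \<union> C. const (h x) * x) =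
        component mdeg a x + l * (g - (\<Sum>b\<in>B. const (c b) * b))"
      unfolding split h1 h2 using eq by (simp add: algebra_simps)
    also have "\<dots> \<in> N" by (intro ideal_ofD(3)[OF idN] comp[OF xr(1)] ideal_UNIV_mult(1)[OF idN] c)
    finally show "\<exists>c. f - (\<Sum>x\<in>(*) l ` B \<union> C. const (c x) * x) \<in> N" by blast
  next
    fix c x assume c: "(\<Sum>x\<in>(*) l ` B \<union> C. const (c x) * x) \<in> N" and x: "x \<in> (*) l ` B \<union> C"
    have "(\<Sum>x\<in>C. const (c x) * x) = (\<Sum>x\<in>(*) l ` B \<union> C. const (c x) * x) - l * (\<Sum>b\<in>B. const (c (l * b)) * b)"
      unfolding split by simp
    also have "\<dots> \<in> ?M" using c NM lM by (auto intro: ideal_UNIV_diff)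
    finally have cC: "c x = 0" if "x \<in> C" for x using Ci that by blast
    then have "l * (\<Sum>b\<in>B. const (c (l * b)) * b) \<in> N" using c unfolding split by simp
    then have "(\<Sum>b\<in>B. const (c (l * b)) * b) \<in> N" using nzd by (simp add: nonzerodivisor_mod_def)
    then have "c (l * b) = 0" if "b \<in> B" for b using Bi[of "\<lambda>b. c (l * b)"] that by blast
    then show "c x = 0" using cC x by blast
  qed (use B' C' in auto)
  then have "dim_mod (forms a) N = card ((*) l ` B \<union> C)" by (rule dim_mod_eq[OF idN])
  also have "\<dots> = card B + card C" using B' C' disj inj by (simp add: card_Un_disjoint card_image)
  also have "card B = dim_mod (forms (a - e)) N" using dim_mod_eq[OF idN B] by simp
  also have "card C = dim_mod (forms a) ?M" using dim_mod_eq[OF ideal_of_gen_ideal C] by simp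
  finally show ?thesis by simp
qed

section \<open>Alternating sums of Hilbert functions along regular sequences\<close>

lemma difference_Pow: "difference F a = (\<Sum>P\<in>UNIV. (-1) ^ card P * F (a - (\<Sum>i\<in>P. axis i 1)))"
  for F :: "int ^ 'q::finite \<Rightarrow> int"
proof -
  have "(\<Sum>P\<in>UNIV. (-1) ^ card P * F (a - (\<Sum>i\<in>P. axis i 1))) =
      (\<Sum>p\<in>{0..CARD('q)}. \<Sum>P | P \<in> UNIV \<and> card P = p. (-1) ^ card P * F (a - (\<Sum>i\<in>P. axis i 1)))"
    by (rule sum.group[symmetric]) (auto simp: card_mono)
  also have "\<dots> = (\<Sum>p\<in>{0..CARD('q)}. (-1) ^ p * (\<Sum>P | card P = p. F (a - (\<Sum>i\<in>P. axis i 1))))"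
    by (intro sum.cong refl) (auto simp: sum_distrib_left)
  also have "\<dots> = (\<Sum>P | card P = 0. F (a - (\<Sum>i\<in>P. axis i (1::int)))) +
      (\<Sum>p = 1..CARD('q). (-1) ^ p * (\<Sum>P | card P = p. F (a - (\<Sum>i\<in>P. axis i 1))))"
    by (simp add: sum.atLeast_Suc_atMost)
  also have "{P :: 'q set. card P = 0} = {{}}" by auto
  finally show ?thesis by (simp add: difference_def)
qed

text \<open>Adding \<open>l j\<close> subtracts the sum shifted by the degree of \<open>l j\<close>,
  and that shifted sum is the part over the subsets containing \<open>j\<close>. Lists grow at the
  front, so regularity is asked along suffixes.\<close>

lemma dim_mod_regular:
  fixes I :: "('q::finite, 'k::field) cox set" and l :: "'q \<Rightarrow> ('q, 'k) cox"
  assumes I: "mdeg.graded_ideal I" and l: "\<And>i. l i \<in> forms (axis i 1)"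
    and "distinct js"
    and "\<And>i ks. suffix (i # ks) js \<Longrightarrow> nonzerodivisor_mod (l i) (gen_ideal UNIV (I \<union> l ` set ks))"
  shows "int (dim_mod (forms a) (gen_ideal UNIV (I \<union> l ` set js))) =
    (\<Sum>P\<in>Pow (set js). (-1) ^ card P * int (dim_mod (forms (a - (\<Sum>i\<in>P. axis i 1))) I))"
  using assms(3,4)
proof (induction js arbitrary: a)
  case Nil
  then show ?case using I by (simp add: mdeg.graded_ideal_def gen_ideal_idem)
next
  case (Cons j js)
  let ?N = "gen_ideal UNIV (I \<union> l ` set js)"
  let ?H = "\<lambda>a. int (dim_mod (forms a) I)"
  have gr: "mdeg.graded_ideal ?N"
    by (rule mdeg.graded_ideal_gen_ideal_Un[OF I]) (use l in \<open>auto simp: forms_iff_homogeneous\<close>)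
  have nzd: "nonzerodivisor_mod (l j) ?N" by (rule Cons.prems) simp
  have IH: "int (dim_mod (forms a) ?N) = (\<Sum>P\<in>Pow (set js). (-1) ^ card P * ?H (a - (\<Sum>i\<in>P. axis i 1)))" for a
    using Cons by (auto simp: suffix_Cons)
  have "gen_ideal UNIV (I \<union> l ` set (j # js)) = gen_ideal UNIV (insert (l j) ?N)"
    by (simp add: gen_ideal_insert gen_ideal_idem)
  then have "int (dim_mod (forms a) (gen_ideal UNIV (I \<union> l ` set (j # js)))) =
      int (dim_mod (forms a) ?N) - int (dim_mod (forms (a - axis j 1)) ?N)"
    using dim_mod_insert[OF gr l nzd] by simp
  also have "\<dots> = (\<Sum>P\<in>Pow (set js). (-1) ^ card P * ?H (a - (\<Sum>i\<in>P. axis i 1))) +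
      (\<Sum>P\<in>Pow (set js). (-1) ^ card (insert j P) * ?H (a - (\<Sum>i\<in>insert j P. axis i 1)))"
  proof -
    have "(\<Sum>P\<in>Pow (set js). (-1) ^ card (insert j P) * ?H (a - (\<Sum>i\<in>insert j P. axis i 1))) =
        (\<Sum>P\<in>Pow (set js). - ((-1) ^ card P * ?H (a - axis j 1 - (\<Sum>i\<in>P. axis i 1))))"
    proof (rule sum.cong)
      fix P assume "P \<in> Pow (set js)"
      then have "finite P" "j \<notin> P" using Cons.prems(1) by auto
      then show "(-1) ^ card (insert j P) * ?H (a - (\<Sum>i\<in>insert j P. axis i 1)) =
          - ((-1) ^ card P * ?H (a - axis j 1 - (\<Sum>i\<in>P. axis i 1)))"
        by (simp add: algebra_simps)
    qed simp
    then show ?thesis by (simp add: IH sum_negf)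
  qed
  also have "\<dots> = (\<Sum>P\<in>Pow (set (j # js)). (-1) ^ card P * ?H (a - (\<Sum>i\<in>P. axis i 1)))"
  proof -
    have "Pow (set (j # js)) = Pow (set js) \<union> insert j ` Pow (set js)" by (simp add: Pow_insert)
    moreover have "Pow (set js) \<inter> insert j ` Pow (set js) = {}" using Cons.prems(1) by auto
    moreover have "inj_on (insert j) (Pow (set js))" using Cons.prems(1)
      by (intro inj_onI) (metis PowD distinct.simps(2) insert_ident subset_eq)
    ultimately show ?thesis by (simp add: sum.union_disjoint sum.reindex)
  qed
  finally show ?case .
qed

text \<open>Modulo \<open>q\<close> linear forms of the \<open>q\<close> different degrees the Cox ring becomes a polynomial ring
  in which every graded piece is spanned by one monomial.\<close>

lemma dim_mod_monomial:
  fixes N :: "('q::finite, 'k::field) cox set" and v :: "'q \<Rightarrow> ('q, 'k) cox"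
  assumes N: "ideal_of UNIV N" and v: "\<And>i. v i \<in> forms (axis i 1)"
    and span: "\<And>i b. \<exists>c. var (i, b) - const c * v i \<in> N"
  shows "int (dim_mod (forms a) N) = indicator {a. 0 \<le> a \<and> (\<Prod>i\<in>UNIV. v i ^ nat (a $ i)) \<notin> N} a"
proof (cases "0 \<le> a")
  case False
  have "forms a = {0 :: ('q, 'k) cox}"
  proof -
    have "F = 0" if "F \<in> forms a" for F :: "('q, 'k) cox"
    proof (rule ccontr)
      assume "F \<noteq> 0"
      then obtain m where "m \<in> keys F" by (metis all_not_in_conv poly_mapping_eqI lookup_zero not_in_keys_iff_lookup_eq_zero)
      then have "mdeg m = a" using that by (simp add: forms_def)
      then show False using False mdeg_nonneg[of m] by simp
    qed
    then show ?thesis using zero_in_forms by blast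
  qed
  then have "basis_mod (forms a) N {}" using ideal_ofD(2)[OF N] by (simp add: basis_mod_def)
  then show ?thesis using dim_mod_eq[OF N] False by fastforce
next
  case True
  define w where "w = (\<lambda>m :: 'q \<times> bool \<Rightarrow>\<^sub>0 nat. \<Prod>i\<in>UNIV. v i ^ nat (mdeg m $ i))"
  let ?va = "\<Prod>i\<in>UNIV. v i ^ nat (a $ i)"
  have va: "?va \<in> forms a"
  proof -
    have "?va \<in> forms (\<Sum>i\<in>UNIV. \<chi> j. int (nat (a $ i)) * axis i 1 $ j)"
      by (rule forms_prod) (rule forms_power[OF v])
    also have "(\<Sum>i\<in>UNIV. \<chi> j. int (nat (a $ i)) * axis i 1 $ j) = a"
      using True by (simp add: vec_eq_iff axis_def less_eq_vec_def if_distrib cong: if_cong)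
    finally show ?thesis .
  qed
  \<comment> \<open>Replacing the variables of \<open>m\<close> one at a time by multiples of the
    \<open>v i\<close> keeps the degree, so the monomial reached is \<open>w m\<close>.\<close>
  have mono: "\<exists>c. single m 1 - const c * w m \<in> N" for m
  proof -
    have "\<exists>c. single m 1 - const c * w m \<in> N" if "keys m \<subseteq> A" "finite A" for A
      using that(2,1)
    proof (induction A arbitrary: m)
      case empty
      then have "m = 0" by (intro poly_mapping_eqI) (auto simp: in_keys_iff)
      then show ?case using ideal_ofD(2)[OF N] by (intro exI[of _ 1]) (simp add: w_def mdeg.\<delta>_0)
    next
      case (insert x A)
      obtain i b where x: "x = (i, b)" by force
      define n where "n = lookup m x"
      define m' where "m' = Poly_Mapping.update x 0 m"
      have m: "m = m' + single x n"
        by (rule poly_mapping_eqI) (auto simp: m'_def n_def lookup_update lookup_add lookup_single when_def)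
      have "keys m' \<subseteq> A" using insert.prems by (auto simp: m'_def in_keys_iff lookup_update subset_iff split: if_splits)
      then obtain c where c: "single m' 1 - const c * w m' \<in> N" using insert.IH by blast
      obtain d where d: "var (i, b) - const d * v i \<in> N" using span by blast
      have pw: "var (i, b) ^ k - (const d * v i) ^ k \<in> N" for k
      proof (induction k)
        case (Suc k)
        have "var (i, b) ^ Suc k - (const d * v i) ^ Suc k =
            var (i, b) * (var (i, b) ^ k - (const d * v i) ^ k) + (const d * v i) ^ k * (var (i, b) - const d * v i)"
          by (simp add: algebra_simps)
        then show ?case using Suc d N by (auto intro!: ideal_ofD(3)[OF N] intro: ideal_UNIV_mult)
      qed (use ideal_ofD(2)[OF N] in simp)
      have "w m = (\<Prod>j\<in>UNIV. v j ^ nat (mdeg m' $ j) * (if j = i then v j ^ n else 1))"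
        unfolding w_def m using mdeg_nonneg[of m']
        by (intro prod.cong) (auto simp: mdeg.\<delta>_add x mdeg_single nat_add_distrib power_add less_eq_vec_def)
      also have "\<dots> = w m' * v i ^ n" by (simp add: w_def prod.distrib)
      finally have w: "w m = w m' * v i ^ n" .
      have "var (i, b) ^ n = (single (single x n) 1 :: ('q, 'k) cox)"
        by (induction n) (auto simp: x Defs.var_def mult_single single_add[symmetric])
      then have "single m (1::'k) = single m' 1 * var (i, b) ^ n"
        by (simp add: m mult_single)
      moreover have "const (c * d ^ n) = const c * const d ^ n" by (induction n) (auto simp: const_mult)
      ultimately have e: "single m (1::'k) = single m' 1 * var (i, b) ^ n"
        "const (c * d ^ n) = const c * const d ^ n" by blast+
      have "single m 1 - const (c * d ^ n) * w m =
          var (i, b) ^ n * (single m' 1 - const c * w m') +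
          (const c * w m') * (var (i, b) ^ n - (const d * v i) ^ n)"
        unfolding w e by (simp add: algebra_simps power_mult_distrib)
      also have "\<dots> \<in> N" using pw c N by (auto intro!: ideal_ofD(3)[OF N] intro: ideal_UNIV_mult)
      finally show ?case by blast
    qed
    then show ?thesis by (meson finite_keys subset_refl)
  qed
  have spans: "\<exists>c. f - const c * ?va \<in> N" if f: "f \<in> forms a" for f
  proof -
    obtain c where c: "\<And>m. single m 1 - const (c m) * w m \<in> N" using mono by metis
    let ?k = "\<lambda>m. lookup f m"
    have "(\<Sum>m\<in>keys f. const (?k m) * (single m 1 - const (c m) * w m)) \<in> N"
      by (rule ideal_sum[OF N]) (use c N in \<open>auto intro: ideal_UNIV_mult\<close>)
    also have "(\<Sum>m\<in>keys f. const (?k m) * (single m 1 - const (c m) * w m)) =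
      (\<Sum>m\<in>keys f. single m (?k m) - const (?k m * c m) * ?va)"
    proof (rule sum.cong)
      fix m assume "m \<in> keys f"
      then have "w m = ?va" using f by (simp add: forms_def w_def)
      then show "const (?k m) * (single m 1 - const (c m) * w m) =
          single m (?k m) - const (?k m * c m) * ?va"
        by (simp only: right_diff_distrib const_mult_single const_mult mult.assoc mult_1_right)
    qed simp
    also have "\<dots> = f - (\<Sum>m\<in>keys f. const (?k m * c m)) * ?va"
      by (simp add: sum_subtractf sum_distrib_right poly_mapping_sum_single[symmetric])
    also have "(\<Sum>m\<in>keys f. const (?k m * c m)) = const (\<Sum>m\<in>keys f. ?k m * c m)"
      by (simp add: const_sum)
    finally show ?thesis by blast
  qed
  show ?thesis
  proof (cases "?va \<in> N")
    case vaN: True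
    have "f \<in> N" if f: "f \<in> forms a" for f
    proof -
      obtain c where "f - const c * ?va \<in> N" using spans[OF f] by blast
      then show ?thesis using ideal_UNIV_mem_cong[OF N] ideal_UNIV_mult(1)[OF N vaN] by blast
    qed
    then have "basis_mod (forms a) N {}" by (simp add: basis_mod_def)
    then show ?thesis using dim_mod_eq[OF N] vaN by fastforce
  next
    case vaN: False
    have "basis_mod (forms a) N {?va}"
      unfolding basis_mod_def
    proof (intro conjI ballI allI impI)
      fix f :: "('q, 'k) cox" assume "f \<in> forms a"
      then obtain c where "f - const c * ?va \<in> N" using spans by blast
      then show "\<exists>c. f - (\<Sum>b\<in>{?va}. const (c b) * b) \<in> N" by (intro exI[of _ "\<lambda>_. c"]) simp
    next
      fix c b assume "(\<Sum>b\<in>{?va}. const (c b) * b) \<in> N" and b: "b \<in> {?va}"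
      then have *: "const (c ?va) * ?va \<in> N" by simp
      have "c ?va = 0"
      proof (rule ccontr)
        assume nz: "c ?va \<noteq> 0"
        have "const (inverse (c ?va)) * (const (c ?va) * ?va) \<in> N" using * N by (rule ideal_UNIV_mult[rotated])
        then show False using vaN nz by (simp add: mult.assoc[symmetric] const_mult[symmetric])
      qed
      then show "c b = 0" using b by simp
    qed (use va in auto)
    then show ?thesis using dim_mod_eq[OF N] vaN True by fastforce
  qed
qed

section \<open>Extension of homomorphisms and algebraicity\<close>

definition subring_of :: "'a::comm_ring_1 set \<Rightarrow> bool" where
  "subring_of A \<longleftrightarrow> 1 \<in> A \<and> (\<forall>x\<in>A. \<forall>y\<in>A. x + y \<in> A \<and> x * y \<in> A) \<and> (\<forall>x\<in>A. - x \<in> A)"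

lemma subring_ofD:
  assumes "subring_of A"
  shows "1 \<in> A" "0 \<in> A" "\<And>x y. x \<in> A \<Longrightarrow> y \<in> A \<Longrightarrow> x + y \<in> A"
    "\<And>x y. x \<in> A \<Longrightarrow> y \<in> A \<Longrightarrow> x * y \<in> A" "\<And>x. x \<in> A \<Longrightarrow> - x \<in> A"
    "\<And>x y. x \<in> A \<Longrightarrow> y \<in> A \<Longrightarrow> x - y \<in> A" "\<And>x n. x \<in> A \<Longrightarrow> x ^ n \<in> A"
proof -
  show A: "1 \<in> A" "\<And>x y. x \<in> A \<Longrightarrow> y \<in> A \<Longrightarrow> x + y \<in> A"
    "\<And>x y. x \<in> A \<Longrightarrow> y \<in> A \<Longrightarrow> x * y \<in> A" "\<And>x. x \<in> A \<Longrightarrow> - x \<in> A"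
    using assms by (auto simp: subring_of_def)
  have "1 + - 1 \<in> A" by (intro A)
  then show "0 \<in> A" by simp
  show "x - y \<in> A" if "x \<in> A" "y \<in> A" for x y
    using A(2)[OF that(1) A(4)[OF that(2)]] by simp
  show "x ^ n \<in> A" if "x \<in> A" for x n
    using that by (induction n) (auto intro: A)
qed

lemma subring_of_sum: "subring_of A \<Longrightarrow> (\<And>i. i \<in> S \<Longrightarrow> f i \<in> A) \<Longrightarrow> sum f S \<in> A"
  by (induction S rule: infinite_finite_induct) (auto simp: subring_ofD)

lemma subring_of_prod: "subring_of A \<Longrightarrow> (\<And>i. i \<in> S \<Longrightarrow> f i \<in> A) \<Longrightarrow> prod f S \<in> A"
  by (induction S rule: infinite_finite_induct) (auto simp: subring_ofD)

text \<open>Also used with an ideal \<open>P\<close> in place of a ring: \<open>polys_over P\<close>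
  then collects the polynomials that become zero modulo \<open>P\<close>.\<close>

definition polys_over :: "'a::comm_ring_1 set \<Rightarrow> 'a poly set" where
  "polys_over A = {p. \<forall>k. poly.coeff p k \<in> A}"

lemma subring_of_polys_over: "subring_of A \<Longrightarrow> subring_of (polys_over A)"
proof -
  assume A: "subring_of A"
  show ?thesis
    unfolding subring_of_def polys_over_def
    by (auto simp: subring_ofD[OF A] coeff_mult coeff_1 intro!: subring_of_sum[OF A])
qed

lemma monom_polys_over: "subring_of A \<Longrightarrow> c \<in> A \<Longrightarrow> Polynomial.monom c n \<in> polys_over A"
  by (auto simp: polys_over_def subring_ofD)

lemma smult_polys_over: "subring_of A \<Longrightarrow> c \<in> A \<Longrightarrow> p \<in> polys_over A \<Longrightarrow> smult c p \<in> polys_over A"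
  by (auto simp: polys_over_def subring_ofD)

lemma polys_over_ideal_mult:
  assumes "ideal_of R P" "A \<subseteq> R" "p \<in> polys_over P" "q \<in> polys_over A"
  shows "q * p \<in> polys_over P"
  using assms unfolding polys_over_def
  by (auto simp: coeff_mult intro!: ideal_sum[OF assms(1)] ideal_ofD(4)[OF assms(1)])

lemma poly_mem_ideal:
  assumes "ideal_of R P" "subring_of R" "p \<in> polys_over P" "x \<in> R"
  shows "poly p x \<in> P"
  unfolding poly_altdef
proof (rule ideal_sum[OF assms(1)])
  fix i
  have "x ^ i * poly.coeff p i \<in> P"
    using assms by (intro ideal_ofD(4)[OF assms(1)]) (auto simp: polys_over_def subring_ofD)
  then show "poly.coeff p i * x ^ i \<in> P" by (simp add: mult.commute)
qed

lemma poly_mem_subring: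
  assumes "subring_of R" "p \<in> polys_over R" "x \<in> R"
  shows "poly p x \<in> R"
  unfolding poly_altdef
  using assms by (intro subring_of_sum) (auto simp: polys_over_def subring_ofD)

definition adjoin :: "'a::comm_ring_1 set \<Rightarrow> 'a \<Rightarrow> 'a set" where
  "adjoin A x = (\<lambda>p. poly p x) ` polys_over A"

lemma subring_of_adjoin:
  assumes A: "subring_of A"
  shows "subring_of (adjoin A x)"
proof -
  note S = subring_ofD[OF subring_of_polys_over[OF A]]
  show ?thesis
    unfolding subring_of_def adjoin_def
  proof (intro conjI ballI)
    show "1 \<in> (\<lambda>p. poly p x) ` polys_over A" by (rule image_eqI[of _ _ 1]) (auto intro: S)
  next
    fix u v assume "u \<in> (\<lambda>p. poly p x) ` polys_over A" "v \<in> (\<lambda>p. poly p x) ` polys_over A"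
    then obtain p q where pq: "u = poly p x" "v = poly q x" "p \<in> polys_over A" "q \<in> polys_over A" by blast
    show "u + v \<in> (\<lambda>p. poly p x) ` polys_over A"
      by (rule image_eqI[of _ _ "p + q"]) (use pq in \<open>auto intro: S\<close>)
    show "u * v \<in> (\<lambda>p. poly p x) ` polys_over A"
      by (rule image_eqI[of _ _ "p * q"]) (use pq in \<open>auto intro: S\<close>)
  next
    fix u assume "u \<in> (\<lambda>p. poly p x) ` polys_over A"
    then obtain p where p: "u = poly p x" "p \<in> polys_over A" by blast
    show "- u \<in> (\<lambda>p. poly p x) ` polys_over A"
      by (rule image_eqI[of _ _ "- p"]) (use p in \<open>auto intro: S\<close>)
  qed
qed

lemma adjoin_superset:
  assumes "subring_of A"
  shows "A \<subseteq> adjoin A x" "x \<in> adjoin A x"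
proof -
  show "A \<subseteq> adjoin A x"
  proof
    fix a assume "a \<in> A"
    then show "a \<in> adjoin A x" unfolding adjoin_def
      by (intro image_eqI[of _ _ "Polynomial.monom a 0"]) (auto simp: poly_monom monom_polys_over assms)
  qed
  show "x \<in> adjoin A x" unfolding adjoin_def
    by (intro image_eqI[of _ _ "Polynomial.monom 1 1"]) (auto simp: poly_monom monom_polys_over assms subring_ofD)
qed

lemma adjoin_subset: "subring_of R \<Longrightarrow> A \<subseteq> R \<Longrightarrow> x \<in> R \<Longrightarrow> adjoin A x \<subseteq> R"
  unfolding adjoin_def by (auto intro!: poly_mem_subring simp: polys_over_def subset_iff)

section \<open>Extending homomorphisms into an algebraically closed field\<close>

definition hom_on :: "'a::comm_ring_1 set \<Rightarrow> ('a \<Rightarrow> 'w::field) \<Rightarrow> bool" where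
  "hom_on A \<phi> \<longleftrightarrow> \<phi> 1 = 1 \<and> (\<forall>x\<in>A. \<forall>y\<in>A. \<phi> (x + y) = \<phi> x + \<phi> y \<and> \<phi> (x * y) = \<phi> x * \<phi> y)"

lemma hom_onD:
  assumes "hom_on A \<phi>"
  shows "\<phi> 1 = 1" "\<And>x y. x \<in> A \<Longrightarrow> y \<in> A \<Longrightarrow> \<phi> (x + y) = \<phi> x + \<phi> y"
    "\<And>x y. x \<in> A \<Longrightarrow> y \<in> A \<Longrightarrow> \<phi> (x * y) = \<phi> x * \<phi> y"
  using assms by (auto simp: hom_on_def)

lemma hom_on_0: "subring_of A \<Longrightarrow> hom_on A \<phi> \<Longrightarrow> \<phi> 0 = 0"
  using hom_onD(2)[of A \<phi> 0 0] subring_ofD(2)[of A] by (metis add.right_neutral add_left_cancel)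

lemma hom_on_power: "subring_of A \<Longrightarrow> hom_on A \<phi> \<Longrightarrow> x \<in> A \<Longrightarrow> \<phi> (x ^ n) = \<phi> x ^ n"
  by (induction n) (auto simp: hom_onD subring_ofD)

lemma hom_on_sum:
  assumes "subring_of A" "hom_on A \<phi>" "\<And>i. i \<in> S \<Longrightarrow> f i \<in> A"
  shows "\<phi> (sum f S) = (\<Sum>i\<in>S. \<phi> (f i))"
  using assms(3)
  by (induction S rule: infinite_finite_induct) (auto simp: hom_onD[OF assms(2)] hom_on_0[OF assms(1,2)] subring_of_sum[OF assms(1)])

lemma map_poly_hom_on:
  assumes A: "subring_of A" and \<phi>: "hom_on A \<phi>" and p: "p \<in> polys_over A" and q: "q \<in> polys_over A"
  shows "map_poly \<phi> (p + q) = map_poly \<phi> p + map_poly \<phi> q"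
    "map_poly \<phi> (p * q) = map_poly \<phi> p * map_poly \<phi> q"
    "c \<in> A \<Longrightarrow> map_poly \<phi> (smult c p) = smult (\<phi> c) (map_poly \<phi> p)"
proof -
  note c = coeff_map_poly[of \<phi>, OF hom_on_0[OF A \<phi>]]
  have pq: "poly.coeff p k \<in> A" "poly.coeff q k \<in> A" for k using p q by (auto simp: polys_over_def)
  show "map_poly \<phi> (p + q) = map_poly \<phi> p + map_poly \<phi> q"
    by (rule poly_eqI) (simp add: c hom_onD[OF \<phi>] pq)
  show "map_poly \<phi> (p * q) = map_poly \<phi> p * map_poly \<phi> q"
    by (rule poly_eqI) (simp add: c coeff_mult hom_onD[OF \<phi>] hom_on_sum[OF A \<phi>] pq subring_ofD[OF A])
  show "map_poly \<phi> (smult c p) = smult (\<phi> c) (map_poly \<phi> p)" if "c \<in> A"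
    by (rule poly_eqI) (simp add: c hom_onD[OF \<phi>] pq that)
qed

text \<open>The condition on \<open>\<omega>\<close> says that evaluation at \<open>\<omega>\<close> is well defined.\<close>

lemma extend_hom_at:
  assumes A: "subring_of A" and P: "ideal_of R P" and \<phi>: "hom_on A \<phi>"
    and \<omega>: "\<And>p. p \<in> polys_over A \<Longrightarrow> poly p x \<in> P \<Longrightarrow> poly (map_poly \<phi> p) \<omega> = 0"
  obtains \<psi> where "hom_on (adjoin A x) \<psi>" "\<And>y. y \<in> adjoin A x \<inter> P \<Longrightarrow> \<psi> y = 0" "\<And>y. y \<in> A \<Longrightarrow> \<psi> y = \<phi> y"
    "\<And>p. p \<in> polys_over A \<Longrightarrow> \<psi> (poly p x) = poly (map_poly \<phi> p) \<omega>"
proof -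
  note S = subring_ofD[OF subring_of_polys_over[OF A]]
  note M = map_poly_hom_on[OF A \<phi>]
  \<comment> \<open>The choice of a representing polynomial is harmless: two of them differ by a
    polynomial with value 0 at \<open>x\<close>, and as 0 lies in \<open>P\<close> the condition on
    \<open>\<omega>\<close> applies to the difference.\<close>
  define \<psi> where "\<psi> = (\<lambda>y. poly (map_poly \<phi> (SOME p. p \<in> polys_over A \<and> poly p x = y)) \<omega>)"
  have \<psi>: "\<psi> (poly p x) = poly (map_poly \<phi> p) \<omega>" if p: "p \<in> polys_over A" for p
  proof -
    define q where "q = (SOME q. q \<in> polys_over A \<and> poly q x = poly p x)"
    have q: "q \<in> polys_over A" "poly q x = poly p x"
      using someI[of "\<lambda>q. q \<in> polys_over A \<and> poly q x = poly p x" p] p by (auto simp: q_def)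
    have "poly (map_poly \<phi> (p - q)) \<omega> = 0"
      using q p ideal_ofD(2)[OF P] by (intro \<omega>) (auto intro: S)
    moreover have "map_poly \<phi> ((p - q) + q) = map_poly \<phi> (p - q) + map_poly \<phi> q"
      using p q by (intro M S) auto
    ultimately show ?thesis by (simp add: \<psi>_def q_def[symmetric])
  qed
  have \<phi>0: "\<phi> 0 = 0" by (rule hom_on_0[OF A \<phi>])
  show ?thesis
  proof
    show "hom_on (adjoin A x) \<psi>"
      unfolding hom_on_def
    proof (intro conjI ballI)
      show "\<psi> 1 = 1" using \<psi>[of 1] S(1) by (simp add: hom_onD(1)[OF \<phi>])
    next
      fix u v assume "u \<in> adjoin A x" "v \<in> adjoin A x"
      then obtain p q where pq: "u = poly p x" "v = poly q x" "p \<in> polys_over A" "q \<in> polys_over A"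
        by (auto simp: adjoin_def)
      show "\<psi> (u + v) = \<psi> u + \<psi> v" using \<psi>[of "p + q"] pq by (simp add: \<psi> S M)
      show "\<psi> (u * v) = \<psi> u * \<psi> v" using \<psi>[of "p * q"] pq by (simp add: \<psi> S M)
    qed
    show "\<psi> y = 0" if "y \<in> adjoin A x \<inter> P" for y
      using that by (auto simp: adjoin_def \<psi> \<omega>)
    show "\<psi> y = \<phi> y" if "y \<in> A" for y
      using \<psi>[OF monom_polys_over[OF A that, of 0]] \<phi>0 by (simp add: poly_monom map_poly_monom)
  qed (use \<psi> in blast)
qed

text \<open>Multiplying \<open>f\<close> by the top coefficient of \<open>g\<close> before each
  subtraction avoids division. The bounds count coefficients: at most \<open>n\<close> for
  \<open>f\<close>, \<open>d + 1\<close> for \<open>g\<close>, \<open>n - d\<close> for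
  \<open>q\<close> and \<open>d\<close> for \<open>r\<close>.\<close>

lemma pseudo_division:
  assumes A: "subring_of A" and g: "g \<in> polys_over A" "\<And>k. k > d \<Longrightarrow> poly.coeff g k = 0"
  shows "f \<in> polys_over A \<Longrightarrow> (\<And>k. k \<ge> n \<Longrightarrow> poly.coeff f k = 0) \<Longrightarrow>
    \<exists>k q r. q \<in> polys_over A \<and> r \<in> polys_over A \<and> smult (poly.coeff g d ^ k) f = q * g + r \<and>
      (\<forall>k\<ge>n - d. poly.coeff q k = 0) \<and> (\<forall>k\<ge>d. poly.coeff r k = 0)"
proof (induction n arbitrary: f)
  case 0
  then have "f = 0" by (intro poly_eqI) simp
  then show ?case using subring_ofD(2)[OF subring_of_polys_over[OF A]]
    by (intro exI[of _ 0] exI[of _ "0 :: 'a poly"]) auto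
next
  case (Suc n f)
  note S = subring_ofD[OF subring_of_polys_over[OF A]]
  let ?c = "poly.coeff g d"
  show ?case
  proof (cases "n < d")
    case True
    then show ?thesis using Suc.prems S(2)
      by (intro exI[of _ 0] exI[of _ "0 :: 'a poly"] exI[of _ f]) auto
  next
    case False
    define m where "m = Polynomial.monom (poly.coeff f n) (n - d)"
    have c: "?c \<in> A" using g by (simp add: polys_over_def)
    have m: "m \<in> polys_over A" unfolding m_def using Suc.prems by (intro monom_polys_over[OF A]) (simp add: polys_over_def)
    define f1 where "f1 = smult ?c f - m * g"
    have f1: "f1 \<in> polys_over A" unfolding f1_def using Suc.prems c m g
      by (intro S smult_polys_over[OF A]) auto
    have "poly.coeff f1 k = 0" if "k \<ge> n" for k
      using that False Suc.prems(2)[of k] g(2)[of "k - (n - d)"]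
      by (cases "k = n") (auto simp: f1_def m_def coeff_monom_mult)
    then obtain k q r where IH: "q \<in> polys_over A" "r \<in> polys_over A" "smult (?c ^ k) f1 = q * g + r"
      "\<forall>k\<ge>n - d. poly.coeff q k = 0" "\<forall>k\<ge>d. poly.coeff r k = 0"
      using Suc.IH[OF f1] by blast
    have "smult (?c ^ Suc k) f = smult (?c ^ k) f1 + smult (?c ^ k) (m * g)"
      by (simp add: f1_def smult_diff_right mult.commute)
    also have "\<dots> = (q + smult (?c ^ k) m) * g + r" unfolding IH(3) by (simp add: algebra_simps)
    finally have "smult (?c ^ Suc k) f = (q + smult (?c ^ k) m) * g + r" .
    moreover have "q + smult (?c ^ k) m \<in> polys_over A"
      using IH(1) m c by (intro S smult_polys_over[OF A]) (auto intro: subring_ofD[OF A])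
    moreover have "\<forall>j\<ge>Suc n - d. poly.coeff (q + smult (?c ^ k) m) j = 0"
      using IH(4) False by (auto simp: m_def)
    ultimately show ?thesis using IH(2,5) by blast
  qed
qed

text \<open>A nonconstant \<open>p\<close> takes the value 1, since \<open>p - 1\<close> has a
  root.\<close>

lemma alg_closed_nonroot:
  fixes p :: "'w::alg_closed_field poly"
  assumes "p \<noteq> 0"
  shows "\<exists>x. poly p x \<noteq> 0"
proof (cases "Polynomial.degree p = 0")
  case True
  then obtain c where "p = [:c:]" by (rule degree_eq_zeroE)
  then show ?thesis using assms by auto
next
  case False
  have "Polynomial.degree (p + [:-1:]) = Polynomial.degree p"
    using False by (intro degree_add_eq_left) auto
  then obtain x where "poly (p + [:-1:]) x = 0" using False alg_closed_imp_poly_has_root[of "p + [:-1:]"] by auto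
  then show ?thesis by (intro exI[of _ x]) auto
qed

text \<open>If \<open>x\<close> is transcendental modulo \<open>P\<close>, take for \<open>a\<close> a coefficient of a polynomial representing
  \<open>b\<close>. Otherwise let \<open>f\<close> be a relation of \<open>x\<close> of minimal degree; a Bezout identity makes \<open>b\<close> divide an
  element of \<open>A\<close> modulo \<open>P\<close>, and \<open>a\<close> is this element times the leading coefficient of \<open>f\<close>.\<close>

lemma extend_hom_step:
  fixes A :: "'a::comm_ring_1 set"
  assumes A: "subring_of A" and R: "subring_of R" "A \<subseteq> R" "x \<in> R" and P: "prime_ideal_of R P"
    and b: "b \<in> adjoin A x" "b \<notin> P"
  shows "\<exists>a\<in>A. a \<notin> P \<and> (\<forall>\<phi> :: 'a \<Rightarrow> 'w::alg_closed_field.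
    hom_on A \<phi> \<longrightarrow> (\<forall>y\<in>A \<inter> P. \<phi> y = 0) \<longrightarrow> \<phi> a \<noteq> 0 \<longrightarrow>
    (\<exists>\<psi>. hom_on (adjoin A x) \<psi> \<and> (\<forall>y\<in>adjoin A x \<inter> P. \<psi> y = 0) \<and> (\<forall>y\<in>A. \<psi> y = \<phi> y) \<and> \<psi> b \<noteq> 0))"
proof -
  note S = subring_ofD[OF subring_of_polys_over[OF A]]
  have idP: "ideal_of R P" and prP: "\<And>u v. u \<in> R \<Longrightarrow> v \<in> R \<Longrightarrow> u * v \<in> P \<Longrightarrow> u \<in> P \<or> v \<in> P"
    using P by (auto simp: prime_ideal_of_def)
  have pow_mult: "v \<in> P" if "u \<in> A" "u \<notin> P" "v \<in> R" "u ^ n * v \<in> P" for u v n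
    using that(4)
  proof (induction n)
    case (Suc n)
    have "u * (u ^ n * v) \<in> P" using Suc.prems by (simp add: mult.assoc)
    then have "u ^ n * v \<in> P" using prP[of u "u ^ n * v"] that R by (auto intro: subring_ofD[OF R(1)])
    then show ?case by (rule Suc.IH)
  qed simp
  have evR: "poly p x \<in> R" if "p \<in> polys_over A" for p
    using that R by (intro poly_mem_subring) (auto simp: polys_over_def)
  have evP: "poly p x \<in> P" if "p \<in> polys_over P" for p
    using poly_mem_ideal[OF idP R(1) that R(3)] .
  have diffP: "u - v \<in> P" if "u \<in> P" "v \<in> P" for u v
  proof -
    have "-1 \<in> R" by (intro subring_ofD[OF R(1)])
    then have "u + (-1) * v \<in> P" using that by (intro ideal_ofD[OF idP])
    then show ?thesis by simp
  qed
  obtain g where g: "g \<in> polys_over A" "b = poly g x" using b by (auto simp: adjoin_def)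
  show ?thesis
  proof (cases "\<exists>f. f \<in> polys_over A \<and> poly f x \<in> P \<and> f \<notin> polys_over P")
    case False
    \<comment> \<open>Every relation of \<open>x\<close> over \<open>A\<close> is trivial modulo
      \<open>P\<close> here, so any \<open>\<omega>\<close> is admissible; one is taken at which the
      image of \<open>g\<close> does not vanish.\<close>
    have "g \<notin> polys_over P" using evP g b by blast
    then obtain j where j: "poly.coeff g j \<notin> P" by (auto simp: polys_over_def)
    have "\<exists>\<psi>. hom_on (adjoin A x) \<psi> \<and> (\<forall>y\<in>adjoin A x \<inter> P. \<psi> y = 0) \<and> (\<forall>y\<in>A. \<psi> y = \<phi> y) \<and> \<psi> b \<noteq> 0"
      if \<phi>: "hom_on A \<phi>" "\<forall>y\<in>A \<inter> P. \<phi> y = 0" "\<phi> (poly.coeff g j) \<noteq> 0" for \<phi> :: "'a \<Rightarrow> 'w"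
    proof -
      note c = coeff_map_poly[of \<phi>, OF hom_on_0[OF A \<phi>(1)]]
      have "map_poly \<phi> g \<noteq> 0" using \<phi>(3) c[of g j] by auto
      then obtain \<omega> where \<omega>: "poly (map_poly \<phi> g) \<omega> \<noteq> 0" using alg_closed_nonroot by blast
      have 0: "poly (map_poly \<phi> p) \<omega> = 0" if p: "p \<in> polys_over A" "poly p x \<in> P" for p
      proof -
        have "p \<in> polys_over P" using p False by blast
        then have "map_poly \<phi> p = 0" using p \<phi>(2) by (intro poly_eqI) (auto simp: c polys_over_def)
        then show ?thesis by simp
      qed
      obtain \<psi> where "hom_on (adjoin A x) \<psi>" "\<And>y. y \<in> adjoin A x \<inter> P \<Longrightarrow> \<psi> y = 0" "\<And>y. y \<in> A \<Longrightarrow> \<psi> y = \<phi> y"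
        "\<And>p. p \<in> polys_over A \<Longrightarrow> \<psi> (poly p x) = poly (map_poly \<phi> p) \<omega>"
        using extend_hom_at[OF A idP \<phi>(1) 0] by blast
      then show ?thesis using \<omega> g by (intro exI[of _ \<psi>]) auto
    qed
    then show ?thesis using j g by (intro bexI[of _ "poly.coeff g j"]) (auto simp: polys_over_def)
  next
    case True
    have mono: "p - Polynomial.monom (poly.coeff p e) e \<in> polys_over A" if "p \<in> polys_over A" for p e
      using that by (intro S monom_polys_over[OF A]) (auto simp: polys_over_def)
    have polyP: "p \<in> polys_over P" if "p - Polynomial.monom c e \<in> polys_over P" "c \<in> P" for p c e
    proof -
      have "poly.coeff p k \<in> P" for k
      proof -
        have "poly.coeff (p - Polynomial.monom c e) k + (if k = e then c else 0) \<in> P"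
          using that ideal_ofD[OF idP] by (auto simp: polys_over_def)
        then show ?thesis by (auto split: if_splits)
      qed
      then show ?thesis by (simp add: polys_over_def)
    qed
    \<comment> \<open>This says that the degree is less than \<open>n\<close>, with
      \<open>n = 0\<close> left to the zero polynomial.\<close>
    define bounded where "bounded = (\<lambda>n (p :: 'a poly). \<forall>k\<ge>n. poly.coeff p k = 0)"
    have bex: "\<exists>n. bounded n p" for p
      unfolding bounded_def by (metis coeff_eq_0 Suc_le_eq)
    define n where "n = (LEAST n. \<exists>f. f \<in> polys_over A \<and> poly f x \<in> P \<and> f \<notin> polys_over P \<and> bounded n f)"
    have "\<exists>n f. f \<in> polys_over A \<and> poly f x \<in> P \<and> f \<notin> polys_over P \<and> bounded n f" using True bex by blast
    then have "\<exists>f. f \<in> polys_over A \<and> poly f x \<in> P \<and> f \<notin> polys_over P \<and> bounded n f"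
      unfolding n_def by (rule LeastI_ex)
    then obtain f where f: "f \<in> polys_over A" "poly f x \<in> P" "f \<notin> polys_over P" "bounded n f" by blast
    have minf: "p \<in> polys_over P" if "p \<in> polys_over A" "poly p x \<in> P" "bounded m p" "m < n" for p m
      using not_less_Least[of m "\<lambda>n. \<exists>f. f \<in> polys_over A \<and> poly f x \<in> P \<and> f \<notin> polys_over P \<and> bounded n f"] that
      unfolding n_def by blast
    have "n \<noteq> 0"
    proof
      assume "n = 0"
      then have "f = 0" using f(4) by (intro poly_eqI) (simp add: bounded_def)
      then show False using f(3) ideal_ofD(2)[OF idP] by (simp add: polys_over_def)
    qed
    then obtain d where n: "n = Suc d" by (cases n) auto
    define c where "c = poly.coeff f d"
    have cA: "c \<in> A" using f by (simp add: c_def polys_over_def)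
    have bminus: "bounded e (p - Polynomial.monom (poly.coeff p e) e)" if "bounded (Suc e) p" for p e
      using that by (auto simp: bounded_def)
    \<comment> \<open>If the top coefficient were in \<open>P\<close>, dropping it would leave a
      shorter relation that is still nontrivial modulo \<open>P\<close>.\<close>
    have cP: "c \<notin> P"
    proof
      assume c: "c \<in> P"
      have "c * x ^ d \<in> P" using c R(3) ideal_ofD(4)[OF idP, of "x ^ d" c] subring_ofD[OF R(1)] by (simp add: mult.commute)
      then have "poly (f - Polynomial.monom c d) x \<in> P" using f(2) diffP by (simp add: poly_monom)
      then have "f - Polynomial.monom c d \<in> polys_over P"
        using minf[OF mono[OF f(1)], of d d] bminus[of d f] f(4) by (simp add: c_def n)
      then show False using polyP[OF _ c] f(3) by blast
    qed
    have d0: "d \<noteq> 0"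
    proof
      assume "d = 0"
      then have "f = Polynomial.monom c 0" using f(4) by (intro poly_eqI) (auto simp: bounded_def n c_def)
      then show False using f(2) cP by (simp add: poly_monom)
    qed
    \<comment> \<open>The preimage in A[X] of the ideal that \<open>f\<close> and \<open>g\<close>
      generate after reducing coefficients modulo \<open>P\<close>.\<close>
    define T where "T = {h \<in> polys_over A. \<exists>u\<in>polys_over A. \<exists>v\<in>polys_over A. h - v * g - u * f \<in> polys_over P}"
    note SP = ideal_ofD[OF idP]
    have addP: "p + q \<in> polys_over P" if "p \<in> polys_over P" "q \<in> polys_over P" for p q
      using that SP by (simp add: polys_over_def)
    have minusP: "p - q \<in> polys_over P" if "p \<in> polys_over P" "q \<in> polys_over P" for p q
      using that diffP by (simp add: polys_over_def)
    have multP: "q * p \<in> polys_over P" if "p \<in> polys_over P" "q \<in> polys_over A" for p q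
      using polys_over_ideal_mult[OF idP R(2) that] .
    have zP: "0 \<in> polys_over P" using SP by (simp add: polys_over_def)
    have "f - 0 * g - 1 * f \<in> polys_over P" "g - 1 * g - 0 * f \<in> polys_over P" using zP by simp_all
    then have Tf: "f \<in> T" and Tg: "g \<in> T"
      unfolding T_def using f(1) g(1) S(1,2) by blast+
    have T1: "q * h \<in> T" if "h \<in> T" "q \<in> polys_over A" for h q
    proof -
      obtain u v where uv: "u \<in> polys_over A" "v \<in> polys_over A" "h - v * g - u * f \<in> polys_over P"
        using \<open>h \<in> T\<close> by (auto simp: T_def)
      have "q * h - (q * v) * g - (q * u) * f = q * (h - v * g - u * f)" by (simp add: algebra_simps)
      then have "q * h - (q * v) * g - (q * u) * f \<in> polys_over P" using multP[OF uv(3) that(2)] by simp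
      moreover have "q * h \<in> polys_over A" using that by (auto simp: T_def intro: S)
      ultimately show ?thesis unfolding T_def using that(2) uv(1,2) S(4) by blast
    qed
    have T2: "h - h' \<in> T" if hh: "h \<in> T" "h' \<in> T" for h h'
    proof -
      obtain u v u' v' where uv: "u \<in> polys_over A" "v \<in> polys_over A" "h - v * g - u * f \<in> polys_over P"
         "u' \<in> polys_over A" "v' \<in> polys_over A" "h' - v' * g - u' * f \<in> polys_over P"
        using hh unfolding T_def by blast
      have eq: "h - h' - (v - v') * g - (u - u') * f = (h - v * g - u * f) - (h' - v' * g - u' * f)"
        by (simp add: algebra_simps)
      then have "h - h' - (v - v') * g - (u - u') * f \<in> polys_over P" using minusP[OF uv(3,6)] by (simp only: eq)
      moreover have "h - h' \<in> polys_over A" using hh by (auto simp: T_def intro: S)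
      ultimately show ?thesis unfolding T_def using uv(1,2,4,5) S(6) by blast
    qed
    \<comment> \<open>A shortest element \<open>h\<close> of \<open>T\<close> that is nontrivial
      modulo \<open>P\<close> plays the part of a greatest common divisor of \<open>f\<close> and
      \<open>g\<close>.\<close>
    define m where "m = (LEAST m. \<exists>h. h \<in> T \<and> h \<notin> polys_over P \<and> bounded m h)"
    have ex_m: "\<exists>h. h \<in> T \<and> h \<notin> polys_over P \<and> bounded n h" using Tf f by blast
    then have "\<exists>h. h \<in> T \<and> h \<notin> polys_over P \<and> bounded m h"
      unfolding m_def by (rule LeastI)
    then obtain h where h: "h \<in> T" "h \<notin> polys_over P" "bounded m h" by blast
    have mn: "m \<le> n" unfolding m_def by (rule Least_le) (rule ex_m)
    have minh: "p \<in> polys_over P" if "p \<in> T" "bounded k p" "k < m" for p k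
      using not_less_Least[of k "\<lambda>m. \<exists>h. h \<in> T \<and> h \<notin> polys_over P \<and> bounded m h"] that
      unfolding m_def by blast
    have hA: "h \<in> polys_over A" using h by (simp add: T_def)
    have "m \<noteq> 0"
    proof
      assume "m = 0"
      then have "h = 0" using h(3) by (intro poly_eqI) (simp add: bounded_def)
      then show False using h(2) zP by simp
    qed
    then obtain e where m: "m = Suc e" by (cases m) auto
    define c' where "c' = poly.coeff h e"
    have c'A: "c' \<in> A" using hA by (simp add: c'_def polys_over_def)
    have c'P: "c' \<notin> P"
    proof
      assume c': "c' \<in> P"
      have "Polynomial.monom c' e \<in> polys_over P" using c' zP by (auto simp: polys_over_def)
      moreover have "Polynomial.monom c' e \<in> polys_over A" by (intro monom_polys_over[OF A] c'A)
      ultimately have "Polynomial.monom c' e \<in> T" using S(2) by (auto simp: T_def intro!: bexI[of _ 0])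
      then have "h - Polynomial.monom c' e \<in> T" using h(1) T2 by blast
      then have "h - Polynomial.monom c' e \<in> polys_over P"
        using minh[of _ e] bminus[of e h] h(3) by (simp add: c'_def m)
      then show False using polyP[OF _ c'] h(2) by blast
    qed
    \<comment> \<open>The remainder of a pseudo-division by \<open>h\<close> lies in
      \<open>T\<close> and is shorter than \<open>h\<close>, so it is trivial modulo
      \<open>P\<close>.\<close>
    have divh: "\<exists>k q. q \<in> polys_over A \<and> smult (c' ^ k) p - q * h \<in> polys_over P \<and> (\<forall>i\<ge>N - e. poly.coeff q i = 0)"
      if p: "p \<in> T" "bounded N p" for p N
    proof -
      have pA: "p \<in> polys_over A" using p by (simp add: T_def)
      have hk: "poly.coeff h k = 0" if "k > e" for k using h(3) that by (simp add: bounded_def m)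
      obtain k q r where *: "q \<in> polys_over A" "r \<in> polys_over A" "smult (c' ^ k) p = q * h + r"
        "\<forall>i\<ge>N - e. poly.coeff q i = 0" "\<forall>i\<ge>e. poly.coeff r i = 0"
        using pseudo_division[OF A hA hk pA, where n = N and d = e] p(2) by (auto simp: bounded_def c'_def)
      have "r = [:c' ^ k:] * p - q * h" using *(3) by simp
      also have "\<dots> \<in> T" using p(1) h(1) *(1) c'A
        by (intro T2 T1) (auto simp: polys_over_def coeff_pCons subring_ofD[OF A] split: nat.splits)
      finally have "r \<in> polys_over P" using minh[of r e] *(5) by (simp add: bounded_def m)
      then show ?thesis using * by (intro exI[of _ k] exI[of _ q]) simp
    qed
    obtain kf q where q: "q \<in> polys_over A" "smult (c' ^ kf) f - q * h \<in> polys_over P"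
      "\<forall>i\<ge>n - e. poly.coeff q i = 0" using divh[OF Tf f(4)] by blast
    have "q \<notin> polys_over P"
    proof
      assume "q \<in> polys_over P"
      then have "h * q \<in> polys_over P" using multP hA by blast
      then have "smult (c' ^ kf) f - q * h + h * q \<in> polys_over P" using addP[OF q(2)] by blast
      then have "smult (c' ^ kf) f \<in> polys_over P" by (simp add: mult.commute)
      then have "c' ^ kf * c \<in> P" by (auto simp: polys_over_def c_def dest: spec[of _ d])
      then show False using pow_mult[OF c'A c'P, of c kf] cA R(2) cP by blast
    qed
    have hxP: "poly h x \<notin> P"
    proof
      assume hx: "poly h x \<in> P"
      obtain N where "bounded N g" using bex by blast
      then obtain k r where r: "r \<in> polys_over A" "smult (c' ^ k) g - r * h \<in> polys_over P" using divh[OF Tg] by blast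
      have "poly r x * poly h x \<in> P" using hx evR[OF r(1)] SP(4) by blast
      moreover have "c' ^ k * b - poly r x * poly h x \<in> P" using evP[OF r(2)] g by simp
      ultimately have "(c' ^ k * b - poly r x * poly h x) + poly r x * poly h x \<in> P" using SP(3) by blast
      then have "c' ^ k * b \<in> P" by simp
      then show False using pow_mult[OF c'A c'P, of b k] evR[OF g(1)] g b by blast
    qed
    have "poly q x \<in> P"
    proof -
      have "c' ^ kf * poly f x - poly q x * poly h x \<in> P" using evP[OF q(2)] by simp
      moreover have "c' ^ kf * poly f x \<in> P"
        using f(2) c'A R(2) subring_ofD[OF A] by (intro SP(4)) auto
      ultimately have "c' ^ kf * poly f x - (c' ^ kf * poly f x - poly q x * poly h x) \<in> P" using diffP by blast
      then have "poly q x * poly h x \<in> P" by simp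
      then show ?thesis using prP[OF evR[OF q(1)] evR[OF hA]] hxP by blast
    qed
    \<comment> \<open>The cofactor \<open>q\<close> is a relation of \<open>x\<close>, nontrivial
      modulo \<open>P\<close>, with at most \<open>n - e\<close> coefficients, so minimality of
      \<open>f\<close> leaves only \<open>e = 0\<close>. Thus \<open>h\<close> is the constant
      \<open>c'\<close>, and its membership in \<open>T\<close> is the Bezout identity.\<close>
    have e0: "e = 0"
    proof (rule ccontr)
      assume "e \<noteq> 0"
      then have "n - e < n" using n by simp
      then show False using minf[OF q(1) \<open>poly q x \<in> P\<close>, of "n - e"] q(3) \<open>q \<notin> polys_over P\<close> by (simp add: bounded_def)
    qed
    have hc: "h = [:c':]" using h(3) by (intro poly_eqI) (auto simp: bounded_def m e0 c'_def coeff_pCons split: nat.splits)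
    obtain u v where uv: "u \<in> polys_over A" "v \<in> polys_over A" "h - v * g - u * f \<in> polys_over P"
      using h(1) by (auto simp: T_def)
    \<comment> \<open>Nonvanishing of \<open>\<phi> c\<close> keeps the image of \<open>f\<close>
      nonconstant, so it has a root, at which all relations vanish by pseudo-division. Nonvanishing
      of \<open>\<phi> c'\<close> prevents the images of \<open>f\<close> and \<open>g\<close> from
      vanishing there together.\<close>
    have "\<exists>\<psi>. hom_on (adjoin A x) \<psi> \<and> (\<forall>y\<in>adjoin A x \<inter> P. \<psi> y = 0) \<and> (\<forall>y\<in>A. \<psi> y = \<phi> y) \<and> \<psi> b \<noteq> 0"
      if \<phi>: "hom_on A \<phi>" "\<forall>y\<in>A \<inter> P. \<phi> y = 0" "\<phi> (c * c') \<noteq> 0" for \<phi> :: "'a \<Rightarrow> 'w"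
    proof -
      note co = coeff_map_poly[of \<phi>, OF hom_on_0[OF A \<phi>(1)]]
      note M = map_poly_hom_on[OF A \<phi>(1)]
      have c0: "\<phi> c \<noteq> 0" "\<phi> c' \<noteq> 0" using \<phi>(3) hom_onD(3)[OF \<phi>(1) cA c'A] by auto
      have zero: "map_poly \<phi> p = 0" if "p \<in> polys_over A" "p \<in> polys_over P" for p
        using that \<phi>(2) by (intro poly_eqI) (auto simp: co polys_over_def)
      have "poly.coeff (map_poly \<phi> f) d \<noteq> 0" using c0 by (simp add: co c_def)
      then have "Polynomial.degree (map_poly \<phi> f) > 0" using le_degree[of "map_poly \<phi> f" d] d0 by auto
      then obtain \<omega> where \<omega>: "poly (map_poly \<phi> f) \<omega> = 0" using alg_closed_imp_poly_has_root by blast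
      have 0: "poly (map_poly \<phi> p) \<omega> = 0" if p: "p \<in> polys_over A" "poly p x \<in> P" for p
      proof -
        obtain N where N: "bounded N p" using bex by blast
        have fk: "poly.coeff f k = 0" if "k > d" for k using f(4) that by (simp add: bounded_def n)
        obtain k q r where *: "q \<in> polys_over A" "r \<in> polys_over A" "smult (c ^ k) p = q * f + r"
          "\<forall>i\<ge>d. poly.coeff r i = 0"
          using pseudo_division[OF A f(1) fk p(1), where n = N and d = d] N by (auto simp: bounded_def c_def)
        have "poly r x = c ^ k * poly p x - poly q x * poly f x" using arg_cong[OF *(3), of "\<lambda>p. poly p x"] by simp
        also have "\<dots> \<in> P" using f(2) p(2) evR[OF *(1)] cA R(2) subring_ofD[OF A]
          by (intro diffP SP(4)) auto
        finally have "r \<in> polys_over P" using minf[OF *(2), of d] *(4) by (simp add: bounded_def n)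
        then have "map_poly \<phi> r = 0" using zero *(2) by blast
        then have "smult (\<phi> (c ^ k)) (map_poly \<phi> p) = map_poly \<phi> q * map_poly \<phi> f"
          using arg_cong[OF *(3), of "map_poly \<phi>"] p(1) *(1,2) f(1) cA S subring_ofD(7)[OF A cA] by (simp add: M)
        then have "\<phi> c ^ k * poly (map_poly \<phi> p) \<omega> = 0"
          using \<omega> hom_on_power[OF A \<phi>(1) cA] by (metis mult_zero_right poly_mult poly_smult)
        then show ?thesis using c0 by simp
      qed
      obtain \<psi> where \<psi>: "hom_on (adjoin A x) \<psi>" "\<And>y. y \<in> adjoin A x \<inter> P \<Longrightarrow> \<psi> y = 0" "\<And>y. y \<in> A \<Longrightarrow> \<psi> y = \<phi> y"
        "\<And>p. p \<in> polys_over A \<Longrightarrow> \<psi> (poly p x) = poly (map_poly \<phi> p) \<omega>"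
        using extend_hom_at[OF A idP \<phi>(1) 0] by blast
      have "\<psi> b \<noteq> 0"
      proof
        assume "\<psi> b = 0"
        then have g0: "poly (map_poly \<phi> g) \<omega> = 0" using \<psi>(4)[OF g(1)] g(2) by simp
        have "map_poly \<phi> (h - v * g - u * f) = 0"
          using uv(3) hA g f uv by (intro zero) (auto intro: S)
        moreover have "h = (h - v * g - u * f) + (v * g + u * f)" by simp
        then have "map_poly \<phi> h = map_poly \<phi> (h - v * g - u * f) + map_poly \<phi> (v * g + u * f)"
          using hA g f uv by (subst M(1)[symmetric]) (auto intro: S)
        ultimately have "map_poly \<phi> h = map_poly \<phi> v * map_poly \<phi> g + map_poly \<phi> u * map_poly \<phi> f"
          using g f uv by (simp add: M S)
        then have "poly (map_poly \<phi> h) \<omega> = 0" using g0 \<omega> by simp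
        moreover have "map_poly \<phi> h = [:\<phi> c':]" unfolding hc
          by (rule poly_eqI) (simp add: co coeff_pCons hom_on_0[OF A \<phi>(1)] split: nat.splits)
        ultimately show False using c0 by simp
      qed
      then show ?thesis using \<psi> by blast
    qed
    moreover have "c * c' \<in> A" "c * c' \<notin> P" using cA c'A cP c'P prP[of c c'] R(2) by (auto intro: subring_ofD[OF A])
    ultimately show ?thesis by blast
  qed
qed

section \<open>Finitely generated algebras and algebraicity in dimension zero\<close>

fun adjoins :: "'a::comm_ring_1 set \<Rightarrow> 'a list \<Rightarrow> 'a set" where
  "adjoins A [] = A"
| "adjoins A (x # xs) = adjoins (adjoin A x) xs"

lemma adjoins_subring: "subring_of A \<Longrightarrow> subring_of (adjoins A xs)"
  by (induction xs arbitrary: A) (auto simp: subring_of_adjoin)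

lemma adjoins_superset: "subring_of A \<Longrightarrow> A \<union> set xs \<subseteq> adjoins A xs"
proof (induction xs arbitrary: A)
  case (Cons x xs)
  have "adjoin A x \<union> set xs \<subseteq> adjoins (adjoin A x) xs" by (rule Cons.IH[OF subring_of_adjoin[OF Cons.prems]])
  then show ?case using adjoin_superset[OF Cons.prems, of x] by auto
qed simp

lemma adjoins_subset: "subring_of R \<Longrightarrow> A \<subseteq> R \<Longrightarrow> set xs \<subseteq> R \<Longrightarrow> adjoins A xs \<subseteq> R"
  by (induction xs arbitrary: A) (auto simp: adjoin_subset)

text \<open>Induction on the generators: the element \<open>a'\<close> obtained for the later ones
  takes the role of \<open>b\<close> when \<open>x\<close> is adjoined.\<close>

lemma extend_hom:
  fixes A :: "'a::comm_ring_1 set"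
  assumes A: "subring_of A" and R: "subring_of R" "A \<subseteq> R" "set xs \<subseteq> R" and P: "prime_ideal_of R P"
    and b: "b \<in> adjoins A xs" "b \<notin> P"
  shows "\<exists>a\<in>A. a \<notin> P \<and> (\<forall>\<phi> :: 'a \<Rightarrow> 'w::alg_closed_field.
    hom_on A \<phi> \<longrightarrow> (\<forall>y\<in>A \<inter> P. \<phi> y = 0) \<longrightarrow> \<phi> a \<noteq> 0 \<longrightarrow>
    (\<exists>\<psi>. hom_on (adjoins A xs) \<psi> \<and> (\<forall>y\<in>adjoins A xs \<inter> P. \<psi> y = 0) \<and> (\<forall>y\<in>A. \<psi> y = \<phi> y) \<and> \<psi> b \<noteq> 0))"
  using A R(2,3) b
proof (induction xs arbitrary: A)
  case Nil
  then show ?case by auto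
next
  case (Cons x xs A)
  note sub = adjoin_superset[OF Cons.prems(1), of x]
  have xR: "x \<in> R" using Cons.prems by simp
  obtain a' where a': "a' \<in> adjoin A x" "a' \<notin> P" "\<And>\<phi> :: 'a \<Rightarrow> 'w.
    hom_on (adjoin A x) \<phi> \<Longrightarrow> (\<forall>y\<in>adjoin A x \<inter> P. \<phi> y = 0) \<Longrightarrow> \<phi> a' \<noteq> 0 \<Longrightarrow>
    (\<exists>\<psi>. hom_on (adjoins A (x # xs)) \<psi> \<and> (\<forall>y\<in>adjoins A (x # xs) \<inter> P. \<psi> y = 0) \<and> (\<forall>y\<in>adjoin A x. \<psi> y = \<phi> y) \<and> \<psi> b \<noteq> 0)"
    using Cons.IH[OF subring_of_adjoin[OF Cons.prems(1)] adjoin_subset[OF R(1) Cons.prems(2) xR]] Cons.prems by auto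
  obtain a where a: "a \<in> A" "a \<notin> P" "\<And>\<phi> :: 'a \<Rightarrow> 'w.
    hom_on A \<phi> \<Longrightarrow> (\<forall>y\<in>A \<inter> P. \<phi> y = 0) \<Longrightarrow> \<phi> a \<noteq> 0 \<Longrightarrow>
    (\<exists>\<psi>. hom_on (adjoin A x) \<psi> \<and> (\<forall>y\<in>adjoin A x \<inter> P. \<psi> y = 0) \<and> (\<forall>y\<in>A. \<psi> y = \<phi> y) \<and> \<psi> a' \<noteq> 0)"
    using extend_hom_step[OF Cons.prems(1) R(1) Cons.prems(2) xR P a'(1,2)] by blast
  show ?case
  proof (intro bexI[of _ a] conjI allI impI)
    fix \<phi> :: "'a \<Rightarrow> 'w" assume \<phi>: "hom_on A \<phi>" "\<forall>y\<in>A \<inter> P. \<phi> y = 0" "\<phi> a \<noteq> 0"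
    obtain \<psi> where \<psi>: "hom_on (adjoin A x) \<psi>" "\<forall>y\<in>adjoin A x \<inter> P. \<psi> y = 0" "\<forall>y\<in>A. \<psi> y = \<phi> y" "\<psi> a' \<noteq> 0"
      using a(3)[OF \<phi>] by blast
    obtain \<theta> where "hom_on (adjoins A (x # xs)) \<theta>" "\<forall>y\<in>adjoins A (x # xs) \<inter> P. \<theta> y = 0"
      "\<forall>y\<in>adjoin A x. \<theta> y = \<psi> y" "\<theta> b \<noteq> 0" using a'(3)[OF \<psi>(1,2,4)] by blast
    then show "\<exists>\<psi>. hom_on (adjoins A (x # xs)) \<psi> \<and> (\<forall>y\<in>adjoins A (x # xs) \<inter> P. \<psi> y = 0) \<and> (\<forall>y\<in>A. \<psi> y = \<phi> y) \<and> \<psi> b \<noteq> 0"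
      using \<psi>(3) sub(1) by (intro exI[of _ \<theta>]) auto
  qed (use a in auto)
qed

text \<open>An ideal maximal among those that contain \<open>J\<close> and avoid \<open>W\<close> is
  prime: enlarging it by \<open>a\<close> or by \<open>b\<close> produces members of
  \<open>W\<close>, and their product would lie in the ideal if \<open>a * b\<close> did.\<close>

lemma prime_ideal_disjoint_exists:
  assumes R: "subring_of R" and J: "ideal_of R J" and W: "W \<subseteq> R" "1 \<in> W" "\<And>x y. x \<in> W \<Longrightarrow> y \<in> W \<Longrightarrow> x * y \<in> W"
    and disj: "J \<inter> W = {}"
  obtains P where "prime_ideal_of R P" "J \<subseteq> P" "P \<inter> W = {}"
proof -
  define F where "F = {I. ideal_of R I \<and> J \<subseteq> I \<and> I \<inter> W = {}}"
  have "\<exists>M\<in>F. \<forall>X\<in>F. M \<subseteq> X \<longrightarrow> X = M"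
  proof (rule subset_Zorn_nonempty)
    show "F \<noteq> {}" using J disj by (auto simp: F_def)
    fix C assume C: "C \<noteq> {}" "subset.chain F C"
    have CF: "I \<in> C \<Longrightarrow> ideal_of R I \<and> J \<subseteq> I \<and> I \<inter> W = {}" for I
      using C by (auto simp: subset.chain_def F_def)
    have "ideal_of R (\<Union>C)"
      unfolding ideal_of_def
    proof (intro conjI ballI)
      show "\<Union>C \<subseteq> R" using CF ideal_ofD(1) by blast
      show "0 \<in> \<Union>C" using CF ideal_ofD(2) C(1) by blast
      show "r * x \<in> \<Union>C" if "r \<in> R" "x \<in> \<Union>C" for r x
        using CF ideal_ofD(4) that by blast
      show "x + y \<in> \<Union>C" if xy: "x \<in> \<Union>C" "y \<in> \<Union>C" for x y
      proof -
        obtain I1 I2 where I: "I1 \<in> C" "I2 \<in> C" "x \<in> I1" "y \<in> I2" using xy by blast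
        then have "I1 \<subseteq> I2 \<or> I2 \<subseteq> I1" using C(2) by (auto simp: subset.chain_def)
        then show ?thesis using I CF ideal_ofD(3) by blast
      qed
    qed
    then show "\<Union>C \<in> F" using CF C(1) by (auto simp: F_def)
  qed
  then obtain M where M: "ideal_of R M" "J \<subseteq> M" "M \<inter> W = {}"
    and max: "\<And>X. ideal_of R X \<Longrightarrow> J \<subseteq> X \<Longrightarrow> X \<inter> W = {} \<Longrightarrow> M \<subseteq> X \<Longrightarrow> X = M"
    by (auto simp: F_def)
  note S = subring_ofD[OF R] and I = ideal_ofD[OF M(1)]
  have meets: "\<exists>m\<in>M. \<exists>r\<in>R. m + a * r \<in> W" if a: "a \<in> R" "a \<notin> M" for a
  proof (rule ccontr)
    assume no: "\<not> ?thesis"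
    let ?X = "{m + a * r | m r. m \<in> M \<and> r \<in> R}"
    have "ideal_of R ?X"
      unfolding ideal_of_def
    proof (intro conjI ballI)
      show "?X \<subseteq> R" using I(1) a S by auto
      show "0 \<in> ?X" using I(2) S(2) by force
    next
      fix u v assume "u \<in> ?X" "v \<in> ?X"
      then obtain m r m' r' where *: "u = m + a * r" "v = m' + a * r'" "m \<in> M" "r \<in> R" "m' \<in> M" "r' \<in> R" by blast
      then have "u + v = (m + m') + a * (r + r')" by (simp add: algebra_simps)
      then show "u + v \<in> ?X" using * I(3) S(3) by blast
    next
      fix s u assume s: "s \<in> R" "u \<in> ?X"
      then obtain m r where *: "u = m + a * r" "m \<in> M" "r \<in> R" by blast
      then have "s * u = s * m + a * (s * r)" by (simp add: algebra_simps)
      then show "s * u \<in> ?X" using * s I(4) S(4) by blast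
    qed
    moreover have MX: "M \<subseteq> ?X"
    proof
      fix m assume "m \<in> M"
      then show "m \<in> ?X" using S(2) by (intro CollectI exI[of _ m] exI[of _ 0]) auto
    qed
    moreover have "?X \<inter> W = {}" using no by blast
    ultimately have "?X = M" using max M(2) by blast
    moreover have "a \<in> ?X" using I(2) S(1) by (intro CollectI exI[of _ 0] exI[of _ 1]) auto
    ultimately show False using a by blast
  qed
  have "prime_ideal_of R M"
    unfolding prime_ideal_of_def
  proof (intro conjI ballI impI)
    show "M \<noteq> R" using M(3) W by blast
    fix a b assume ab: "a \<in> R" "b \<in> R" "a * b \<in> M"
    show "a \<in> M \<or> b \<in> M"
    proof (rule ccontr)
      assume "\<not> (a \<in> M \<or> b \<in> M)"
      then obtain m r m' r' where *: "m \<in> M" "r \<in> R" "m + a * r \<in> W" "m' \<in> M" "r' \<in> R" "m' + b * r' \<in> W"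
        using meets ab by meson
      have "(m + a * r) * (m' + b * r') = (m' + b * r') * m + ((a * r) * m' + (r * r') * (a * b))"
        by (simp add: algebra_simps)
      also have "\<dots> \<in> M"
      proof -
        have "m' + b * r' \<in> R" "a * r \<in> R" "r * r' \<in> R"
          using * ab I(1) by (auto intro!: S(3,4))
        then show ?thesis using I(3,4) *(1,4) ab(3) by simp
      qed
      finally show False using W(3)[OF *(3,6)] M(3) by blast
    qed
  qed (rule M(1))
  then show ?thesis using that M by blast
qed

text \<open>A prime avoiding all nonzero polynomials in \<open>x\<close> would lie in the kernel of a homomorphism to the
  algebraic closure, and strictly so since the image of \<open>x\<close> is algebraic.\<close>

lemma algebraic_mod_zero_dim:
  fixes h :: "'k::field \<Rightarrow> 'a::comm_ring_1"
  assumes h: "h 1 = 1" "\<And>x y. h (x + y) = h x + h y" "\<And>x y. h (x * y) = h x * h y"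
    and xs: "x \<in> adjoins (range h) xs"
    and J: "ideal_of (adjoins (range h) xs) J"
    and nochain: "\<And>P Q. prime_ideal_of (adjoins (range h) xs) P \<Longrightarrow> prime_ideal_of (adjoins (range h) xs) Q \<Longrightarrow>
      J \<subseteq> P \<Longrightarrow> \<not> P \<subset> Q"
  shows "\<exists>p. p \<noteq> 0 \<and> poly (map_poly h p) x \<in> J"
proof (rule ccontr)
  assume no: "\<not> ?thesis"
  let ?K = "range h" and ?R = "adjoins (range h) xs"
  have h0: "h 0 = 0" using h(2)[of 0 0] by simp
  have hneg: "h (- c) = - h c" for c using h(2)[of c "- c"] h0 by (simp add: eq_neg_iff_add_eq_0 add.commute)
  have hsum: "h (sum f A) = (\<Sum>i\<in>A. h (f i))" for f :: "nat \<Rightarrow> 'k" and A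
    by (induction A rule: infinite_finite_induct) (auto simp: h h0)
  have K: "subring_of ?K"
    unfolding subring_of_def by (auto simp: h[symmetric] hneg[symmetric])
  note R = adjoins_subring[OF K, of xs]
  note KR = adjoins_superset[OF K, of xs]
  define W where "W = {poly (map_poly h p) x | p. p \<noteq> 0}"
  have mh: "map_poly h (p * q) = map_poly h p * map_poly h q" for p q
    by (rule poly_eqI) (simp add: coeff_map_poly h0 coeff_mult hsum h)
  have "map_poly h p \<in> polys_over ?K" for p by (simp add: polys_over_def coeff_map_poly h0)
  then have hpR: "poly (map_poly h p) x \<in> ?R" for p
    using KR xs by (intro poly_mem_subring[OF R]) (auto simp: polys_over_def)
  obtain P where P: "prime_ideal_of ?R P" "J \<subseteq> P" "P \<inter> W = {}"
  proof (rule prime_ideal_disjoint_exists[OF R J, of W])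
    show "1 \<in> W" unfolding W_def using h(1) by (intro CollectI exI[of _ 1]) simp
    show "u * v \<in> W" if "u \<in> W" "v \<in> W" for u v
    proof -
      obtain p q where "u = poly (map_poly h p) x" "v = poly (map_poly h q) x" "p \<noteq> 0" "q \<noteq> 0"
        using \<open>u \<in> W\<close> \<open>v \<in> W\<close> by (auto simp: W_def)
      then show ?thesis unfolding W_def by (intro CollectI exI[of _ "p * q"]) (simp add: mh)
    qed
    show "J \<inter> W = {}" using no by (auto simp: W_def)
    show "W \<subseteq> ?R" using hpR by (auto simp: W_def)
  qed
  have idP: "ideal_of ?R P" using P(1) by (simp add: prime_ideal_of_def)
  have 1: "1 \<notin> P"
  proof
    assume "1 \<in> P"
    then have "r * 1 \<in> P" if "r \<in> ?R" for r using ideal_ofD(4)[OF idP that] by blast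
    then show False using P(1) ideal_ofD(1)[OF idP] by (auto simp: prime_ideal_of_def)
  qed
  have unit: "h c \<notin> P" if "c \<noteq> 0" for c
  proof
    assume "h c \<in> P"
    moreover have "h (inverse c) \<in> ?R" using KR by blast
    ultimately have "h (inverse c) * h c \<in> P" using ideal_ofD(4)[OF idP] by blast
    then show False using 1 that by (simp add: h(3)[symmetric] h(1))
  qed
  have inj: "inj h"
  proof (rule injI, rule ccontr)
    fix c d assume "h c = h d" "c \<noteq> d"
    then have "h (c - d) = 0" using h(2)[of c "- d"] hneg by simp
    then show False using unit[of "c - d"] \<open>c \<noteq> d\<close> ideal_ofD(2)[OF idP] by simp
  qed
  \<comment> \<open>Only the existence of some \<open>\<psi>\<close> is wanted, so \<open>b\<close>
    is taken to be 1. The resulting \<open>a\<close> is the image of a nonzero constant, at which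
    the embedding \<open>\<phi>\<close> does not vanish.\<close>
  have "\<exists>a\<in>?K. a \<notin> P \<and> (\<forall>\<phi> :: 'a \<Rightarrow> 'k alg_closure.
    hom_on ?K \<phi> \<longrightarrow> (\<forall>y\<in>?K \<inter> P. \<phi> y = 0) \<longrightarrow> \<phi> a \<noteq> 0 \<longrightarrow>
    (\<exists>\<psi>. hom_on ?R \<psi> \<and> (\<forall>y\<in>?R \<inter> P. \<psi> y = 0) \<and> (\<forall>y\<in>?K. \<psi> y = \<phi> y) \<and> \<psi> 1 \<noteq> 0))"
    by (rule extend_hom[OF K R _ _ P(1) _ 1]) (use KR subring_ofD(1)[OF R] in auto)
  then obtain a where a: "a \<in> ?K" "a \<notin> P" "\<And>\<phi> :: 'a \<Rightarrow> 'k alg_closure.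
    hom_on ?K \<phi> \<Longrightarrow> (\<forall>y\<in>?K \<inter> P. \<phi> y = 0) \<Longrightarrow> \<phi> a \<noteq> 0 \<Longrightarrow>
    (\<exists>\<psi>. hom_on ?R \<psi> \<and> (\<forall>y\<in>?R \<inter> P. \<psi> y = 0) \<and> (\<forall>y\<in>?K. \<psi> y = \<phi> y) \<and> \<psi> 1 \<noteq> 0)"
    by blast
  define \<phi> where "\<phi> = (\<lambda>y. to_ac (the_inv h y))"
  have \<phi>: "\<phi> (h c) = to_ac c" for c using inj by (simp add: \<phi>_def the_inv_f_f)
  have "hom_on ?K \<phi>" unfolding hom_on_def
    using \<phi>[of 1] by (auto simp: \<phi> h[symmetric])
  moreover have "\<forall>y\<in>?K \<inter> P. \<phi> y = 0"
  proof
    fix y assume "y \<in> ?K \<inter> P"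
    then obtain c where "y = h c" "h c \<in> P" by blast
    then show "\<phi> y = 0" using unit[of c] \<phi>[of c] by (cases "c = 0") simp_all
  qed
  moreover have "\<phi> a \<noteq> 0"
  proof -
    obtain c where "a = h c" using a(1) by blast
    then show ?thesis using a(2) \<phi>[of c] h0 ideal_ofD(2)[OF idP] by auto
  qed
  ultimately obtain \<psi> where \<psi>: "hom_on ?R \<psi>" "\<forall>y\<in>?R \<inter> P. \<psi> y = 0" "\<forall>y\<in>?K. \<psi> y = \<phi> y"
    using a(3) by blast
  have \<psi>h: "\<psi> (h c) = to_ac c" for c using \<psi>(3) \<phi> by simp
  define Q where "Q = {y \<in> ?R. \<psi> y = 0}"
  have idQ: "ideal_of ?R Q"
    unfolding ideal_of_def Q_def
    using hom_on_0[OF R \<psi>(1)] by (auto simp: hom_onD[OF \<psi>(1)] subring_ofD[OF R])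
  have "prime_ideal_of ?R Q"
    unfolding prime_ideal_of_def
  proof (intro conjI ballI impI)
    have "1 \<notin> Q" using hom_onD(1)[OF \<psi>(1)] by (simp add: Q_def)
    then show "Q \<noteq> ?R" using subring_ofD(1)[OF R] by blast
  qed (use idQ in \<open>auto simp: Q_def hom_onD[OF \<psi>(1)]\<close>)
  moreover have "P \<subseteq> Q" using ideal_ofD(1)[OF idP] \<psi>(2) by (auto simp: Q_def)
  moreover have "P \<noteq> Q"
  proof -
    obtain p where p: "p \<noteq> 0" "poly (map_poly to_ac p) (\<psi> x) = 0" by (rule alg_closure_algebraic)
    have "poly (map_poly h p) x = (\<Sum>i\<le>Polynomial.degree p. h (poly.coeff p i) * x ^ i)"
      by (subst poly_as_sum_of_monoms'[of "map_poly h p" "Polynomial.degree p", symmetric])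
         (auto simp: map_poly_degree_leq h0 poly_sum poly_monom coeff_map_poly)
    then have "\<psi> (poly (map_poly h p) x) = (\<Sum>i\<le>Polynomial.degree p. \<psi> (h (poly.coeff p i) * x ^ i))"
      using KR xs by (auto intro!: hom_on_sum[OF R \<psi>(1)] subring_ofD[OF R])
    also have "\<dots> = (\<Sum>i\<le>Polynomial.degree p. to_ac (poly.coeff p i) * \<psi> x ^ i)"
    proof (rule sum.cong)
      fix i
      have "h (poly.coeff p i) \<in> ?R" "x ^ i \<in> ?R" using KR xs subring_ofD[OF R] by auto
      then show "\<psi> (h (poly.coeff p i) * x ^ i) = to_ac (poly.coeff p i) * \<psi> x ^ i"
        by (simp add: hom_onD(3)[OF \<psi>(1)] \<psi>h hom_on_power[OF R \<psi>(1) xs])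
    qed simp
    also have "\<dots> = poly (map_poly to_ac p) (\<psi> x)"
      by (simp add: poly_altdef degree_map_poly coeff_map_poly)
    finally have "poly (map_poly h p) x \<in> Q" using p hpR by (simp add: Q_def)
    then show ?thesis using P(3) p by (auto simp: W_def)
  qed
  ultimately show False using nochain[OF P(1) _ P(2)] by blast
qed

section \<open>Linear systems of parameters\<close>

lemma krull_dim_0_no_chain:
  assumes "krull_dim R I = 0" "prime_ideal_of R P" "prime_ideal_of R Q" "I \<subseteq> P"
  shows "\<not> P \<subset> Q"
proof
  assume PQ: "P \<subset> Q"
  let ?S = "{enat n | n. \<exists>P :: nat \<Rightarrow> 'a set.
     (\<forall>k\<le>n. prime_ideal_of R (P k) \<and> I \<subseteq> P k) \<and> (\<forall>k<n. P k \<subset> P (Suc k))}"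
  have "enat 1 \<in> ?S"
    using assms PQ by (intro CollectI exI[of _ 1] conjI refl exI[of _ "\<lambda>k. if k = 0 then P else Q"]) auto
  then have "enat 1 \<le> krull_dim R I" unfolding krull_dim_def by (rule Sup_upper)
  then show False using assms(1) by (simp add: enat_0_iff one_enat_def[symmetric])
qed

section \<open>Coordinate rings of the charts\<close>

lemma subring_of_patch: "subring_of (patch \<sigma> \<tau> :: ('q::finite, 'k::field) laurent set)"
  unfolding subring_of_def
proof (intro conjI ballI)
  show "1 \<in> patch \<sigma> \<tau>" by (simp add: patch_def)
  fix f g :: "('q, 'k) laurent" assume fg: "f \<in> patch \<sigma> \<tau>" "g \<in> patch \<sigma> \<tau>"
  show "f + g \<in> patch \<sigma> \<tau>" using fg keys_add[of f g] unfolding patch_def by blast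
  show "f * g \<in> patch \<sigma> \<tau>" unfolding patch_def
  proof (intro CollectI ballI allI)
    fix u i assume "u \<in> keys (f * g)"
    then obtain v w where vw: "u = v + w" "v \<in> keys f" "w \<in> keys g"
      using keys_mult[of f g] by blast
    have "(\<not> \<sigma> i \<and> \<not> \<tau> i \<longrightarrow> 0 \<le> v $ i) \<and> (\<sigma> i \<and> \<tau> i \<longrightarrow> v $ i \<le> 0)"
      "(\<not> \<sigma> i \<and> \<not> \<tau> i \<longrightarrow> 0 \<le> w $ i) \<and> (\<sigma> i \<and> \<tau> i \<longrightarrow> w $ i \<le> 0)"
      using fg vw(2,3) unfolding patch_def by blast+
    then show "(\<not> \<sigma> i \<and> \<not> \<tau> i \<longrightarrow> 0 \<le> u $ i) \<and> (\<sigma> i \<and> \<tau> i \<longrightarrow> u $ i \<le> 0)"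
      by (auto simp: vw(1))
  qed
next
  fix f :: "('q, 'k) laurent" assume "f \<in> patch \<sigma> \<tau>"
  then show "- f \<in> patch \<sigma> \<tau>" by (simp add: patch_def in_keys_iff)
qed

lemma single_in_patch:
  "(\<And>i. (\<not> \<sigma> i \<and> \<not> \<tau> i \<longrightarrow> 0 \<le> u $ i) \<and> (\<sigma> i \<and> \<tau> i \<longrightarrow> u $ i \<le> 0)) \<Longrightarrow> single u c \<in> patch \<sigma> \<tau>"
  by (auto simp: patch_def)

definition coord :: "('q::finite \<Rightarrow> bool) \<Rightarrow> 'q \<Rightarrow> ('q, 'k::field) laurent" where
  "coord \<sigma> i = single (axis i (if \<sigma> i then - 1 else 1)) 1"

lemma coord_in_patch: "coord \<sigma> i \<in> patch \<sigma> \<sigma>"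
  unfolding coord_def by (rule single_in_patch) (auto simp: axis_def)

lemma coord_power: "coord \<sigma> i ^ n = single (axis i (if \<sigma> i then - int n else int n)) 1"
proof (induction n)
  case 0
  have "axis i (0 :: int) = 0" by (simp add: vec_eq_iff axis_def)
  then have "single (axis i (0 :: int)) 1 = 1" by (metis single_one)
  then show ?case by simp
next
  case (Suc n)
  have "axis i (if \<sigma> i then - 1 else 1) + axis i (if \<sigma> i then - int n else int n) =
      axis i (if \<sigma> i then - int (Suc n) else int (Suc n))"
    by (simp add: vec_eq_iff axis_def)
  then show ?case using Suc by (simp add: mult_single coord_def)
qed

text \<open>Brings the chart ring into the form expected by \<open>algebraic_mod_zero_dim\<close>, a
  finitely generated algebra over the constants. Exponents have the sign prescribed by
  \<open>\<sigma>\<close>, so every monomial is a product of powers of the coordinates.\<close>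

lemma patch_eq_adjoins:
  assumes "set ns = UNIV"
  shows "patch \<sigma> \<sigma> = adjoins (range (single 0)) (map (coord \<sigma>) ns)"
    (is "_ = adjoins ?K ?xs")
proof
  have K: "subring_of (?K :: ('a, 'b) laurent set)"
    unfolding subring_of_def
    by (auto simp: single_one[symmetric] single_add[symmetric] mult_single single_uminus[symmetric] simp del: single_one)
  note R = adjoins_subring[OF K, of ?xs]
  have KR: "?K \<subseteq> adjoins ?K ?xs" "\<And>i. coord \<sigma> i \<in> adjoins ?K ?xs"
    using adjoins_superset[OF K, of ?xs] assms by auto
  show "adjoins ?K ?xs \<subseteq> patch \<sigma> \<sigma>"
    by (rule adjoins_subset[OF subring_of_patch]) (auto simp: coord_in_patch intro: single_in_patch)
  show "patch \<sigma> \<sigma> \<subseteq> adjoins ?K ?xs"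
  proof
    fix f :: "('a, 'b) laurent" assume f: "f \<in> patch \<sigma> \<sigma>"
    have "single u c \<in> adjoins ?K ?xs" if u: "u \<in> keys f" for u c
    proof -
      have "single (\<Sum>i\<in>S. axis i (u $ i)) c =
          single 0 c * (\<Prod>i\<in>S. coord \<sigma> i ^ nat \<bar>u $ i\<bar>)" for S
      proof (induction S rule: infinite_finite_induct)
        case (insert i S)
        have "(if \<sigma> i then - int (nat \<bar>u $ i\<bar>) else int (nat \<bar>u $ i\<bar>)) = u $ i"
          using f u by (auto simp: patch_def)
        then have "coord \<sigma> i ^ nat \<bar>u $ i\<bar> = (single (axis i (u $ i)) 1 :: ('a, 'b) laurent)"
          by (simp add: coord_power)
        then have "single 0 c * (\<Prod>i\<in>insert i S. coord \<sigma> i ^ nat \<bar>u $ i\<bar>) =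
            single (axis i (u $ i)) 1 * (single 0 c * (\<Prod>i\<in>S. coord \<sigma> i ^ nat \<bar>u $ i\<bar>))"
          using insert.hyps by (simp add: mult.left_commute)
        also have "\<dots> = single (\<Sum>i\<in>insert i S. axis i (u $ i)) c"
          unfolding insert.IH[symmetric] using insert.hyps by (simp add: mult_single)
        finally show ?case by simp
      qed auto
      moreover have "(\<Sum>i\<in>UNIV. axis i (u $ i)) = u"
        by (simp add: vec_eq_iff axis_def if_distrib cong: if_cong)
      ultimately have "single u c = single 0 c * (\<Prod>i\<in>UNIV. coord \<sigma> i ^ nat \<bar>u $ i\<bar>)"
        by metis
      also have "\<dots> \<in> adjoins ?K ?xs"
        using KR by (intro subring_ofD(4)[OF R] subring_of_prod[OF R] subring_ofD(7)[OF R]) auto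
      finally show ?thesis .
    qed
    then show "f \<in> adjoins ?K ?xs"
      by (subst poly_mapping_sum_single) (auto intro: subring_of_sum[OF R])
  qed
qed

lemma zero_dimensional_algebraic:
  fixes X :: "('q::finite, 'k::field) ideal_sheaf"
  assumes "zero_dimensional X"
  shows "\<exists>p. p \<noteq> 0 \<and> poly (map_poly (single 0) p) (coord \<sigma> i) \<in> X \<sigma>"
proof -
  have X: "ideal_of (patch \<sigma> \<sigma>) (X \<sigma>)" "scheme_dim X = 0"
    using assms by (auto simp: zero_dimensional_def closed_subscheme_def)
  have "krull_dim (patch \<sigma> \<sigma>) (X \<sigma>) \<le> scheme_dim X"
    unfolding scheme_dim_def by (rule SUP_upper) simp
  then have kd: "krull_dim (patch \<sigma> \<sigma>) (X \<sigma>) = 0" using X(2) by simp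
  obtain ns :: "'q list" where "set ns = UNIV" using finite_list[OF finite] by blast
  note R = patch_eq_adjoins[OF this, where ?'b = 'k]
  show ?thesis
  proof (rule algebraic_mod_zero_dim)
    show "coord \<sigma> i \<in> adjoins (range (single 0 :: 'k \<Rightarrow> ('q, 'k) laurent)) (map (coord \<sigma>) ns)"
      unfolding R[symmetric] by (rule coord_in_patch)
    show "ideal_of (adjoins (range (single 0 :: 'k \<Rightarrow> ('q, 'k) laurent)) (map (coord \<sigma>) ns)) (X \<sigma>)"
      unfolding R[symmetric] by (rule X(1))
    show "\<not> P \<subset> Q"
      if "prime_ideal_of (adjoins (range (single 0 :: 'k \<Rightarrow> ('q, 'k) laurent)) (map (coord \<sigma>) ns)) P"
        "prime_ideal_of (adjoins (range (single 0 :: 'k \<Rightarrow> ('q, 'k) laurent)) (map (coord \<sigma>) ns)) Q" "X \<sigma> \<subseteq> P" for P Q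
      using krull_dim_0_no_chain[OF kd] that unfolding R[symmetric] by blast
  qed (auto simp: single_add mult_single)
qed

section \<open>Dehomogenization of forms\<close>

definition chart_exponent :: "('q::finite \<Rightarrow> bool) \<Rightarrow> ('q \<times> bool \<Rightarrow>\<^sub>0 nat) \<Rightarrow> int ^ 'q" where
  "chart_exponent \<sigma> m = (\<chi> i. if \<sigma> i then - int (lookup m (i, False))
     else int (lookup m (i, True)))"

interpretation restrict: monoid_algebra_hom "single (0 :: int ^ 'q::finite) :: 'k::field \<Rightarrow> _"
  "\<lambda>m. single (chart_exponent \<sigma> m) 1" for \<sigma> :: "'q::finite \<Rightarrow> bool"
proof
  show "single (chart_exponent \<sigma> 0) (1::'k) = 1"
    by (simp add: chart_exponent_def zero_vec_def[symmetric] cong: if_cong)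
  fix m n :: "'q \<times> bool \<Rightarrow>\<^sub>0 nat"
  have "chart_exponent \<sigma> (m + n) = chart_exponent \<sigma> m + chart_exponent \<sigma> n"
    by (simp add: chart_exponent_def vec_eq_iff lookup_add)
  then show "single (chart_exponent \<sigma> (m + n)) (1::'k) =
      single (chart_exponent \<sigma> m) 1 * single (chart_exponent \<sigma> n) 1"
    by (simp add: mult_single)
qed (auto simp: single_add mult_single)

text \<open>Dehomogenizing sets the variables \<open>(i, \<sigma> i)\<close> to 1, which is a ring
  homomorphism on the whole Cox ring and not only on the forms of one degree.\<close>

lemma restrict_form_lift:
  "restrict_form \<sigma> F = lift (single 0) (\<lambda>m. single (chart_exponent \<sigma> m) 1) F"
  by (simp add: restrict_form_def lift_def chart_exponent_def mult_single)

lemmas restrict_form_simps = restrict.lift_add[folded restrict_form_lift] restrict.lift_mult[folded restrict_form_lift]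
  restrict.lift_sum[folded restrict_form_lift] restrict.lift_prod[folded restrict_form_lift]
  restrict.lift_power[folded restrict_form_lift] restrict.lift_diff[folded restrict_form_lift]

lemma restrict_form_const: "restrict_form \<sigma> (const c) = single 0 c"
proof -
  have "chart_exponent \<sigma> 0 = 0" by (simp add: chart_exponent_def vec_eq_iff)
  then show ?thesis by (simp add: restrict_form_lift const_def restrict.lift_single mult_single)
qed

lemma restrict_form_var: "restrict_form \<sigma> (var (i, b)) = (if b = \<sigma> i then 1 else coord \<sigma> i)"
proof -
  have "chart_exponent \<sigma> (single (i, b) 1) = (if b = \<sigma> i then 0 else axis i (if \<sigma> i then - 1 else 1))"
    by (auto simp: chart_exponent_def vec_eq_iff axis_def lookup_single when_def)
  then show ?thesis by (simp add: restrict_form_lift Defs.var_def restrict.lift_single coord_def)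
qed

lemma restrict_form_in_patch: "restrict_form \<sigma> F \<in> patch \<sigma> \<sigma>"
  unfolding restrict_form_def
  by (rule subring_of_sum[OF subring_of_patch], rule single_in_patch) auto

section \<open>Gradings of the vanishing ideal, homogenization and the choice of the linear
  forms\<close>

lemma graded_vanishing_ideal: "mdeg.graded_ideal (vanishing_ideal X)"
  unfolding vanishing_ideal_def
  by (rule mdeg.graded_ideal_gen_ideal_homogeneous) (auto simp: forms_iff_homogeneous)

lemma homogeneous_mdeg_tdeg: "homogeneous mdeg a F \<Longrightarrow> homogeneous tdeg (\<Sum>i\<in>UNIV. a $ i) F"
  by (auto simp: homogeneous_def tdeg_def)

lemma tdeg_graded_vanishing_ideal: "tdeg.graded_ideal (vanishing_ideal X)"
  unfolding vanishing_ideal_def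
  by (rule tdeg.graded_ideal_gen_ideal_homogeneous) (auto simp: forms_iff_homogeneous intro: homogeneous_mdeg_tdeg)

text \<open>The homogenizing variable is \<open>var (i, b)\<close>, so \<open>b = \<sigma> i\<close>
  fits polynomials in \<open>coord \<sigma> i\<close>.\<close>

definition homogenization :: "bool \<Rightarrow> 'q::finite \<Rightarrow> 'k::field poly \<Rightarrow> ('q, 'k) cox" where
  "homogenization b i p = (\<Sum>k\<le>Polynomial.degree p. const (poly.coeff p k) *
     var (i, \<not> b) ^ k * var (i, b) ^ (Polynomial.degree p - k))"

lemma var_power_in_forms: "var (i, b) ^ n \<in> forms (axis i (int n))"
proof -
  have "(\<chi> j. int n * axis i 1 $ j) = axis i (int n)" by (simp add: vec_eq_iff axis_def)
  then show ?thesis using forms_power[OF var_in_forms] by metis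
qed

lemma homogenization_in_forms: "homogenization b i p \<in> forms (axis i (int (Polynomial.degree p)))"
  unfolding homogenization_def
proof (rule forms_sum)
  fix k assume k: "k \<in> {..Polynomial.degree p}"
  have "const (poly.coeff p k) * var (i, \<not> b) ^ k * var (i, b) ^ (Polynomial.degree p - k) \<in>
      forms (0 + axis i (int k) + axis i (int (Polynomial.degree p - k)))"
    by (intro forms_mult const_in_forms var_power_in_forms)
  also have "0 + axis i (int k) + axis i (int (Polynomial.degree p - k)) = axis i (int (Polynomial.degree p))"
    using k by (simp add: vec_eq_iff axis_def)
  finally show "const (poly.coeff p k) * var (i, \<not> b) ^ k * var (i, b) ^ (Polynomial.degree p - k) \<in>
      forms (axis i (int (Polynomial.degree p)))" .
qed

lemma restrict_homogenization:
  "restrict_form \<sigma> (homogenization (\<sigma> i) i p) = poly (map_poly (single 0) p) (coord \<sigma> i)"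
proof -
  have "poly (map_poly (single 0) p) (coord \<sigma> i) =
      (\<Sum>k\<le>Polynomial.degree p. single 0 (poly.coeff p k) * coord \<sigma> i ^ k)"
    by (subst poly_as_sum_of_monoms'[of "map_poly (single 0) p" "Polynomial.degree p", symmetric])
       (auto simp: map_poly_degree_leq poly_sum poly_monom coeff_map_poly)
  then show ?thesis
    by (simp add: homogenization_def restrict_form_simps restrict_form_const restrict_form_var)
qed

lemma ideal_cong_mult:
  assumes J: "ideal_of UNIV J" and "a - a' \<in> J" "b - b' \<in> J"
  shows "a * b - a' * b' \<in> J"
proof -
  have "a * b - a' * b' = a * (b - b') + b' * (a - a')" by (simp add: algebra_simps)
  then show ?thesis using assms ideal_ofD(3)[OF J] ideal_UNIV_mult(1)[OF J] by metis
qed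

lemma ideal_cong_power: "ideal_of UNIV J \<Longrightarrow> a - a' \<in> J \<Longrightarrow> a ^ n - a' ^ n \<in> J"
  by (induction n) (auto simp: ideal_cong_mult ideal_ofD(2))

lemma ideal_cong_sum: "ideal_of UNIV J \<Longrightarrow> (\<And>i. i \<in> S \<Longrightarrow> f i - g i \<in> J) \<Longrightarrow> sum f S - sum g S \<in> J"
  using ideal_sum[of UNIV J S "\<lambda>i. f i - g i"] by (simp add: sum_subtractf)

lemma ideal_cong_prod: "ideal_of UNIV J \<Longrightarrow> (\<And>i. i \<in> S \<Longrightarrow> f i - g i \<in> J) \<Longrightarrow> prod f S - prod g S \<in> J"
  by (induction S rule: infinite_finite_induct) (auto simp: ideal_cong_mult ideal_ofD(2))

lemma const_power: "const (c ^ n) = const c ^ n"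
  by (induction n) (auto simp: const_mult)

lemma const_prod: "const (prod f A) = (\<Prod>x\<in>A. const (f x))"
  by (induction A rule: infinite_finite_induct) (auto simp: const_mult)

lemma const_unit_ideal:
  assumes "ideal_of UNIV J" "const c * F \<in> J" "c \<noteq> 0"
  shows "F \<in> J"
proof -
  have "const (inverse c) * (const c * F) \<in> J" 
    by (rule ideal_UNIV_mult(1)[OF assms(1,2)])
  then show ?thesis using assms(3) by (simp add: mult.assoc[symmetric] const_mult[symmetric])
qed

text \<open>Modulo \<open>J\<close> the variable x_{i1} is \<open>c\<close> times x_{i0}. So the
  ratio of \<open>var (i, \<not> b)\<close> to \<open>var (i, b)\<close> is \<open>c\<close> or, if
  \<open>b\<close> holds, its inverse; in the second case the homogenizing variable contributes the
  power of \<open>c\<close>.\<close>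

lemma homogenization_cong:
  fixes J :: "('q::finite, 'k::field) cox set"
  assumes J: "ideal_of UNIV J" and l: "var (i, True) - const c * var (i, False) \<in> J" and c: "c \<noteq> 0"
  shows "homogenization b i p - const ((if b then c ^ Polynomial.degree p else 1) * poly p (if b then inverse c else c)) *
     var (i, False) ^ Polynomial.degree p \<in> J"
proof -
  let ?d = "Polynomial.degree p" and ?x = "var (i, False) :: ('q, 'k) cox"
  let ?s = "\<lambda>b. if b then c else 1"
  have s: "var (i, b) - const (?s b) * ?x \<in> J" for b
    using l ideal_ofD(2)[OF J] by (cases b) simp_all
  have "homogenization b i p - (\<Sum>k\<le>?d. const (poly.coeff p k) * (const (?s (\<not> b)) * ?x) ^ k * (const (?s b) * ?x) ^ (?d - k)) \<in> J"
    unfolding homogenization_def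
    by (intro ideal_cong_sum[OF J] ideal_cong_mult[OF J] ideal_cong_power[OF J] s) (simp add: ideal_ofD(2)[OF J])
  also have "(\<Sum>k\<le>?d. const (poly.coeff p k) * (const (?s (\<not> b)) * ?x) ^ k * (const (?s b) * ?x) ^ (?d - k)) =
      (\<Sum>k\<le>?d. const (poly.coeff p k * ?s (\<not> b) ^ k * ?s b ^ (?d - k)) * ?x ^ ?d)"
  proof (rule sum.cong)
    fix k assume "k \<in> {..?d}"
    then have "?x ^ ?d = ?x ^ k * ?x ^ (?d - k)" by (simp add: power_add[symmetric])
    then show "const (poly.coeff p k) * (const (?s (\<not> b)) * ?x) ^ k * (const (?s b) * ?x) ^ (?d - k) =
        const (poly.coeff p k * ?s (\<not> b) ^ k * ?s b ^ (?d - k)) * ?x ^ ?d"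
      by (simp only: power_mult_distrib const_mult const_power mult_ac)
  qed simp
  also have "\<dots> = const (\<Sum>k\<le>?d. poly.coeff p k * ?s (\<not> b) ^ k * ?s b ^ (?d - k)) * ?x ^ ?d"
    by (simp add: const_sum sum_distrib_right)
  also have "(\<Sum>k\<le>?d. poly.coeff p k * ?s (\<not> b) ^ k * ?s b ^ (?d - k)) =
      (if b then c ^ ?d else 1) * poly p (if b then inverse c else c)"
  proof (cases b)
    case True
    have "c ^ (?d - k) = c ^ ?d * inverse c ^ k" if "k \<le> ?d" for k
      using that c by (simp add: power_diff power_inverse divide_inverse)
    then show ?thesis using True by (simp add: poly_altdef sum_distrib_left mult_ac)
  next
    case False
    then show ?thesis by (simp add: poly_altdef)
  qed
  finally show ?thesis .
qed

text \<open>The linear form with coefficient \<open>c i\<close> has to vanish at no point of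
  \<open>X\<close>, also after extending the field. Each of the finitely many charts excludes
  finitely many values, so an infinite field leaves a choice.\<close>

lemma zero_dimensional_parameters:
  fixes X :: "('q::finite, 'k::field) ideal_sheaf"
  assumes inf: "infinite (UNIV :: 'k set)" and X: "zero_dimensional X"
  obtains c :: "'q \<Rightarrow> 'k" where
    "\<And>J i. ideal_of UNIV J \<Longrightarrow> vanishing_ideal X \<subseteq> J \<Longrightarrow>
      var (i, True) - const (c i) * var (i, False) \<in> J \<Longrightarrow> \<exists>n. var (i, False) ^ n \<in> J"
proof -
  obtain p :: "('q \<Rightarrow> bool) \<Rightarrow> 'q \<Rightarrow> 'k poly" where p: "\<And>\<sigma> i. p \<sigma> i \<noteq> 0"
    "\<And>\<sigma> i. poly (map_poly (single 0) (p \<sigma> i)) (coord \<sigma> i) \<in> X \<sigma>"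
    using zero_dimensional_algebraic[OF X] by metis
  have "\<exists>c. c \<noteq> 0 \<and> (\<forall>\<sigma>. poly (p \<sigma> i) (if \<sigma> i then inverse c else c) \<noteq> 0)" for i
  proof -
    \<comment> \<open>On the charts with \<open>\<sigma> i\<close> the coordinate is the inverse
      one, hence the inverses of the roots; 0 is excluded so that \<open>c\<close> can be
      inverted.\<close>
    define B where "B = {0} \<union> (\<Union>\<sigma>. {x. poly (p \<sigma> i) x = 0}) \<union> (\<Union>\<sigma>. inverse ` {x. poly (p \<sigma> i) x = 0})"
    have "finite B" unfolding B_def using poly_roots_finite[OF p(1)] by auto
    then obtain c where c: "c \<notin> B" using inf by (metis UNIV_I ex_new_if_finite)
    have "c \<in> inverse ` {x. poly (p \<sigma> i) x = 0}" if "poly (p \<sigma> i) (inverse c) = 0" for \<sigma>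
      by (rule image_eqI[of _ _ "inverse c"]) (use that in auto)
    then show ?thesis using c by (intro exI[of _ c]) (auto simp: B_def)
  qed
  then obtain c where c: "\<And>i. c i \<noteq> 0" "\<And>\<sigma> i. poly (p \<sigma> i) (if \<sigma> i then inverse (c i) else c i) \<noteq> 0" by metis
  show ?thesis
  proof (rule that[of c])
    fix J :: "('q, 'k) cox set" and i
    assume J: "ideal_of UNIV J" "vanishing_ideal X \<subseteq> J" "var (i, True) - const (c i) * var (i, False) \<in> J"
    \<comment> \<open>The factor for \<open>\<sigma>\<close> is only known to vanish on the part of
      \<open>X\<close> in its own chart; the product over all charts vanishes on all of
      \<open>X\<close>.\<close>
    define F where "F = (\<Prod>\<sigma>\<in>UNIV. homogenization (\<sigma> i) i (p \<sigma> i))"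
    define a where "a = (\<lambda>\<sigma>. (if \<sigma> i then c i ^ Polynomial.degree (p \<sigma> i) else 1) * poly (p \<sigma> i) (if \<sigma> i then inverse (c i) else c i))"
    have "F \<in> forms (\<Sum>\<sigma>\<in>UNIV. axis i (int (Polynomial.degree (p \<sigma> i))))"
      unfolding F_def by (rule forms_prod) (rule homogenization_in_forms)
    moreover have "vanishes_on F X"
      unfolding vanishes_on_def
    proof
      fix \<sigma>
      have "restrict_form \<sigma> F = (\<Prod>\<tau>\<in>UNIV - {\<sigma>}. restrict_form \<sigma> (homogenization (\<tau> i) i (p \<tau> i))) *
          restrict_form \<sigma> (homogenization (\<sigma> i) i (p \<sigma> i))"
        by (simp add: F_def restrict_form_simps prod.remove[of UNIV \<sigma>] mult.commute)
      moreover have "(\<Prod>\<tau>\<in>UNIV - {\<sigma>}. restrict_form \<sigma> (homogenization (\<tau> i) i (p \<tau> i))) \<in> patch \<sigma> \<sigma>"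
        by (intro subring_of_prod subring_of_patch restrict_form_in_patch)
      moreover have "restrict_form \<sigma> (homogenization (\<sigma> i) i (p \<sigma> i)) \<in> X \<sigma>"
        using p(2) by (simp add: restrict_homogenization)
      moreover have "ideal_of (patch \<sigma> \<sigma>) (X \<sigma>)"
        using X by (auto simp: zero_dimensional_def closed_subscheme_def)
      ultimately show "restrict_form \<sigma> F \<in> X \<sigma>" by (simp add: ideal_ofD(4))
    qed
    ultimately have "F \<in> {F. \<exists>a. F \<in> forms a \<and> vanishes_on F X}" by blast
    then have "F \<in> J" using J(2) gen_ideal_superset unfolding vanishing_ideal_def by (meson subsetD)
    have "F - (\<Prod>\<sigma>\<in>UNIV. const (a \<sigma>) * var (i, False) ^ Polynomial.degree (p \<sigma> i)) \<in> J"
      unfolding F_def a_def by (intro ideal_cong_prod[OF J(1)] homogenization_cong[OF J(1,3) c(1)])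
    then have "(\<Prod>\<sigma>\<in>UNIV. const (a \<sigma>) * var (i, False) ^ Polynomial.degree (p \<sigma> i)) \<in> J"
      using \<open>F \<in> J\<close> ideal_UNIV_mem_cong[OF J(1)] by blast
    then have "const (\<Prod>\<sigma>\<in>UNIV. a \<sigma>) * var (i, False) ^ (\<Sum>\<sigma>\<in>UNIV. Polynomial.degree (p \<sigma> i)) \<in> J"
      by (simp add: prod.distrib const_prod power_sum)
    moreover have "(\<Prod>\<sigma>\<in>UNIV. a \<sigma>) \<noteq> 0" using c by (simp add: a_def)
    ultimately show "\<exists>n. var (i, False) ^ n \<in> J" using const_unit_ideal[OF J(1)] by blast
  qed
qed

section \<open>From depth to exactness of the Koszul complex\<close>

lemma radical_ideal:
  assumes J: "ideal_of UNIV J"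
  shows "ideal_of UNIV {f. \<exists>n. f ^ n \<in> J}"
  unfolding ideal_of_def
proof (intro conjI ballI)
  show "0 \<in> {f. \<exists>n. f ^ n \<in> J}" using ideal_ofD(2)[OF J] by (auto intro!: exI[of _ 1])
next
  fix f g assume "f \<in> {f. \<exists>n. f ^ n \<in> J}" "g \<in> {f. \<exists>n. f ^ n \<in> J}"
  then obtain m n where mn: "f ^ m \<in> J" "g ^ n \<in> J" by blast
  have "of_nat ((m + n) choose k) * f ^ k * g ^ (m + n - k) \<in> J" for k
  proof (cases "m \<le> k")
    case True
    then have "f ^ k = f ^ (k - m) * f ^ m" by (simp add: power_add[symmetric])
    then show ?thesis using mn by (simp add: ideal_UNIV_mult[OF J])
  next
    case False
    then have "g ^ (m + n - k) = g ^ (m - k) * g ^ n" by (simp add: power_add[symmetric])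
    then show ?thesis using mn by (simp add: ideal_UNIV_mult[OF J])
  qed
  then have "(f + g) ^ (m + n) \<in> J" unfolding binomial_ring by (intro ideal_sum[OF J])
  then show "f + g \<in> {f. \<exists>n. f ^ n \<in> J}" by blast
next
  fix r f assume "f \<in> {f. \<exists>n. f ^ n \<in> J}"
  then show "r * f \<in> {f. \<exists>n. f ^ n \<in> J}" using ideal_UNIV_mult[OF J] by (auto simp: power_mult_distrib)
qed simp

lemma var_ideal_radical:
  fixes J :: "('q::finite, 'k::field) cox set"
  assumes J: "ideal_of UNIV J" and v: "\<And>i b. \<exists>n. var (i, b) ^ n \<in> J" and f: "f \<in> var_ideal"
  shows "\<exists>n. f ^ n \<in> J"
proof -
  have "var_ideal \<subseteq> {f. \<exists>n. f ^ n \<in> J}"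
    unfolding var_ideal_def by (rule gen_ideal_least[OF radical_ideal[OF J]]) (use v in auto)
  then show ?thesis using f by blast
qed

lemma gen_ideal_Un_gen_ideal: "gen_ideal UNIV (gen_ideal UNIV A \<union> B) = gen_ideal UNIV (A \<union> B)"
proof
  show "gen_ideal UNIV (gen_ideal UNIV A \<union> B) \<subseteq> gen_ideal UNIV (A \<union> B)"
    by (rule gen_ideal_least[OF ideal_of_gen_ideal])
       (use gen_ideal_mono[of A "A \<union> B"] gen_ideal_superset[of "A \<union> B"] in blast)
  show "gen_ideal UNIV (A \<union> B) \<subseteq> gen_ideal UNIV (gen_ideal UNIV A \<union> B)"
    by (rule gen_ideal_mono) (use gen_ideal_superset[of A] in blast)
qed

text \<open>Modulo all of \<open>fs\<close>, exactness in degrees above \<open>length xs\<close>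
  holds because there are no chains; each element of \<open>fs\<close> taken off at the end extends
  it one degree further down by \<open>koszul_exact_descend\<close>.\<close>

lemma koszul_exact_regular_seq:
  assumes I: "ideal_of UNIV I" and reg: "regular_seq I fs"
    and rad: "\<And>f. f \<in> set fs \<Longrightarrow> \<exists>n. f ^ n \<in> gen_ideal UNIV (I \<union> set xs)"
    and p: "length xs < p + length fs"
  shows "koszul_exact xs p I"
proof -
  let ?I = "\<lambda>k. gen_ideal UNIV (I \<union> set (take k fs))"
  have "koszul_exact xs p (?I k)" if "k \<le> length fs" "length xs + k < p + length fs" for k p
    using that
  proof (induction "length fs - k" arbitrary: k p)
    case 0
    then show ?case by (intro koszul_exact_gt_length) simp
  next
    case (Suc d)
    then have k: "k < length fs" by simp
    let ?f = "fs ! k"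
    obtain n where n: "?f ^ n \<in> gen_ideal UNIV (I \<union> set xs)" using rad k by (meson nth_mem)
    have "gen_ideal UNIV (insert ?f (?I k)) = ?I (Suc k)"
      using gen_ideal_Un_gen_ideal[of "I \<union> set (take k fs)" "{?f}"] k by (simp add: take_Suc_conv_app_nth Un_commute)
    then have ex: "koszul_exact xs (Suc p) (gen_ideal UNIV (insert ?f (?I k)))"
      using Suc.hyps(1)[of "Suc k" "Suc p"] Suc.hyps(2) Suc.prems k by simp
    show ?case
    proof (rule koszul_exact_descend[OF ideal_of_gen_ideal _ _ ex])
      show "nonzerodivisor_mod ?f (?I k)" using reg k by (simp add: regular_seq_def nonzerodivisor_mod_def)
      have "gen_ideal UNIV (I \<union> set xs) \<subseteq> gen_ideal UNIV (?I k \<union> set xs)"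
        by (rule gen_ideal_mono) (use gen_ideal_superset[of "I \<union> set (take k fs)" UNIV] in blast)
      then show "?f ^ n \<in> gen_ideal UNIV (?I k \<union> set xs)" using n by blast
    qed
  qed
  from this[of 0 p] p show ?thesis using I by (simp add: gen_ideal_idem)
qed

text \<open>A finite supremum of extended naturals is a maximum, except that the empty set has
  supremum 0; hence the positivity.\<close>

lemma Sup_enat_attained:
  assumes "Sup A = enat n" "0 < n"
  shows "enat n \<in> A"
proof (rule ccontr)
  assume "enat n \<notin> A"
  have "x \<le> enat (n - 1)" if "x \<in> A" for x
  proof -
    have "x \<le> enat n" using that assms(1) Sup_upper by metis
    moreover have "x \<noteq> enat n" using that \<open>enat n \<notin> A\<close> by blast
    ultimately show ?thesis by (cases x) auto
  qed
  then have "Sup A \<le> enat (n - 1)" by (rule Sup_least)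
  then show False using assms by simp
qed

section \<open>The difference function of an ACM scheme\<close>

lemma finite_int_box: "finite {0..b :: int ^ 'q::finite}"
proof (rule finite_subset)
  show "{0..b} \<subseteq> vec_lambda ` (\<Pi>\<^sub>E i\<in>UNIV. {0..b $ i})"
  proof
    fix a assume "a \<in> {0..b}"
    then show "a \<in> vec_lambda ` (\<Pi>\<^sub>E i\<in>UNIV. {0..b $ i})"
      by (intro image_eqI[of _ _ "vec_nth a"]) (auto simp: less_eq_vec_def PiE_def extensional_def)
  qed
  show "finite (vec_lambda ` (\<Pi>\<^sub>E i\<in>UNIV. {0..b $ i}))"
    by (intro finite_imageI finite_PiE) auto
qed

text \<open>Shared by both directions: the ACM case takes x_{i1} - c_i x_{i0} for \<open>l i\<close>
  and x_{i0} for \<open>v i\<close>, the grid takes x_{i0} for \<open>l i\<close> and x_{i1} for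
  \<open>v i\<close>.\<close>

lemma hilbert_difference_regular:
  fixes X :: "('q::finite, 'k::field) ideal_sheaf" and l v :: "'q \<Rightarrow> ('q, 'k) cox"
  assumes js: "distinct js" "set js = UNIV" and l: "\<And>i. l i \<in> forms (axis i 1)" and v: "\<And>i. v i \<in> forms (axis i 1)"
    and nzd: "\<And>i ks. suffix (i # ks) js \<Longrightarrow> nonzerodivisor_mod (l i) (gen_ideal UNIV (vanishing_ideal X \<union> l ` set ks))"
    and span: "\<And>i b. \<exists>c. var (i, b) - const c * v i \<in> gen_ideal UNIV (vanishing_ideal X \<union> range l)"
  shows "difference (hilbert_fun X) =
    indicator {a. 0 \<le> a \<and> (\<Prod>i\<in>UNIV. v i ^ nat (a $ i)) \<notin> gen_ideal UNIV (vanishing_ideal X \<union> range l)}"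
proof
  fix a
  have "difference (hilbert_fun X) a =
      (\<Sum>P\<in>Pow (set js). (-1) ^ card P * int (dim_mod (forms (a - (\<Sum>i\<in>P. axis i 1))) (vanishing_ideal X)))"
    by (simp add: difference_Pow hilbert_fun_def js)
  also have "\<dots> = int (dim_mod (forms a) (gen_ideal UNIV (vanishing_ideal X \<union> l ` set js)))"
    by (rule dim_mod_regular[symmetric, OF graded_vanishing_ideal l js(1) nzd])
  also have "\<dots> = indicator {a. 0 \<le> a \<and> (\<Prod>i\<in>UNIV. v i ^ nat (a $ i)) \<notin> gen_ideal UNIV (vanishing_ideal X \<union> range l)} a"
    unfolding js(2) by (rule dim_mod_monomial[OF ideal_of_gen_ideal v span])
  finally show "difference (hilbert_fun X) a =
    indicator {a. 0 \<le> a \<and> (\<Prod>i\<in>UNIV. v i ^ nat (a $ i)) \<notin> gen_ideal UNIV (vanishing_ideal X \<union> range l)} a" .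
qed

theorem ACM_difference_quasi_rectangular:
  fixes X :: "('q::finite, 'k::field) ideal_sheaf"
  assumes inf: "infinite (UNIV :: 'k set)" and X: "zero_dimensional X" "ACM X"
  shows "\<exists>Q. quasi_rectangular Q \<and> difference (hilbert_fun X) = indicator Q"
proof -
  let ?I = "vanishing_ideal X"
  have idI: "ideal_of UNIV ?I" using graded_vanishing_ideal by (auto simp: mdeg.graded_ideal_def)
  obtain c :: "'q \<Rightarrow> 'k" where c: "\<And>J i. ideal_of UNIV J \<Longrightarrow> ?I \<subseteq> J \<Longrightarrow>
      var (i, True) - const (c i) * var (i, False) \<in> J \<Longrightarrow> \<exists>n. var (i, False) ^ n \<in> J"
    by (rule zero_dimensional_parameters[OF inf X(1)]) blast
  define l :: "'q \<Rightarrow> ('q, 'k) cox" where "l = (\<lambda>i. var (i, True) - const (c i) * var (i, False))"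
  define N where "N = gen_ideal UNIV (?I \<union> range l)"
  have idN: "ideal_of UNIV N" by (simp add: N_def)
  have IN: "?I \<subseteq> N" and lN: "l i \<in> N" for i using gen_ideal_superset[of "?I \<union> range l" UNIV] by (auto simp: N_def)
  have v0: "\<exists>n. var (i, False) ^ n \<in> N" for i
    using c[OF idN IN] lN by (simp add: l_def)
  have v1: "\<exists>n. var (i, b) ^ n \<in> N" for i b
  proof (cases b)
    case True
    obtain n where n: "var (i, False) ^ n \<in> N" using v0 by blast
    have "var (i, True) ^ n - (const (c i) * var (i, False)) ^ n \<in> N"
      using lN by (intro ideal_cong_power[OF idN]) (simp add: l_def)
    moreover have "(const (c i) * var (i, False)) ^ n \<in> N"
      using n by (simp add: power_mult_distrib ideal_UNIV_mult[OF idN])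
    ultimately have "var (i, True) ^ n \<in> N" using ideal_UNIV_mem_cong[OF idN] by blast
    then show ?thesis using True by auto
  qed (use v0 in simp)
  have lforms: "l i \<in> forms (axis i 1)" for i
    unfolding l_def by (intro forms_diff var_in_forms forms_const_mult)
  obtain js :: "'q list" where js: "set js = UNIV" "distinct js" using finite_distinct_list[OF finite] by blast
  then have len: "length js = CARD('q)" using distinct_card by fastforce
  have "depth var_ideal ?I = enat CARD('q)" using X(2) by (simp add: ACM_def)
  then have "enat CARD('q) \<in> {enat (length fs) | fs. set fs \<subseteq> var_ideal \<and> regular_seq ?I fs}"
    unfolding depth_def by (rule Sup_enat_attained) simp
  then obtain fs where fs: "length fs = CARD('q)" "set fs \<subseteq> var_ideal" "regular_seq ?I fs" by auto
  \<comment> \<open>There are as many linear forms as members of \<open>fs\<close>, which gives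
    exactness down to degree 1.\<close>
  have "koszul_exact (map l js) 1 ?I"
  proof (rule koszul_exact_regular_seq[OF idI fs(3)])
    show "\<exists>n. f ^ n \<in> gen_ideal UNIV (?I \<union> set (map l js))" if "f \<in> set fs" for f
      using var_ideal_radical[OF idN v1] fs(2) that by (auto simp: N_def js)
  qed (simp add: fs len)
  \<comment> \<open>Each \<open>l i\<close> has to be a nonzerodivisor modulo the forms after it, so
    the first homology must vanish for every suffix.\<close>
  then have suff: "koszul_exact (map l ks) 1 ?I" if "suffix ks js" for ks
    using that
  proof (induction js)
    case (Cons j js)
    have "koszul_exact (map l js) 1 ?I"
      by (rule koszul_exact_tl[OF tdeg.grading_axioms tdeg_nonneg tdeg_graded_vanishing_ideal])
         (use Cons.prems(1) lforms in \<open>auto intro: forms_axis_tdeg\<close>)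
    then show ?case using Cons by (auto simp: suffix_Cons)
  qed simp
  have nzd: "nonzerodivisor_mod (l i) (gen_ideal UNIV (?I \<union> l ` set ks))" if "suffix (i # ks) js" for i ks
    using koszul_exact_1_nonzerodivisor[OF idI, of "l i" "map l ks"] suff[OF that] by simp
  let ?Q = "{a. 0 \<le> a \<and> (\<Prod>i\<in>UNIV. (var (i, False) :: ('q, 'k) cox) ^ nat (a $ i)) \<notin> N}"
  have "difference (hilbert_fun X) = indicator ?Q"
    unfolding N_def
  proof (rule hilbert_difference_regular[OF js(2,1) lforms var_in_forms nzd])
    fix i b
    have "var (i, b) - const (if b then c i else 1) * var (i, False) \<in> N"
      using lN[of i] ideal_ofD(2)[OF idN] by (simp add: l_def)
    then show "\<exists>d. var (i, b) - const d * var (i, False) \<in> gen_ideal UNIV (?I \<union> range l)"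
      unfolding N_def by blast
  qed
  \<comment> \<open>The exponents of monomials outside an ideal form a down-set, which is finite as
    the variables are nilpotent; it is the union of the boxes below its own elements.\<close>
  moreover have "quasi_rectangular ?Q"
  proof -
    obtain n where n: "\<And>i. var (i, False) ^ n i \<in> N" using v0 by metis
    have mono: "(\<Prod>i\<in>UNIV. (var (i, False) :: ('q, 'k) cox) ^ nat (b $ i)) \<in> N"
      if ab: "a \<le> b" "0 \<le> a" and a: "(\<Prod>i\<in>UNIV. (var (i, False) :: ('q, 'k) cox) ^ nat (a $ i)) \<in> N" for a b :: "int ^ 'q"
    proof -
      have "(\<Prod>i\<in>UNIV. (var (i, False) :: ('q, 'k) cox) ^ nat (b $ i)) =
          (\<Prod>i\<in>UNIV. var (i, False) ^ nat (b $ i - a $ i)) * (\<Prod>i\<in>UNIV. var (i, False) ^ nat (a $ i))"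
        unfolding prod.distrib[symmetric] using ab
        by (intro prod.cong) (auto simp: less_eq_vec_def power_add[symmetric] nat_add_distrib[symmetric])
      then show ?thesis using a by (simp add: ideal_UNIV_mult[OF idN])
    qed
    have "?Q \<subseteq> {0..\<chi> i. int (n i)}"
    proof
      fix a assume a: "a \<in> ?Q"
      have "a $ i \<le> int (n i)" for i
      proof (rule ccontr)
        assume "\<not> a $ i \<le> int (n i)"
        then have "nat (a $ i) = (nat (a $ i) - n i) + n i" by simp
        then have "(var (i, False) :: ('q, 'k) cox) ^ nat (a $ i) = var (i, False) ^ (nat (a $ i) - n i) * var (i, False) ^ n i"
          by (metis power_add)
        then have "var (i, False) ^ nat (a $ i) \<in> N" using n by (simp add: ideal_UNIV_mult[OF idN])
        then have "(\<Prod>i\<in>UNIV. (var (i, False) :: ('q, 'k) cox) ^ nat (a $ i)) \<in> N"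
          by (simp add: prod.remove[of UNIV i] ideal_UNIV_mult[OF idN])
        then show False using a by simp
      qed
      then show "a \<in> {0..\<chi> i. int (n i)}" using a by (simp add: less_eq_vec_def)
    qed
    then have "finite ?Q" using finite_int_box finite_subset by blast
    moreover have "?Q = (\<Union>r\<in>?Q. {0..r})"
    proof
      show "(\<Union>r\<in>?Q. {0..r}) \<subseteq> ?Q" using mono by auto
    qed auto
    ultimately show ?thesis unfolding quasi_rectangular_def by (intro exI[of _ ?Q]) auto
  qed
  ultimately show ?thesis by blast
qed

section \<open>Krull dimension of polynomial rings\<close>

lemma var_power: "(var v :: ('q, 'k::field) cox) ^ n = single (single v n) 1"
  by (induction n) (auto simp: Defs.var_def mult_single single_add[symmetric])

lemma single_eq_prod_var:
  "single m c = const c * (\<Prod>v\<in>UNIV. (var v :: ('q::finite, 'k::field) cox) ^ lookup m v)"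
proof -
  have "(\<Prod>v\<in>S. (var v :: ('q, 'k) cox) ^ lookup m v) =
      single (\<Sum>v\<in>S. single v (lookup m v)) 1" for S
    by (induction S rule: infinite_finite_induct) (auto simp: var_power mult_single)
  moreover have "(\<Sum>v\<in>UNIV. single v (lookup m v)) = m"
    by (rule poly_mapping_eqI) (simp add: lookup_sum lookup_single when_def)
  ultimately show ?thesis by (simp add: const_mult_single)
qed

lemma cox_induct [case_names const var add mult]:
  fixes F :: "('q::finite, 'k::field) cox"
  assumes "\<And>c. P (const c)" "\<And>v. P (var v)"
    and add: "\<And>F G. P F \<Longrightarrow> P G \<Longrightarrow> P (F + G)" and mult: "\<And>F G. P F \<Longrightarrow> P G \<Longrightarrow> P (F * G)"
  shows "P F"
proof (induction F rule: poly_mapping_induct_sum)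
  case (single m c)
  have 1: "P 1" using assms(1)[of 1] by simp
  have pow: "P (var v ^ n)" for v n by (induction n) (auto simp: 1 assms mult)
  have "P (\<Prod>v\<in>S. var v ^ lookup m v)" for S
    by (induction S rule: infinite_finite_induct) (auto simp: 1 pow mult)
  then show ?case unfolding single_eq_prod_var by (intro mult assms(1))
qed (rule add)

text \<open>Keeping only the terms with the smallest exponent of \<open>y k\<close> and cancelling that power moves the
  relation from \<open>P k\<close> to \<open>P (Suc k)\<close>; at the top a nonzero constant is left.\<close>

lemma chain_no_relation:
  fixes y :: "nat \<Rightarrow> ('q::finite, 'k::field) cox"
  assumes P: "\<And>k. k \<le> n \<Longrightarrow> ideal_of UNIV (P k)" and nzd: "\<And>k. k < n \<Longrightarrow> nonzerodivisor_mod (y k) (P k)"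
    and sub: "\<And>k. k < n \<Longrightarrow> P k \<subseteq> P (Suc k)" and y: "\<And>k. k < n \<Longrightarrow> y k \<in> P (Suc k)" and 1: "1 \<notin> P n"
    and B: "finite B" "B \<subseteq> extensional {..<n}"
    and rel: "(\<Sum>\<beta>\<in>B. const (u \<beta>) * (\<Prod>k\<in>{..<n}. y k ^ \<beta> k)) \<in> P 0"
  shows "\<forall>\<beta>\<in>B. u \<beta> = 0"
proof (rule ccontr)
  assume no: "\<not> ?thesis"
  define S where "S = {\<beta>\<in>B. u \<beta> \<noteq> 0}"
  have "\<exists>T\<subseteq>S. T \<noteq> {} \<and> (\<forall>\<beta>\<in>T. \<forall>\<gamma>\<in>T. \<forall>j<k. \<beta> j = \<gamma> j) \<and>
      (\<Sum>\<beta>\<in>T. const (u \<beta>) * (\<Prod>j\<in>{k..<n}. y j ^ \<beta> j)) \<in> P k" if "k \<le> n" for k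
    using that
  proof (induction k)
    case 0
    have "(\<Sum>\<beta>\<in>S. const (u \<beta>) * (\<Prod>j\<in>{0..<n}. y j ^ \<beta> j)) = (\<Sum>\<beta>\<in>B. const (u \<beta>) * (\<Prod>k\<in>{..<n}. y k ^ \<beta> k))"
      using B by (intro sum.mono_neutral_cong_left) (auto simp: S_def atLeast0LessThan)
    then show ?case using no rel by (intro exI[of _ S]) (auto simp: S_def)
  next
    case (Suc k)
    then have k: "k < n" by simp
    obtain T where T: "T \<subseteq> S" "T \<noteq> {}" "\<forall>\<beta>\<in>T. \<forall>\<gamma>\<in>T. \<forall>j<k. \<beta> j = \<gamma> j"
      "(\<Sum>\<beta>\<in>T. const (u \<beta>) * (\<Prod>j\<in>{k..<n}. y j ^ \<beta> j)) \<in> P k"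
      using Suc.IH[OF less_imp_le[OF k]] by blast
    have finT: "finite T" using T(1) B by (auto simp: S_def intro: finite_subset)
    define m where "m = Min ((\<lambda>\<beta>. \<beta> k) ` T)"
    have m: "m \<le> \<beta> k" if "\<beta> \<in> T" for \<beta> using that finT by (simp add: m_def)
    obtain \<beta>0 where \<beta>0: "\<beta>0 \<in> T" "\<beta>0 k = m"
      using Min_in[of "(\<lambda>\<beta>. \<beta> k) ` T"] finT T(2) unfolding m_def by fastforce
    let ?w = "\<lambda>\<beta>. const (u \<beta>) * (\<Prod>j\<in>{Suc k..<n}. y j ^ \<beta> j)"
    note idk = P[OF less_imp_le[OF k]] and idS = P[OF Suc.prems]
    have pull: "z \<in> P k" if "y k ^ e * z \<in> P k" for e z
      using that by (induction e) (use nzd[OF k] in \<open>auto simp: nonzerodivisor_mod_def mult.assoc\<close>)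
    have "(\<Sum>\<beta>\<in>T. const (u \<beta>) * (\<Prod>j\<in>{k..<n}. y j ^ \<beta> j)) = (\<Sum>\<beta>\<in>T. y k ^ m * (y k ^ (\<beta> k - m) * ?w \<beta>))"
    proof (rule sum.cong)
      fix \<beta> assume "\<beta> \<in> T"
      have "y k ^ \<beta> k = y k ^ m * y k ^ (\<beta> k - m)" using m[OF \<open>\<beta> \<in> T\<close>] by (simp add: power_add[symmetric])
      then show "const (u \<beta>) * (\<Prod>j\<in>{k..<n}. y j ^ \<beta> j) = y k ^ m * (y k ^ (\<beta> k - m) * ?w \<beta>)"
        using k by (simp add: prod.atLeast_Suc_lessThan mult_ac)
    qed simp
    then have "y k ^ m * (\<Sum>\<beta>\<in>T. y k ^ (\<beta> k - m) * ?w \<beta>) \<in> P k" using T(4) by (simp add: sum_distrib_left)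
    then have "(\<Sum>\<beta>\<in>T. y k ^ (\<beta> k - m) * ?w \<beta>) \<in> P (Suc k)" using pull sub[OF k] by blast
    moreover have "(\<Sum>\<beta>\<in>T. y k ^ (\<beta> k - m) * ?w \<beta>) =
        (\<Sum>\<beta>\<in>{\<beta>\<in>T. \<beta> k = m}. ?w \<beta>) + (\<Sum>\<beta>\<in>{\<beta>\<in>T. \<beta> k \<noteq> m}. y k ^ (\<beta> k - m) * ?w \<beta>)"
    proof -
      have "(\<Sum>\<beta>\<in>T. y k ^ (\<beta> k - m) * ?w \<beta>) = (\<Sum>\<beta>\<in>{\<beta>\<in>T. \<beta> k = m} \<union> {\<beta>\<in>T. \<beta> k \<noteq> m}. y k ^ (\<beta> k - m) * ?w \<beta>)"
        by (rule sum.cong) auto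
      also have "\<dots> = (\<Sum>\<beta>\<in>{\<beta>\<in>T. \<beta> k = m}. y k ^ (\<beta> k - m) * ?w \<beta>) + (\<Sum>\<beta>\<in>{\<beta>\<in>T. \<beta> k \<noteq> m}. y k ^ (\<beta> k - m) * ?w \<beta>)"
        using finT by (intro sum.union_disjoint) auto
      also have "(\<Sum>\<beta>\<in>{\<beta>\<in>T. \<beta> k = m}. y k ^ (\<beta> k - m) * ?w \<beta>) = (\<Sum>\<beta>\<in>{\<beta>\<in>T. \<beta> k = m}. ?w \<beta>)"
        by (rule sum.cong) auto
      finally show ?thesis .
    qed
    moreover have "(\<Sum>\<beta>\<in>{\<beta>\<in>T. \<beta> k \<noteq> m}. y k ^ (\<beta> k - m) * ?w \<beta>) \<in> P (Suc k)"
    proof (rule ideal_sum[OF idS])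
      fix \<beta> assume "\<beta> \<in> {\<beta>\<in>T. \<beta> k \<noteq> m}"
      then have "\<beta> k - m = Suc (\<beta> k - m - 1)" using m[of \<beta>] by auto
      then have "y k ^ (\<beta> k - m) = y k ^ (\<beta> k - m - 1) * y k" by (metis power_Suc2)
      then show "y k ^ (\<beta> k - m) * ?w \<beta> \<in> P (Suc k)" using y[OF k] by (simp add: ideal_UNIV_mult[OF idS])
    qed
    ultimately have "(\<Sum>\<beta>\<in>{\<beta>\<in>T. \<beta> k = m}. ?w \<beta>) \<in> P (Suc k)"
      using ideal_UNIV_diff[OF idS] by fastforce
    then show ?case using \<beta>0 T(1,3)
      by (intro exI[of _ "{\<beta>\<in>T. \<beta> k = m}"]) (auto simp: less_Suc_eq)
  qed
  from this[OF order_refl] obtain T where T: "T \<subseteq> S" "T \<noteq> {}" "\<forall>\<beta>\<in>T. \<forall>\<gamma>\<in>T. \<forall>j<n. \<beta> j = \<gamma> j"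
    "(\<Sum>\<beta>\<in>T. const (u \<beta>) * (\<Prod>j\<in>{n..<n}. y j ^ \<beta> j)) \<in> P n" by blast
  obtain \<beta> where \<beta>: "\<beta> \<in> T" using T(2) by blast
  \<comment> \<open>The remaining exponent functions agree below \<open>n\<close> and are
    extensional, so only one is left.\<close>
  have "\<gamma> = \<beta>" if "\<gamma> \<in> T" for \<gamma>
    using that \<beta> T(1,3) B(2) by (intro extensionalityI[of _ "{..<n}"]) (auto simp: S_def)
  then have "T = {\<beta>}" using \<beta> by blast
  then have "const (u \<beta>) * 1 \<in> P n" using T(4) by simp
  moreover have "u \<beta> \<noteq> 0" using \<beta> T(1) by (auto simp: S_def)
  ultimately show False using const_unit_ideal[OF P[OF order_refl]] 1 by blast
qed

text \<open>Dimension count: the number of products with exponents up to \<open>N\<close> grows like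
  the power \<open>q + 1\<close> of \<open>N\<close>, the number of monomials they involve only like
  the power \<open>q\<close>.\<close>

lemma algebraic_relation:
  fixes y :: "nat \<Rightarrow> ('q::finite, 'k::field) cox"
  defines "n \<equiv> Suc CARD('q)"
  assumes y: "\<And>k m i. k < n \<Longrightarrow> m \<in> keys (y k) \<Longrightarrow> lookup m (i, True) = 0"
  obtains N u where "\<exists>\<beta>\<in>{..<n} \<rightarrow>\<^sub>E {..N :: nat}. u \<beta> \<noteq> 0"
    "(\<Sum>\<beta>\<in>{..<n} \<rightarrow>\<^sub>E {..N}. const (u \<beta>) * (\<Prod>k\<in>{..<n}. y k ^ \<beta> k)) = 0"
proof -
  let ?q = "CARD('q)"
  define A where "A = (\<lambda>L. {m :: 'q \<times> bool \<Rightarrow>\<^sub>0 nat. (\<forall>i. lookup m (i, True) = 0) \<and> (\<forall>v. lookup m v \<le> L)})"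
  define D where "D = Max (insert 0 ((\<lambda>(m, v). lookup m v) ` ((\<Union>k<n. keys (y k)) \<times> UNIV)))"
  have yA: "keys (y k) \<subseteq> A D" if "k < n" for k
  proof
    fix m assume m: "m \<in> keys (y k)"
    have "lookup m v \<le> D" for v
      unfolding D_def by (rule Max_ge) (use m that in force)+
    then show "m \<in> A D" using y[OF that m] by (simp add: A_def)
  qed
  have multA: "keys (F * G) \<subseteq> A (a + b)"
    if F: "keys F \<subseteq> A a" and G: "keys G \<subseteq> A b" for F G :: "('q, 'k) cox" and a b
  proof
    fix m assume "m \<in> keys (F * G)"
    then obtain s t where "m = s + t" "s \<in> A a" "t \<in> A b" using keys_mult[of F G] F G by blast
    then show "m \<in> A (a + b)" by (auto simp: A_def lookup_add intro: add_mono)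
  qed
  have oneA: "keys (1 :: ('q, 'k) cox) \<subseteq> A 0" by (simp add: A_def)
  have powA: "keys (y k ^ e) \<subseteq> A (e * D)" if "k < n" for k e
    by (induction e) (use oneA multA[OF yA[OF that]] in auto)
  have prodA: "keys (\<Prod>k\<in>K. y k ^ \<beta> k) \<subseteq> A (\<Sum>k\<in>K. \<beta> k * D)" if "K \<subseteq> {..<n}" for K \<beta>
    using finite_subset[OF that finite_lessThan] that
    by (induction K rule: finite_induct) (use oneA multA powA in auto)
  \<comment> \<open>\<open>(N + 1)\<^sup>q\<^sup>+\<^sup>1\<close> products lie in the span of \<open>(L + 1)\<^sup>q\<close> monomials\<close>
  define N where "N = (n * D + 1) ^ ?q"
  define L where "L = n * D * N"
  let ?B = "{..<n} \<rightarrow>\<^sub>E {..N}" and ?g = "\<lambda>\<beta>. \<Prod>k\<in>{..<n}. y k ^ \<beta> k"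
  have finB: "finite ?B" by (intro finite_PiE) auto
  have gA: "keys (?g \<beta>) \<subseteq> A L" if "\<beta> \<in> ?B" for \<beta>
  proof -
    have "(\<Sum>k\<in>{..<n}. \<beta> k * D) \<le> (\<Sum>k\<in>{..<n}. N * D)"
      using that by (intro sum_mono mult_right_mono) (auto simp: PiE_def Pi_def)
    also have "\<dots> = L" by (simp add: L_def)
    finally have "A (\<Sum>k\<in>{..<n}. \<beta> k * D) \<subseteq> A L" by (auto simp: A_def intro: order_trans)
    then show ?thesis using prodA[of "{..<n}" \<beta>] by blast
  qed
  have cardA: "finite (A L)" "card (A L) \<le> (L + 1) ^ ?q"
  proof -
    show "finite (A L)" by (rule finite_subset[OF _ finite_bounded_exponents[of L]]) (auto simp: A_def)
    let ?f = "\<lambda>m. \<lambda>i\<in>(UNIV :: 'q set). lookup m (i, False)"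
    have "card (A L) \<le> card ((UNIV :: 'q set) \<rightarrow>\<^sub>E {..L})"
    proof (rule card_inj_on_le)
      show "inj_on ?f (A L)"
      proof (rule inj_onI)
        fix s t assume st: "s \<in> A L" "t \<in> A L" "?f s = ?f t"
        show "s = t"
        proof (rule poly_mapping_eqI)
          fix v :: "'q \<times> bool"
          obtain i b where v: "v = (i, b)" by force
          show "lookup s v = lookup t v"
            using st(1,2) fun_cong[OF st(3), of i] by (cases b) (simp_all add: A_def v)
        qed
      qed
      show "?f ` A L \<subseteq> UNIV \<rightarrow>\<^sub>E {..L}" by (auto simp: A_def)
      show "finite ((UNIV :: 'q set) \<rightarrow>\<^sub>E {..L})" by (intro finite_PiE) auto
    qed
    also have "\<dots> = (L + 1) ^ ?q" by (simp add: card_PiE)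
    finally show "card (A L) \<le> (L + 1) ^ ?q" .
  qed
  \<comment> \<open>This explains the value of \<open>N\<close>: it turns the \<open>q\<close>-th
    power of the right-hand side into \<open>N * (N + 1) ^ q\<close>, just below the number of
    products.\<close>
  have "L + 1 \<le> (n * D + 1) * (N + 1)" by (simp add: L_def algebra_simps)
  then have "(L + 1) ^ ?q \<le> ((n * D + 1) * (N + 1)) ^ ?q" by (rule power_mono) simp
  also have "\<dots> = N * (N + 1) ^ ?q" by (simp only: power_mult_distrib N_def)
  also have "\<dots> < (N + 1) * (N + 1) ^ ?q" by simp
  also have "\<dots> = card ?B" by (simp add: card_PiE n_def)
  finally have less: "(L + 1) ^ ?q < card ?B" .
  \<comment> \<open>Two equal products already give a relation with coefficients 1 and -1; otherwise
    there are too many distinct products for them to be independent.\<close>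
  have "\<exists>u. (\<exists>\<beta>\<in>?B. u \<beta> \<noteq> 0) \<and> (\<Sum>\<beta>\<in>?B. const (u \<beta>) * ?g \<beta>) = 0"
  proof (cases "inj_on ?g ?B")
    case False
    then obtain \<beta> \<gamma> where bg: "\<beta> \<in> ?B" "\<gamma> \<in> ?B" "\<beta> \<noteq> \<gamma>" "?g \<beta> = ?g \<gamma>" by (auto simp: inj_on_def)
    define u where "u = (\<lambda>\<alpha>. if \<alpha> = \<beta> then 1 else if \<alpha> = \<gamma> then - 1 else (0::'k))"
    have "(\<Sum>\<alpha>\<in>?B. const (u \<alpha>) * ?g \<alpha>) = (\<Sum>\<alpha>\<in>?B. (if \<alpha> = \<beta> then ?g \<beta> else 0) - (if \<alpha> = \<gamma> then ?g \<gamma> else 0))"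
      using bg(3) by (intro sum.cong) (auto simp: u_def const_uminus)
    also have "\<dots> = 0" using bg finB by (simp add: sum_subtractf)
    finally show ?thesis using bg(1) by (intro exI[of _ u]) (auto simp: u_def)
  next
    case True
    have "\<not> cox.independent (?g ` ?B)"
    proof
      assume ind: "cox.independent (?g ` ?B)"
      have "?g ` ?B \<subseteq> cox.span ((\<lambda>m. single m 1) ` A L)"
        using in_span_singles[OF gA] by (rule image_subsetI)
      then have "card (?g ` ?B) \<le> card ((\<lambda>m. single m (1::'k)) ` A L)"
        using cox.independent_span_bound[OF _ ind] cardA(1) by blast
      also have "\<dots> \<le> card (A L)" using cardA(1) by (rule card_image_le)
      finally show False using True cardA(2) less by (simp add: card_image)
    qed
    then obtain u where u: "\<exists>v\<in>?g ` ?B. u v \<noteq> 0" "(\<Sum>v\<in>?g ` ?B. const (u v) * v) = 0"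
      using cox.dependent_finite[of "?g ` ?B"] finB by blast
    have "(\<Sum>\<beta>\<in>?B. const (u (?g \<beta>)) * ?g \<beta>) = 0" using u(2) True by (simp add: sum.reindex)
    then show ?thesis using u(1) by (intro exI[of _ "\<lambda>\<beta>. u (?g \<beta>)"]) auto
  qed
  then show ?thesis using that by blast
qed

lemma prime_ideal_kernel:
  fixes f :: "'a::comm_ring_1 \<Rightarrow> 'b::idom"
  assumes "f 1 = 1" "\<And>x y. f (x + y) = f x + f y" "\<And>x y. f (x * y) = f x * f y"
  shows "prime_ideal_of UNIV {x. f x = 0}"
proof -
  have "f 0 = 0" using assms(2)[of 0 0] by (metis add.right_neutral add_left_cancel)
  moreover have "1 \<notin> {x. f x = 0}" using assms(1) by simp
  then have "{x. f x = 0} \<noteq> UNIV" by blast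
  ultimately show ?thesis unfolding prime_ideal_of_def ideal_of_def by (auto simp: assms)
qed

lemma prime_ideal_one: "prime_ideal_of UNIV P \<Longrightarrow> 1 \<notin> P"
  unfolding prime_ideal_of_def using ideal_UNIV_mult(1)[of P 1] by force

lemma prime_ideal_prod:
  assumes "prime_ideal_of UNIV P" "prod g S \<in> P"
  shows "\<exists>s\<in>S. g s \<in> P"
  using assms(2)
proof (induction S rule: infinite_finite_induct)
  case (insert s S)
  then show ?case using assms(1) by (auto simp: prime_ideal_of_def)
qed (use prime_ideal_one[OF assms(1)] in auto)

lemma krull_dim_eqI:
  assumes le: "\<And>n P. (\<And>k. k \<le> n \<Longrightarrow> prime_ideal_of R (P k)) \<Longrightarrow> (\<And>k. k \<le> n \<Longrightarrow> I \<subseteq> P k) \<Longrightarrow>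
      (\<And>k. k < n \<Longrightarrow> P k \<subset> P (Suc k)) \<Longrightarrow> n \<le> d"
    and ge: "\<And>k. k \<le> d \<Longrightarrow> prime_ideal_of R (C k)" "\<And>k. k \<le> d \<Longrightarrow> I \<subseteq> C k" "\<And>k. k < d \<Longrightarrow> C k \<subset> C (Suc k)"
  shows "krull_dim R I = enat d"
  unfolding krull_dim_def
proof (rule Sup_eqI)
  fix x assume "x \<in> {enat n | n. \<exists>P. (\<forall>k\<le>n. prime_ideal_of R (P k) \<and> I \<subseteq> P k) \<and> (\<forall>k<n. P k \<subset> P (Suc k))}"
  then obtain n P where "x = enat n" "\<forall>k\<le>n. prime_ideal_of R (P k) \<and> I \<subseteq> P k" "\<forall>k<n. P k \<subset> P (Suc k)"
    by blast
  then show "x \<le> enat d" using le[of n P] by simp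
next
  fix x assume x: "\<And>z. z \<in> {enat n | n. \<exists>P. (\<forall>k\<le>n. prime_ideal_of R (P k) \<and> I \<subseteq> P k) \<and> (\<forall>k<n. P k \<subset> P (Suc k))} \<Longrightarrow> z \<le> x"
  show "enat d \<le> x"
    by (rule x, intro CollectI exI[of _ d] conjI refl exI[of _ C]) (use ge in auto)
qed

text \<open>A prime containing \<open>q\<close> linear forms of different degrees reduces its elements to polynomials in
  \<open>q\<close> variables, of which no \<open>q + 1\<close> are algebraically independent.\<close>

lemma prime_chain_length_le:
  fixes P :: "nat \<Rightarrow> ('q::finite, 'k::field) cox set"
  assumes P: "\<And>k. k \<le> n \<Longrightarrow> prime_ideal_of UNIV (P k)" "\<And>k. k < n \<Longrightarrow> P k \<subset> P (Suc k)"
    and l: "\<And>i. var (i, True) - const (a i) * var (i, False) \<in> P 0"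
  shows "n \<le> CARD('q)"
proof (rule ccontr)
  assume "\<not> n \<le> CARD('q)"
  then have n: "Suc CARD('q) \<le> n" by simp
  have idP: "ideal_of UNIV (P k)" if "k \<le> n" for k using P(1)[OF that] by (simp add: prime_ideal_of_def)
  have P0: "P 0 \<subseteq> P k" if "k \<le> n" for k
    using that
  proof (induction k)
    case (Suc k)
    then show ?case using P(2)[of k] by auto
  qed simp
  define clean where "clean = (\<lambda>F :: ('q, 'k) cox. \<forall>m\<in>keys F. \<forall>i. lookup m (i, True) = 0)"
  have red: "\<exists>G. clean G \<and> F - G \<in> P 0" for F :: "('q, 'k) cox"
  proof (induction F rule: cox_induct)
    case (const c)
    show ?case using ideal_ofD(2)[OF idP[of 0]] by (intro exI[of _ "const c"]) (simp add: clean_def const_def)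
  next
    case (var v)
    obtain i b where v: "v = (i, b)" by force
    have "clean (const (if b then a i else 1) * var (i, False))"
      by (auto simp: clean_def Defs.var_def const_mult_single lookup_single when_def)
    moreover have "var v - const (if b then a i else 1) * var (i, False) \<in> P 0"
      using l[of i] ideal_ofD(2)[OF idP[of 0]] by (simp add: v)
    ultimately show ?case by blast
  next
    case (add F G)
    then obtain F' G' where *: "clean F'" "F - F' \<in> P 0" "clean G'" "G - G' \<in> P 0" by blast
    have "clean (F' + G')" using *(1,3) keys_add[of F' G'] unfolding clean_def by blast
    moreover have "F + G - (F' + G') \<in> P 0" using ideal_ofD(3)[OF idP[of 0] *(2,4)] by (simp add: algebra_simps)
    ultimately show ?case by blast
  next
    case (mult F G)
    then obtain F' G' where *: "clean F'" "F - F' \<in> P 0" "clean G'" "G - G' \<in> P 0" by blast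
    have "clean (F' * G')" unfolding clean_def
    proof (intro ballI allI)
      fix m i assume "m \<in> keys (F' * G')"
      then obtain s t where st: "m = s + t" "s \<in> keys F'" "t \<in> keys G'" using keys_mult by blast
      then show "lookup m (i, True) = 0" using *(1,3) by (simp add: lookup_add clean_def)
    qed
    moreover have "F * G - F' * G' \<in> P 0" using ideal_cong_mult[OF idP[of 0] *(2,4)] by simp
    ultimately show ?case by blast
  qed
  \<comment> \<open>Witnesses of the strict inclusions are replaced by representatives in the x_{i0}
    alone; a change by an element of \<open>P 0\<close> affects membership in none of the
    \<open>P k\<close>.\<close>
  have "\<exists>z. k < n \<longrightarrow> z \<in> P (Suc k) - P k" for k using P(2)[of k] by blast
  then obtain z where z: "\<And>k. k < n \<Longrightarrow> z k \<in> P (Suc k) - P k" by metis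
  have "\<forall>k. \<exists>G. clean G \<and> z k - G \<in> P 0" using red by blast
  then obtain y where y: "\<And>k. clean (y k)" "\<And>k. z k - y k \<in> P 0" by metis
  have yP: "y k \<in> P (Suc k)" "y k \<notin> P k" if "k < n" for k
    using z[OF that] ideal_UNIV_mem_cong[OF idP, of "Suc k" "z k" "y k"] ideal_UNIV_mem_cong[OF idP, of k "z k" "y k"]
      y(2)[of k] P0[of k] P0[of "Suc k"] that by auto
  let ?n = "Suc CARD('q)"
  obtain N u where u: "\<exists>\<beta>\<in>{..<?n} \<rightarrow>\<^sub>E {..N}. u \<beta> \<noteq> 0"
    "(\<Sum>\<beta>\<in>{..<?n} \<rightarrow>\<^sub>E {..N}. const (u \<beta>) * (\<Prod>k\<in>{..<?n}. y k ^ \<beta> k)) = 0"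
    using algebraic_relation[of y] y(1) by (auto simp: clean_def)
  have "\<forall>\<beta>\<in>{..<?n} \<rightarrow>\<^sub>E {..N}. u \<beta> = 0"
  proof (rule chain_no_relation[of ?n P y])
    show "nonzerodivisor_mod (y k) (P k)" if "k < ?n" for k
      using P(1)[of k] yP(2)[of k] that n by (auto simp: nonzerodivisor_mod_def prime_ideal_of_def)
    show "finite ({..<?n} \<rightarrow>\<^sub>E {..N})" by (intro finite_PiE) auto
    show "1 \<notin> P ?n" using prime_ideal_one[OF P(1)[OF n]] .
    show "(\<Sum>\<beta>\<in>{..<?n} \<rightarrow>\<^sub>E {..N}. const (u \<beta>) * (\<Prod>k\<in>{..<?n}. y k ^ \<beta> k)) \<in> P 0"
      using u(2) ideal_ofD(2)[OF idP[of 0]] by simp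
    show "P k \<subseteq> P (Suc k)" if "k < ?n" for k using P(2)[of k] that n by auto
    show "y k \<in> P (Suc k)" if "k < ?n" for k using yP(1)[of k] that n by auto
  qed (use idP n in \<open>auto simp: PiE_def\<close>)
  then show False using u(1) by blast
qed

lemma subst_hom:
  fixes h :: "'k::comm_ring_1 \<Rightarrow> 'b::comm_ring_1" and z :: "'v::finite \<Rightarrow> 'b"
  assumes "h 1 = 1" "\<And>x y. h (x + y) = h x + h y" "\<And>x y. h (x * y) = h x * h y"
  shows "monoid_algebra_hom h (\<lambda>m. \<Prod>v\<in>UNIV. z v ^ lookup m v)"
  by unfold_locales (auto simp: assms lookup_add power_add prod.distrib)

lemma prod_power_lookup_single:
  "(\<Prod>v\<in>UNIV. z v ^ lookup (single w n) v) = (z (w :: 'v::finite) :: 'b::comm_ring_1) ^ n"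
proof -
  have "(\<Prod>v\<in>UNIV. z v ^ lookup (single w n) v) = (\<Prod>v\<in>UNIV. if v = w then z w ^ n else 1)"
    by (intro prod.cong) (auto simp: lookup_single when_def)
  then show ?thesis by simp
qed

lemma prod_UNIV_bool_pair: "(\<Prod>v\<in>UNIV. f v) = (\<Prod>i\<in>UNIV. f (i, False) * f (i, True))"
  for f :: "'q::finite \<times> bool \<Rightarrow> 'b::comm_ring_1"
proof -
  have "(\<Prod>v\<in>UNIV. f v) = (\<Prod>i\<in>UNIV. \<Prod>b\<in>UNIV. f (i, b))"
    by (simp add: prod.cartesian_product UNIV_Times_UNIV[symmetric] del: UNIV_Times_UNIV)
  then show ?thesis by (simp add: UNIV_bool)
qed

section \<open>Points of a grid\<close>

text \<open>Nonzero \<open>c j\<close> keep the points inside the torus, so a single evaluation of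
  Laurent polynomials serves all charts.\<close>

locale grid =
  fixes c :: "nat \<Rightarrow> 'k::field" and Q :: "(int ^ 'q::finite) set"
  assumes inj_c: "inj c" and c_nonzero: "c j \<noteq> 0" and finite_Q: "finite Q" and Q_nonempty: "Q \<noteq> {}"
    and Q_nonneg: "a \<in> Q \<Longrightarrow> 0 \<le> a" and Q_down: "b \<in> Q \<Longrightarrow> 0 \<le> a \<Longrightarrow> a \<le> b \<Longrightarrow> a \<in> Q"
begin

definition pt :: "int ^ 'q \<Rightarrow> 'q \<Rightarrow> 'k" where
  "pt w i = c (nat (w $ i))"

lemma pt_nonzero: "pt w i \<noteq> 0"
  by (simp add: pt_def c_nonzero)

definition eval :: "int ^ 'q \<Rightarrow> ('q, 'k) laurent \<Rightarrow> 'k" where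
  "eval w = lift (\<lambda>x. x) (\<lambda>u. \<Prod>i\<in>UNIV. pt w i powi (u $ i))"

sublocale eval: monoid_algebra_hom "\<lambda>x. x :: 'k" "\<lambda>u. \<Prod>i\<in>UNIV. pt w i powi (u $ i)" for w
  by unfold_locales (auto simp: power_int_add pt_nonzero prod.distrib)

lemmas eval_simps = eval.lift_add[folded eval_def] eval.lift_mult[folded eval_def] eval.lift_prod[folded eval_def]
  eval.lift_power[folded eval_def] eval.lift_diff[folded eval_def] eval.lift_0[folded eval_def]
  eval.lift_1[folded eval_def] eval.lift_sum[folded eval_def] eval.lift_uminus[folded eval_def]

lemma eval_single: "eval w (single u x) = x * (\<Prod>i\<in>UNIV. pt w i powi (u $ i))"
  unfolding eval_def by (rule eval.lift_single)

lemma eval_coord: "eval w (coord \<sigma> i) = (if \<sigma> i then inverse (pt w i) else pt w i)"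
proof -
  have "(\<Prod>j\<in>UNIV. pt w j powi (axis i e $ j)) = (\<Prod>j\<in>UNIV. if j = i then pt w i powi e else 1)" for e
    by (rule prod.cong) (auto simp: axis_def)
  then show ?thesis by (simp add: coord_def eval_single power_int_minus)
qed

definition Z :: "('q, 'k) laurent set" where
  "Z = {f. \<forall>w\<in>Q. eval w f = 0}"

definition pts :: "('q, 'k) ideal_sheaf" where
  "pts \<sigma> = patch \<sigma> \<sigma> \<inter> Z"

lemma ideal_Z: "ideal_of (patch \<sigma> \<tau>) (patch \<sigma> \<tau> \<inter> Z)"
  using subring_ofD[OF subring_of_patch[of \<sigma> \<tau>]] by (auto simp: ideal_of_def Z_def eval_simps)

text \<open>On the overlap every t_i with \<open>\<sigma> i \<noteq> \<tau> i\<close> is a unit, so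
  denominators can be cleared without affecting the vanishing at the points.\<close>

lemma gen_ideal_pts: "gen_ideal (patch \<sigma> \<tau>) (pts \<sigma>) = patch \<sigma> \<tau> \<inter> Z"
proof
  have "patch \<sigma> \<sigma> \<subseteq> patch \<sigma> \<tau>" by (auto simp: patch_def)
  then show "gen_ideal (patch \<sigma> \<tau>) (pts \<sigma>) \<subseteq> patch \<sigma> \<tau> \<inter> Z"
    by (intro gen_ideal_least[OF ideal_Z]) (auto simp: pts_def)
  show "patch \<sigma> \<tau> \<inter> Z \<subseteq> gen_ideal (patch \<sigma> \<tau>) (pts \<sigma>)"
  proof
    fix f assume f: "f \<in> patch \<sigma> \<tau> \<inter> Z"
    define N where "N = Max (insert 0 ((\<lambda>(u :: int ^ 'q, i). \<bar>u $ i\<bar>) ` (keys f \<times> UNIV)))"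
    have N: "\<bar>u $ i\<bar> \<le> N" if "u \<in> keys f" for u :: "int ^ 'q" and i
      unfolding N_def by (rule Max_ge) (use that in force)+
    \<comment> \<open>No shift where \<open>\<sigma>\<close> and \<open>\<tau>\<close> agree;
      elsewhere all exponents, which \<open>N\<close> bounds, are moved to the side that the chart
      of \<open>\<sigma>\<close> allows.\<close>
    define e :: "int ^ 'q" where "e = (\<chi> i. if \<sigma> i = \<tau> i then 0 else if \<sigma> i then - N else N)"
    let ?g = "single e 1 * f"
    have "?g \<in> patch \<sigma> \<sigma>"
      unfolding patch_def
    proof (intro CollectI ballI allI)
      fix u i assume "u \<in> keys ?g"
      then obtain v where v: "u = e + v" "v \<in> keys f"
        using keys_mult[of "single e 1" f] by (auto split: if_splits)
      have "(\<not> \<sigma> i \<and> \<not> \<tau> i \<longrightarrow> 0 \<le> v $ i) \<and> (\<sigma> i \<and> \<tau> i \<longrightarrow> v $ i \<le> 0)"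
        using f v(2) unfolding patch_def by blast
      then show "(\<not> \<sigma> i \<and> \<not> \<sigma> i \<longrightarrow> 0 \<le> u $ i) \<and> (\<sigma> i \<and> \<sigma> i \<longrightarrow> u $ i \<le> 0)"
        using N[OF v(2), of i] by (auto simp: v(1) e_def)
    qed
    then have g: "?g \<in> pts \<sigma>" using f by (simp add: pts_def Z_def eval_simps)
    have "single (- e) 1 * ?g = f"
      by (simp add: mult.assoc[symmetric] mult_single)
    moreover have "single (- e) (1::'k) \<in> patch \<sigma> \<tau>"
      by (rule single_in_patch) (auto simp: e_def)
    moreover have "r * x \<in> gen_ideal (patch \<sigma> \<tau>) (pts \<sigma>)" if "r \<in> patch \<sigma> \<tau>" "x \<in> pts \<sigma>" for r x
      using that ideal_ofD(4) unfolding gen_ideal_def by blast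
    ultimately show "f \<in> gen_ideal (patch \<sigma> \<tau>) (pts \<sigma>)" using g by metis
  qed
qed

lemma closed_subscheme_pts: "closed_subscheme pts"
  unfolding closed_subscheme_def
proof (intro conjI allI)
  show "ideal_of (patch \<sigma> \<sigma>) (pts \<sigma>)" for \<sigma> unfolding pts_def by (rule ideal_Z)
  fix \<sigma> \<tau> :: "'q \<Rightarrow> bool"
  have "patch \<sigma> \<tau> = (patch \<tau> \<sigma> :: ('q, 'k) laurent set)" by (auto simp: patch_def)
  then show "gen_ideal (patch \<sigma> \<tau>) (pts \<sigma>) = gen_ideal (patch \<sigma> \<tau>) (pts \<tau>)"
    using gen_ideal_pts[of \<sigma> \<tau>] gen_ideal_pts[of \<tau> \<sigma>] by simp
qed

text \<open>A prime containing the ideal of the points contains the kernel of the evaluation at one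
  of them, and that kernel is maximal.\<close>

lemma krull_dim_pts: "krull_dim (patch \<sigma> \<sigma>) (pts \<sigma>) = 0"
proof -
  let ?R = "patch \<sigma> \<sigma> :: ('q, 'k) laurent set"
  note S = subring_ofD[OF subring_of_patch[of \<sigma> \<sigma>, where ?'k = 'k]]
  have nochain: False if P: "prime_ideal_of ?R P" "pts \<sigma> \<subseteq> P" and P': "prime_ideal_of ?R P'" "P \<subset> P'" for P P'
  proof -
    have idP: "ideal_of ?R P" "ideal_of ?R P'" using P P' by (auto simp: prime_ideal_of_def)
    have one: "1 \<notin> P'" using P'(1) ideal_ofD(1,4)[OF idP(2)] by (fastforce simp: prime_ideal_of_def)
    \<comment> \<open>Otherwise there would be for each point a function vanishing there and not in
      \<open>P\<close>, while the product of these functions lies in \<open>P\<close>.\<close>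
    have "\<exists>w\<in>Q. \<forall>f\<in>?R. eval w f = 0 \<longrightarrow> f \<in> P"
    proof (rule ccontr)
      assume "\<not> ?thesis"
      then obtain g where g: "\<And>w. w \<in> Q \<Longrightarrow> g w \<in> ?R" "\<And>w. w \<in> Q \<Longrightarrow> eval w (g w) = 0" "\<And>w. w \<in> Q \<Longrightarrow> g w \<notin> P"
        by metis
      have "prod g Q \<in> ?R" using g(1) by (rule subring_of_prod[OF subring_of_patch])
      moreover have "eval w (prod g Q) = 0" if "w \<in> Q" for w
        unfolding eval_simps using g(2)[OF that] that finite_Q by (intro prod_zero) auto
      ultimately have "prod g Q \<in> P" using P(2) by (auto simp: pts_def Z_def)
      moreover have "prod g S \<notin> P" if "S \<subseteq> Q" for S
        using finite_subset[OF that finite_Q] that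
      proof (induction S rule: finite_induct)
        case empty
        then show ?case using one P'(2) by auto
      next
        case (insert w S)
        have "g w \<in> ?R" "g w \<notin> P" using g insert.prems by auto
        moreover have "prod g S \<in> ?R" using g(1) insert.prems by (intro subring_of_prod[OF subring_of_patch]) auto
        moreover have "prod g S \<notin> P" using insert by auto
        ultimately have "g w * prod g S \<notin> P" using P(1) unfolding prime_ideal_of_def by blast
        then show ?case using insert.hyps by simp
      qed
      ultimately show False by blast
    qed
    then obtain w where w: "w \<in> Q" "\<And>f. f \<in> ?R \<Longrightarrow> eval w f = 0 \<Longrightarrow> f \<in> P" by blast
    obtain g where g: "g \<in> P'" "g \<notin> P" using P'(2) by blast
    then have gR: "g \<in> ?R" using ideal_ofD(1)[OF idP(2)] by blast
    let ?k = "\<lambda>x. single 0 x :: ('q, 'k) laurent"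
    have kR: "?k x \<in> ?R" for x by (rule single_in_patch) auto
    have ek: "eval w (?k x) = x" for x by (simp add: eval_single)
    \<comment> \<open>Modulo \<open>P\<close> the element \<open>g\<close> is its value at
      \<open>w\<close>, so \<open>P'\<close> contains a nonzero constant.\<close>
    have "g - ?k (eval w g) \<in> P" using gR kR S by (intro w) (auto simp: eval_simps ek)
    then have "(-1) * (g - ?k (eval w g)) + g \<in> P'"
      using g P'(2) S(1,5) by (intro ideal_ofD(3,4)[OF idP(2)]) auto
    then have kP: "?k (eval w g) \<in> P'" by simp
    have "eval w g \<noteq> 0" using w(2)[OF gR] g(2) by blast
    then have "?k (inverse (eval w g)) * ?k (eval w g) = 1" by (simp add: mult_single)
    then show False using ideal_ofD(4)[OF idP(2) kR kP] one by metis
  qed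
  have "x \<le> 0" if x: "x \<in> {enat n | n. \<exists>P. (\<forall>k\<le>n. prime_ideal_of ?R (P k) \<and> pts \<sigma> \<subseteq> P k) \<and> (\<forall>k<n. P k \<subset> P (Suc k))}" for x
  proof -
    obtain n P where n: "x = enat n" "\<forall>k\<le>n. prime_ideal_of ?R (P k) \<and> pts \<sigma> \<subseteq> P k" "\<forall>k<n. P k \<subset> P (Suc k)"
      using x by blast
    have "n = 0"
    proof (rule ccontr)
      assume "n \<noteq> 0"
      then show False using nochain[of "P 0" "P (Suc 0)"] n by auto
    qed
    then show ?thesis by (simp add: n(1) zero_enat_def)
  qed
  then have "krull_dim ?R (pts \<sigma>) \<le> 0" unfolding krull_dim_def by (rule Sup_least)
  then show ?thesis by simp
qed

lemma zero_dimensional_pts: "zero_dimensional pts"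
  unfolding zero_dimensional_def
proof (intro conjI closed_subscheme_pts)
  have "1 \<notin> pts (\<lambda>_. False)" using Q_nonempty by (auto simp: pts_def Z_def eval_simps)
  then show "\<exists>\<sigma>. pts \<sigma> \<noteq> patch \<sigma> \<sigma>" using subring_ofD(1)[OF subring_of_patch] by metis
  show "scheme_dim pts = 0" by (simp add: scheme_dim_def krull_dim_pts)
qed

section \<open>Forms vanishing at the points, and the cones over the points\<close>

definition lin :: "'q \<Rightarrow> nat \<Rightarrow> ('q, 'k) cox" where
  "lin i j = var (i, True) - const (c j) * var (i, False)"

lemma lin_in_forms: "lin i j \<in> forms (axis i 1)"
  unfolding lin_def by (intro forms_diff var_in_forms forms_const_mult)

lemma eval_restrict_lin: "eval w (restrict_form \<sigma> (lin i (nat (w $ i)))) = 0"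
  by (simp add: lin_def restrict_form_simps restrict_form_const restrict_form_var eval_simps eval_single eval_coord
      pt_def[symmetric] pt_nonzero)

abbreviation I :: "('q, 'k) cox set" where
  "I \<equiv> vanishing_ideal pts"

lemma ideal_I: "ideal_of UNIV I"
  using graded_vanishing_ideal by (auto simp: mdeg.graded_ideal_def)

lemma mem_I:
  assumes "F \<in> forms a" "\<And>w \<sigma>. w \<in> Q \<Longrightarrow> eval w (restrict_form \<sigma> F) = 0"
  shows "F \<in> I"
proof -
  have "F \<in> {F. \<exists>a. F \<in> forms a \<and> vanishes_on F pts}"
    using assms restrict_form_in_patch by (auto simp: vanishes_on_def pts_def Z_def)
  then show ?thesis unfolding vanishing_ideal_def using gen_ideal_superset by (rule subsetD[rotated])
qed

text \<open>The homomorphism restricting forms to the cone over the point \<open>w\<close>, which is parametrized by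
  \<open>y\<close>.\<close>

definition cone :: "('k \<Rightarrow> 'b::comm_ring_1) \<Rightarrow> ('q \<Rightarrow> 'b) \<Rightarrow> int ^ 'q \<Rightarrow> ('q, 'k) cox \<Rightarrow> 'b" where
  "cone h y w = lift h (\<lambda>m. \<Prod>v\<in>UNIV. (case v of (i, b) \<Rightarrow> (if b then h (pt w i) else 1) * y i) ^ lookup m v)"

context
  fixes h :: "'k \<Rightarrow> 'b::comm_ring_1"
  assumes h: "h 1 = 1" "\<And>x y. h (x + y) = h x + h y" "\<And>x y. h (x * y) = h x * h y"
begin

interpretation cone: monoid_algebra_hom h
  "\<lambda>m. \<Prod>v\<in>UNIV. (case v of (i, b) \<Rightarrow> (if b then h (pt w i) else 1) * y i) ^ lookup m v" for w y
  by (rule subst_hom[OF h])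

lemmas cone_simps = cone.lift_add[folded cone_def] cone.lift_mult[folded cone_def] cone.lift_prod[folded cone_def]
  cone.lift_power[folded cone_def] cone.lift_diff[folded cone_def] cone.lift_0[folded cone_def]
  cone.lift_1[folded cone_def] cone.lift_sum[folded cone_def]

lemma cone_single: "cone h y w (single m x) =
  h x * (\<Prod>v\<in>UNIV. (case v of (i, b) \<Rightarrow> (if b then h (pt w i) else 1) * y i) ^ lookup m v)"
  unfolding cone_def by (rule cone.lift_single)

lemma cone_const: "cone h y w (const x) = h x"
  by (simp add: const_def cone_single)

lemma cone_var: "cone h y w (var (i, b)) = (if b then h (pt w i) else 1) * y i"
  unfolding Defs.var_def cone_single prod_power_lookup_single by (simp add: h)

lemma h_prod: "h (prod f A) = (\<Prod>x\<in>A. h (f x))"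
  by (induction A rule: infinite_finite_induct) (auto simp: h)

lemma h_power: "h (x ^ n) = h x ^ n"
  by (induction n) (auto simp: h)

lemma h_sum: "h (sum f A) = (\<Sum>x\<in>A. h (f x))"
  by (induction A rule: infinite_finite_induct) (auto simp: h cone.h_0)

text \<open>On the cone x_{i0} is \<open>y i\<close> and x_{i1} is \<open>pt w i\<close> times
  \<open>y i\<close>, so a form becomes its value in the chart where all x_{i0} are invertible,
  times a monomial in the \<open>y i\<close> fixed by the degree.\<close>

lemma cone_form:
  assumes "F \<in> forms a"
  shows "cone h y w F = h (eval w (restrict_form (\<lambda>_. False) F)) * (\<Prod>i\<in>UNIV. y i ^ nat (a $ i))"
proof -
  let ?p = "\<lambda>m. \<Prod>i\<in>UNIV. pt w i ^ lookup m (i, True)"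
  have mono: "(\<Prod>v\<in>UNIV. (case v of (i, b) \<Rightarrow> (if b then h (pt w i) else 1) * y i) ^ lookup m v) =
      h (?p m) * (\<Prod>i\<in>UNIV. y i ^ nat (a $ i))" if m: "m \<in> keys F" for m
  proof -
    have "a = mdeg m" using assms m by (auto simp: forms_def)
    then have "nat (a $ i) = lookup m (i, False) + lookup m (i, True)" for i
      by (simp add: mdeg_def)
    then show ?thesis
      by (simp add: prod_UNIV_bool_pair h_prod h_power power_add power_mult_distrib prod.distrib mult_ac)
  qed
  have "eval w (restrict_form (\<lambda>_. False) F) = (\<Sum>m\<in>keys F. lookup F m * ?p m)"
    by (simp add: restrict_form_def eval_simps eval_single)
  moreover have "cone h y w F = (\<Sum>m\<in>keys F. h (lookup F m) *
      (h (?p m) * (\<Prod>i\<in>UNIV. y i ^ nat (a $ i))))"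
    unfolding cone_def lift_def using mono by (intro sum.cong) auto
  ultimately show ?thesis by (simp add: h_sum h sum_distrib_right mult.assoc)
qed

text \<open>Tests for lying outside \<open>I\<close>. It is used with \<open>y = 0\<close> for
  properness, with indeterminates for a chain of primes, and with \<open>y = x0\<close> for reading
  off coefficients.\<close>

lemma cone_I:
  assumes "F \<in> I" "w \<in> Q"
  shows "cone h y w F = 0"
proof -
  have "ideal_of UNIV {F. cone h y w F = 0}" by (auto simp: ideal_of_def cone_simps)
  moreover have "{F. \<exists>a. F \<in> forms a \<and> vanishes_on F pts} \<subseteq> {F. cone h y w F = 0}"
  proof safe
    fix F a assume F: "F \<in> forms a" "vanishes_on F pts"
    then have "eval w (restrict_form (\<lambda>_. False) F) = 0" using assms(2) by (auto simp: vanishes_on_def pts_def Z_def)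
    then show "cone h y w F = 0" using cone_form[OF F(1)] by (simp add: cone.h_0)
  qed
  ultimately show ?thesis using assms(1) gen_ideal_least unfolding vanishing_ideal_def by blast
qed

end

lemma one_notin_gen_ideal_vars: "1 \<notin> gen_ideal UNIV (I \<union> range (\<lambda>i. var (i, False)))"
proof -
  obtain w where w: "w \<in> Q" using Q_nonempty by blast
  let ?f = "cone (\<lambda>x. x :: 'k) (\<lambda>_. 0) w"
  have hom: "(1::'k) = 1" "\<And>x y :: 'k. x + y = x + y" "\<And>x y :: 'k. x * y = x * y" by simp_all
  have "ideal_of UNIV {F. ?f F = 0}" by (auto simp: ideal_of_def cone_simps[OF hom])
  moreover have "I \<union> range (\<lambda>i. var (i, False)) \<subseteq> {F. ?f F = 0}"
    using cone_I[OF hom _ w] by (auto simp: cone_var[OF hom])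
  ultimately have "gen_ideal UNIV (I \<union> range (\<lambda>i. var (i, False))) \<subseteq> {F. ?f F = 0}"
    by (rule gen_ideal_least)
  then show ?thesis using cone_simps(7)[OF hom] by auto
qed

text \<open>At most \<open>q\<close>: a prime over \<open>I\<close> contains all the linear forms
  through some point, since a product with one such form for each point lies in \<open>I\<close>. At
  least \<open>q\<close>: over one point, the coordinates of the cone are set to 0 one after
  another.\<close>

lemma krull_dim_I: "krull_dim UNIV I = enat CARD('q)"
proof -
  obtain w where w: "w \<in> Q" using Q_nonempty by blast
  obtain js :: "'q list" where js: "set js = UNIV" "distinct js" using finite_distinct_list[OF finite] by blast
  then have len: "length js = CARD('q)" using distinct_card by fastforce
  obtain ix :: "'q \<Rightarrow> nat" where ix: "inj ix" using finite_imp_inj_to_nat_seg[of "UNIV :: 'q set"] by auto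
  let ?h = "single 0 :: 'k \<Rightarrow> ((nat \<Rightarrow>\<^sub>0 nat) \<Rightarrow>\<^sub>0 'k)"
  have hom: "?h 1 = 1" "\<And>x y. ?h (x + y) = ?h x + ?h y" "\<And>x y. ?h (x * y) = ?h x * ?h y"
    by (simp_all add: single_add mult_single)
  \<comment> \<open>Indexing the indeterminates by \<open>nat\<close> orders the exponents linearly,
    so that the target is an integral domain, as \<open>prime_ideal_kernel\<close> requires.\<close>
  define y where "y = (\<lambda>J i. if i \<in> J then 0 else single (single (ix i) (1::nat)) (1::'k))"
  define C where "C = (\<lambda>k. {F. cone ?h (y (set (take k js))) w F = 0})"
  show ?thesis
  proof (rule krull_dim_eqI)
    fix n and P :: "nat \<Rightarrow> ('q, 'k) cox set"
    assume P: "\<And>k. k \<le> n \<Longrightarrow> prime_ideal_of UNIV (P k)" "\<And>k. k \<le> n \<Longrightarrow> I \<subseteq> P k" "\<And>k. k < n \<Longrightarrow> P k \<subset> P (Suc k)"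
    have "\<exists>w\<in>Q. \<forall>i. lin i (nat (w $ i)) \<in> P 0"
    proof (rule ccontr)
      assume "\<not> ?thesis"
      then obtain f where f: "\<And>w. w \<in> Q \<Longrightarrow> lin (f w) (nat (w $ f w)) \<notin> P 0" by metis
      have "(\<Prod>w\<in>Q. lin (f w) (nat (w $ f w))) \<in> I"
      proof (rule mem_I)
        show "(\<Prod>w\<in>Q. lin (f w) (nat (w $ f w))) \<in> forms (\<Sum>w\<in>Q. axis (f w) 1)"
          by (rule forms_prod) (rule lin_in_forms)
        show "eval w (restrict_form \<sigma> (\<Prod>w\<in>Q. lin (f w) (nat (w $ f w)))) = 0" if "w \<in> Q" for w \<sigma>
          unfolding restrict_form_simps eval_simps using that finite_Q eval_restrict_lin by (intro prod_zero) auto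
      qed
      then show False using prime_ideal_prod[OF P(1)[of 0]] P(2)[of 0] f by blast
    qed
    then obtain w where "\<And>i. var (i, True) - const (pt w i) * var (i, False) \<in> P 0"
      by (auto simp: lin_def pt_def)
    then show "n \<le> CARD('q)" using prime_chain_length_le[of n P "pt w"] P(1,3) by blast
  next
    show "prime_ideal_of UNIV (C k)" for k
      unfolding C_def by (rule prime_ideal_kernel) (auto simp: cone_simps[OF hom])
    show "I \<subseteq> C k" for k unfolding C_def using cone_I[OF hom _ w] by blast
    fix k assume k: "k < CARD('q)"
    let ?j = "js ! k"
    have tk: "set (take (Suc k) js) = insert ?j (set (take k js))" "?j \<notin> set (take k js)"
      using k len js(2) by (auto simp: take_Suc_conv_app_nth in_set_conv_nth nth_eq_iff_index_eq)
    \<comment> \<open>Setting one more indeterminate to 0 turns the homomorphism with kernel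
      \<open>C k\<close> into the one with kernel \<open>C (Suc k)\<close>.\<close>
    let ?\<mu> = "\<lambda>m :: nat \<Rightarrow>\<^sub>0 nat. if ix ?j \<in> keys m then 0 else single m (1::'k)"
    interpret kill: monoid_algebra_hom ?h ?\<mu>
    proof
      fix m n :: "nat \<Rightarrow>\<^sub>0 nat"
      have "ix ?j \<in> keys (m + n) \<longleftrightarrow> ix ?j \<in> keys m \<or> ix ?j \<in> keys n"
        by (simp add: in_keys_iff lookup_add)
      then show "?\<mu> (m + n) = ?\<mu> m * ?\<mu> n" by (simp add: mult_single)
    qed (simp_all add: hom)
    have kill_h: "lift ?h ?\<mu> (?h x) = ?h x" for x
      by (simp add: kill.lift_single mult_single)
    have kill_y: "lift ?h ?\<mu> (y (set (take k js)) i) = y (set (take (Suc k) js)) i" for i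
      using ix tk(2) by (auto simp: y_def kill.lift_0 kill.lift_single tk(1) inj_eq)
    have kill_cone: "lift ?h ?\<mu> (cone ?h (y (set (take k js))) w F) = cone ?h (y (set (take (Suc k) js))) w F" for F
    proof (induction F rule: cox_induct)
      case (var v)
      obtain i b where "v = (i, b)" by force
      then show ?case by (simp add: cone_var[OF hom] kill.lift_mult kill.lift_1 kill_h kill_y)
    qed (simp_all add: cone_const[OF hom] cone_simps[OF hom] kill.lift_add kill.lift_mult kill_h)
    have "C k \<subseteq> C (Suc k)"
    proof
      fix F assume "F \<in> C k"
      then show "F \<in> C (Suc k)" using kill_cone[of F] by (simp add: C_def kill.lift_0)
    qed
    moreover have "single (single (ix ?j) (1::nat)) (1::'k) \<noteq> 0"
      by (metis lookup_single_eq lookup_zero zero_neq_one)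
    then have "var (?j, False) \<in> C (Suc k)" "var (?j, False) \<notin> C k"
      using tk by (auto simp: C_def cone_var[OF hom] y_def)
    ultimately show "C k \<subset> C (Suc k)" by blast
  qed
qed

end

section \<open>The ideal of the grid points as the distraction of a monomial ideal\<close>

lemma var_mult_single: "var v * single m x = single (m + single v 1) x"
  by (simp add: Defs.var_def mult_single add.commute)

lemma lookup_var_mult:
  "lookup ((var v :: ('q, 'k::field) cox) * F) (m + single v 1) = lookup F m"
proof (induction F rule: poly_mapping_induct_sum)
  case (single n x)
  have "n + single v 1 = m + single v 1 \<longleftrightarrow> n = m" by (rule add_right_cancel)
  then show ?case unfolding var_mult_single by (simp add: lookup_single when_def)
qed (simp add: distrib_left lookup_add)

text \<open>The ideal of the grid points is the image of a monomial ideal under the linear bijection that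
  replaces each power of $x_{i1}$ by a product of linear forms through the grid points. This
  bijection commutes with multiplication by the $x_{i0}$.\<close>

context grid
begin

abbreviation x0 :: "'q \<Rightarrow> ('q, 'k) cox" where
  "x0 i \<equiv> var (i, False)"

definition distract_mono :: "('q \<times> bool \<Rightarrow>\<^sub>0 nat) \<Rightarrow> ('q, 'k) cox" where
  "distract_mono m = (\<Prod>i\<in>UNIV. x0 i ^ lookup m (i, False) * (\<Prod>j<lookup m (i, True). lin i j))"

definition distract :: "('q, 'k) cox \<Rightarrow> ('q, 'k) cox" where
  "distract = lift const distract_mono"

interpretation distract: coefficient_hom "const :: 'k \<Rightarrow> ('q, 'k) cox" distract_mono
  by unfold_locales (simp_all add: const_add const_mult)

lemma distract_add: "distract (F + G) = distract F + distract G"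
  unfolding distract_def by (rule distract.lift_add)

lemma distract_diff: "distract (F - G) = distract F - distract G"
  unfolding distract_def by (rule distract.lift_diff)

lemma distract_single: "distract (single m x) = const x * distract_mono m"
  unfolding distract_def by (rule distract.lift_single)

lemma distract_mono_add_x0: "distract_mono (m + single (i, False) 1) = x0 i * distract_mono m"
proof -
  have "distract_mono (m + single (i, False) 1) =
      (\<Prod>k\<in>UNIV. (if k = i then x0 i else 1) * (x0 k ^ lookup m (k, False) * (\<Prod>j<lookup m (k, True). lin k j)))"
    unfolding distract_mono_def by (rule prod.cong) (auto simp: lookup_add lookup_single when_def)
  then show ?thesis by (simp add: prod.distrib distract_mono_def)
qed

lemma distract_mono_add_x1:
  "distract_mono (m + single (i, True) 1) = lin i (lookup m (i, True)) * distract_mono m"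
proof -
  have "distract_mono (m + single (i, True) 1) =
      (\<Prod>k\<in>UNIV. (if k = i then lin i (lookup m (i, True)) else 1) *
        (x0 k ^ lookup m (k, False) * (\<Prod>j<lookup m (k, True). lin k j)))"
    unfolding distract_mono_def by (rule prod.cong) (auto simp: lookup_add lookup_single when_def mult_ac)
  then show ?thesis by (simp add: prod.distrib distract_mono_def)
qed

lemma distract_x0_mult: "distract (x0 i * F) = x0 i * distract F"
proof (induction F rule: poly_mapping_induct_sum)
  case (single m x)
  show ?case unfolding var_mult_single distract_single distract_mono_add_x0 by (simp add: mult_ac)
qed (simp add: distrib_left distract_add)

lemma distract_const_mult: "distract (const x * F) = const x * distract F"
proof (induction F rule: poly_mapping_induct_sum)
  case (single m y)
  show ?case by (simp only: const_mult_single distract_single const_mult mult.assoc)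
qed (simp add: distrib_left distract_add)

text \<open>The image contains 1 and is closed under multiplication by the variables: for x_{i1}
  because it equals \<open>lin i j + const (c j) * x0 i\<close>, with \<open>j\<close> the exponent
  of x_{i1} in the monomial at hand.\<close>

lemma distract_surj: "\<exists>G. F = distract G"
proof -
  have "\<exists>G'. F * distract G = distract G'" for G
  proof (induction F arbitrary: G rule: cox_induct)
    case (const x)
    show ?case by (rule exI[of _ "const x * G"]) (rule distract_const_mult[symmetric])
  next
    case (var v)
    obtain i b where v: "v = (i, b)" by force
    show ?case
    proof (cases b)
      case False
      then show ?thesis by (intro exI[of _ "x0 i * G"]) (simp add: v distract_x0_mult)
    next
      case True
      have "\<exists>G'. var (i, True) * distract G = distract G'"
      proof (induction G rule: poly_mapping_induct_sum)
        case (single m x)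
        let ?j = "lookup m (i, True)"
        have "distract (single (m + single (i, True) 1) x +
            const (c ?j) * (x0 i * single m x)) =
            (lin i ?j + const (c ?j) * x0 i) * distract (single m x)"
          unfolding distract_add distract_const_mult distract_x0_mult distract_single distract_mono_add_x1
          by (simp add: algebra_simps)
        also have "lin i ?j + const (c ?j) * x0 i = var (i, True)" by (simp add: lin_def)
        finally show ?case by (intro exI) (rule sym)
      next
        case (add F G)
        then obtain F' G' where "var (i, True) * distract F = distract F'" "var (i, True) * distract G = distract G'"
          by blast
        then show ?case by (intro exI[of _ "F' + G'"]) (simp add: distract_add distrib_left)
      qed
      then show ?thesis using v True by simp
    qed
  next
    case (add F1 F2)
    then obtain G1 G2 where "F1 * distract G = distract G1" "F2 * distract G = distract G2" by blast
    then show ?case by (intro exI[of _ "G1 + G2"]) (simp add: distract_add distrib_right)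
  next
    case (mult F1 F2)
    then obtain G2 where "F2 * distract G = distract G2" by blast
    then show ?case using mult.IH(1)[of G2] by (simp add: mult.assoc)
  qed
  moreover have "distract 1 = 1"
    using distract_single[of 0 1] by (simp add: distract_mono_def)
  ultimately show ?thesis by (metis mult.right_neutral)
qed

definition height :: "('q \<times> bool \<Rightarrow>\<^sub>0 nat) \<Rightarrow> int ^ 'q" where
  "height m = (\<chi> i. int (lookup m (i, True)))"

lemma height_nonneg: "0 \<le> height m"
  by (simp add: height_def less_eq_vec_def)

text \<open>As \<open>Q\<close> is a down-set, a height outside it is not below any \<open>w\<close>
  in \<open>Q\<close>. So in some direction \<open>i\<close> the product runs past
  \<open>w $ i\<close> and contains the linear form through the point \<open>w\<close>.\<close>

lemma distract_mono_in_I: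
  assumes "height m \<notin> Q"
  shows "distract_mono m \<in> I"
proof (rule mem_I)
  show "distract_mono m \<in> forms (\<Sum>i\<in>UNIV. axis i (int (lookup m (i, False))) + (\<Sum>j<lookup m (i, True). axis i 1))"
    unfolding distract_mono_def by (intro forms_prod forms_mult var_power_in_forms lin_in_forms)
  fix w \<sigma> assume w: "w \<in> Q"
  have "\<not> height m \<le> w" using assms Q_down[OF w height_nonneg] by blast
  then obtain i where "w $ i < int (lookup m (i, True))" by (auto simp: less_eq_vec_def height_def not_le)
  moreover have "0 \<le> w $ i" using Q_nonneg[OF w] by (simp add: less_eq_vec_def)
  ultimately have i: "nat (w $ i) < lookup m (i, True)" by simp
  have "eval w (restrict_form \<sigma> (\<Prod>j<lookup m (i, True). lin i j)) = 0"
    unfolding restrict_form_simps eval_simps using i eval_restrict_lin[of w \<sigma> i] by (intro prod_zero) auto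
  then show "eval w (restrict_form \<sigma> (distract_mono m)) = 0"
    unfolding distract_mono_def restrict_form_simps eval_simps by (intro prod_zero) (auto intro!: exI[of _ i])
qed

text \<open>The value of \<open>distract_mono m\<close> at the point \<open>w\<close> after setting
  all x_{i0} to 1; it is zero once \<open>height m\<close> exceeds \<open>w\<close> in some
  direction.\<close>

definition height_coeff :: "('q \<times> bool \<Rightarrow>\<^sub>0 nat) \<Rightarrow> int ^ 'q \<Rightarrow> 'k" where
  "height_coeff m w = (\<Prod>i\<in>UNIV. \<Prod>j<lookup m (i, True). pt w i - c j)"

text \<open>Evaluation is triangular: among the terms of one degree with height in \<open>Q\<close>
  choose one of minimal height; at the point indexed by this height it is the only term of that
  degree to survive.\<close>

lemma distract_in_I_iff: "distract F \<in> I \<longleftrightarrow> (\<forall>m\<in>keys F. height m \<notin> Q)"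
proof
  assume *: "\<forall>m\<in>keys F. height m \<notin> Q"
  show "distract F \<in> I" unfolding distract_def lift_def
    by (rule ideal_sum[OF ideal_I]) (use * distract_mono_in_I in \<open>simp add: ideal_UNIV_mult[OF ideal_I]\<close>)
next
  assume FI: "distract F \<in> I"
  show "\<forall>m\<in>keys F. height m \<notin> Q"
  proof (rule ccontr)
    assume "\<not> ?thesis"
    then obtain m1 where m1: "m1 \<in> keys F" "height m1 \<in> Q" by blast
    define T where "T = (\<lambda>m. m \<in> keys F \<and> height m \<in> Q \<and> mdeg m = mdeg m1)"
    have "T m1" using m1 by (simp add: T_def)
    from ex_has_least_nat[of T, OF this, of "\<lambda>m. \<Sum>i\<in>UNIV. lookup m (i, True)"]
    obtain m0 where m0: "T m0"
      "\<And>m. T m \<Longrightarrow> (\<Sum>i\<in>UNIV. lookup m0 (i, True)) \<le> (\<Sum>i\<in>UNIV. lookup m (i, True))" by blast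
    define w where "w = height m0"
    have w: "w \<in> Q" using m0(1) by (simp add: w_def T_def)
    have ptw: "pt w i = c (lookup m0 (i, True))" for i by (simp add: pt_def w_def height_def)
    have hom: "const 1 = (1 :: ('q, 'k) cox)" "\<And>x y. const (x + y) = const x + (const y :: ('q, 'k) cox)"
      "\<And>x y. const (x * y) = const x * (const y :: ('q, 'k) cox)" by (simp_all add: const_add const_mult)
    let ?\<theta> = "cone const x0 w"
    \<comment> \<open>On the cone a monomial of degree \<open>a\<close> becomes a multiple of the
      monomial in the x_{i0} with exponents \<open>a\<close>, so \<open>E\<close> separates exactly
      the degrees.\<close>
    define E where "E = (\<lambda>m :: 'q \<times> bool \<Rightarrow>\<^sub>0 nat. \<Sum>i\<in>UNIV. single (i, False) (nat (mdeg m $ i)))"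
    have lookE: "lookup (E m) (i, False) = nat (mdeg m $ i)" for m i
    proof -
      have "lookup (E m) (i, False) = (\<Sum>k\<in>UNIV. if k = i then nat (mdeg m $ i) else 0)"
        unfolding E_def lookup_sum by (rule sum.cong) (auto simp: lookup_single when_def)
      then show ?thesis by simp
    qed
    have E_eq: "E m = E m' \<longleftrightarrow> mdeg m = mdeg m'" for m m'
    proof
      assume "E m = E m'"
      then have "nat (mdeg m $ i) = nat (mdeg m' $ i)" for i using lookE by metis
      then have "mdeg m $ i = mdeg m' $ i" for i
        using mdeg_nonneg[of m] mdeg_nonneg[of m'] by (simp add: less_eq_vec_def eq_nat_nat_iff)
      then show "mdeg m = mdeg m'" by (simp add: vec_eq_iff)
    qed (simp add: E_def)
    have xE: "(\<Prod>i\<in>S. x0 i ^ nat (mdeg m $ i)) = single (\<Sum>i\<in>S. single (i, False) (nat (mdeg m $ i))) 1" for S m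
      by (induction S rule: infinite_finite_induct) (auto simp: var_power mult_single)
    have theta: "?\<theta> (distract_mono m) = single (E m) (height_coeff m w)" for m
    proof -
      have "?\<theta> (lin i j) = const (pt w i - c j) * x0 i" for i j
        by (simp add: lin_def cone_simps[OF hom] cone_var[OF hom] cone_const[OF hom] const_diff algebra_simps)
      then have "?\<theta> (distract_mono m) = (\<Prod>i\<in>UNIV. x0 i ^ lookup m (i, False) *
          (\<Prod>j<lookup m (i, True). const (pt w i - c j) * x0 i))"
        unfolding distract_mono_def by (simp add: cone_simps[OF hom] cone_var[OF hom])
      also have "\<dots> = (\<Prod>i\<in>UNIV. const (\<Prod>j<lookup m (i, True). pt w i - c j) * x0 i ^ nat (mdeg m $ i))"
        by (intro prod.cong) (simp_all add: const_prod prod.distrib mdeg_def nat_add_distrib power_add mult_ac)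
      also have "\<dots> = const (height_coeff m w) * (\<Prod>i\<in>UNIV. x0 i ^ nat (mdeg m $ i))"
        by (simp add: height_coeff_def const_prod prod.distrib)
      finally show ?thesis unfolding xE by (simp add: E_def const_mult_single)
    qed
    have "?\<theta> (distract F) = (\<Sum>m\<in>keys F. single (E m) (lookup F m * height_coeff m w))"
      unfolding distract_def lift_def cone_simps[OF hom] cone_const[OF hom] theta const_mult_single ..
    then have "(\<Sum>m\<in>keys F. single (E m) (lookup F m * height_coeff m w)) = 0"
      using cone_I[OF hom FI w] by simp
    then have "lookup (\<Sum>m\<in>keys F. single (E m) (lookup F m * height_coeff m w)) (E m0) = 0"
      by simp
    then have "(\<Sum>m\<in>keys F. if E m = E m0 then lookup F m * height_coeff m w else 0) = 0"
      by (simp add: lookup_sum lookup_single when_def)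
    moreover have "(\<Sum>m\<in>keys F. if E m = E m0 then lookup F m * height_coeff m w else 0) =
        (\<Sum>m\<in>keys F. if m = m0 then lookup F m0 * height_coeff m0 w else 0)"
    proof (rule sum.cong)
      fix m assume m: "m \<in> keys F"
      have "height_coeff m w = 0" if dm: "mdeg m = mdeg m0" "m \<noteq> m0"
      proof -
        \<comment> \<open>A height not exceeding \<open>w\<close> would lie in \<open>Q\<close> and,
          by minimality, equal \<open>w\<close>; as the degrees agree, this forces
          \<open>m = m0\<close>.\<close>
        have "\<exists>i. lookup m0 (i, True) < lookup m (i, True)"
        proof (rule ccontr)
          assume "\<not> ?thesis"
          then have le: "lookup m (i, True) \<le> lookup m0 (i, True)" for i by (simp add: not_less)
          then have "height m \<le> w" by (simp add: w_def height_def less_eq_vec_def)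
          then have "height m \<in> Q" using Q_down[OF w height_nonneg] by blast
          then have "T m" using m dm(1) m0(1) by (simp add: T_def)
          then have ge: "(\<Sum>i\<in>UNIV. lookup m0 (i, True)) \<le> (\<Sum>i\<in>UNIV. lookup m (i, True))"
            by (rule m0(2))
          have eq1: "lookup m (i, True) = lookup m0 (i, True)" for i
          proof (rule ccontr)
            assume "lookup m (i, True) \<noteq> lookup m0 (i, True)"
            then have "lookup m (i, True) < lookup m0 (i, True)" using le[of i] by simp
            then have "(\<Sum>i\<in>UNIV. lookup m (i, True)) < (\<Sum>i\<in>UNIV. lookup m0 (i, True))"
              using le by (intro sum_strict_mono_ex1) auto
            then show False using ge by simp
          qed
          have "m = m0"
          proof (rule poly_mapping_eqI)
            fix v :: "'q \<times> bool"
            obtain i b where v: "v = (i, b)" by force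
            have "mdeg m $ i = mdeg m0 $ i" using dm(1) by simp
            then have "lookup m (i, False) = lookup m0 (i, False)"
              using eq1[of i] by (simp add: mdeg_def)
            then show "lookup m v = lookup m0 v" using eq1 v by (cases b) auto
          qed
          then show False using dm(2) by simp
        qed
        then obtain i where i: "lookup m0 (i, True) < lookup m (i, True)" by blast
        have "(\<Prod>j<lookup m (i, True). pt w i - c j) = 0"
          using i by (intro prod_zero) (auto simp: ptw intro!: bexI[of _ "lookup m0 (i, True)"])
        then show ?thesis unfolding height_coeff_def by (intro prod_zero) (auto intro!: exI[of _ i])
      qed
      then show "(if E m = E m0 then lookup F m * height_coeff m w else 0) =
          (if m = m0 then lookup F m0 * height_coeff m0 w else 0)"
        by (auto simp: E_eq)
    qed simp
    ultimately have "lookup F m0 * height_coeff m0 w = 0"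
      using m0(1) by (simp add: T_def)
    \<comment> \<open>Only the \<open>c j\<close> with \<open>j\<close> strictly below the index of
      the point occur, so injectivity makes all factors nonzero.\<close>
    moreover have "height_coeff m0 w \<noteq> 0"
      using inj_c by (auto simp: height_coeff_def ptw inj_eq)
    ultimately show False using m0(1) by (simp add: T_def in_keys_iff)
  qed
qed

text \<open>As \<open>distract\<close> is onto and commutes with multiplication by each
  \<open>x0 j\<close>, the ideal corresponds to a monomial ideal, where membership is decided term
  by term.\<close>

lemma distract_in_gen_ideal_iff:
  "distract F \<in> gen_ideal UNIV (I \<union> x0 ` set js) \<longleftrightarrow>
    (\<forall>m\<in>keys F. height m \<in> Q \<longrightarrow> (\<exists>j\<in>set js. 0 < lookup m (j, False)))"
    (is "_ \<longleftrightarrow> ?M js F")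
proof
  let ?N = "gen_ideal UNIV (I \<union> x0 ` set js)"
  assume *: "?M js F"
  have "distract_mono m \<in> ?N" if "m \<in> keys F" for m
  proof (cases "height m \<in> Q")
    case True
    then obtain j where j: "j \<in> set js" "0 < lookup m (j, False)" using * \<open>m \<in> _\<close> by blast
    have "x0 j ^ lookup m (j, False) = x0 j * x0 j ^ (lookup m (j, False) - 1)"
      using j(2) by (metis Suc_diff_1 power_Suc)
    moreover have "x0 j \<in> ?N" using j(1) gen_ideal_superset[of "I \<union> x0 ` set js" UNIV] by blast
    ultimately show ?thesis unfolding distract_mono_def
      by (subst prod.remove[of _ j]) (auto simp: ideal_UNIV_mult[OF ideal_of_gen_ideal] mult.assoc)
  next
    case False
    then show ?thesis using distract_mono_in_I gen_ideal_superset[of "I \<union> x0 ` set js" UNIV] by blast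
  qed
  then show "distract F \<in> ?N" unfolding distract_def lift_def
    by (intro ideal_sum[OF ideal_of_gen_ideal]) (simp add: ideal_UNIV_mult[OF ideal_of_gen_ideal])
next
  show "distract F \<in> gen_ideal UNIV (I \<union> x0 ` set js) \<Longrightarrow> ?M js F"
  proof (induction js arbitrary: F)
    case Nil
    then show ?case using distract_in_I_iff by (simp add: gen_ideal_idem[OF ideal_I])
  next
    case (Cons j js)
    then have "distract F \<in> gen_ideal UNIV (insert (x0 j) (I \<union> x0 ` set js))" by simp
    then obtain y r where yr: "distract F = y + x0 j * r" "y \<in> gen_ideal UNIV (I \<union> x0 ` set js)"
      by (auto simp: gen_ideal_insert)
    obtain r' where r': "r = distract r'" using distract_surj by blast
    have "distract (F - x0 j * r') = y" using yr(1) by (simp add: r' distract_diff distract_x0_mult)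
    then have "distract (F - x0 j * r') \<in> gen_ideal UNIV (I \<union> x0 ` set js)" using yr(2) by simp
    then have M: "?M js (F - x0 j * r')" by (rule Cons.IH)
    show ?case
    proof (intro ballI impI)
      fix m assume m: "m \<in> keys F" "height m \<in> Q"
      show "\<exists>k\<in>set (j # js). 0 < lookup m (k, False)"
      proof (cases "m \<in> keys (F - x0 j * r')")
        case True
        then show ?thesis using M m(2) by auto
      next
        case False
        then have "m \<in> keys (x0 j * r')" using m(1) by (simp add: in_keys_iff lookup_minus)
        then obtain s t where "m = s + t" "s \<in> keys (x0 j)" using keys_mult by blast
        then have "m = single (j, False) 1 + t" by (simp add: Defs.var_def)
        then show ?thesis by (auto simp: lookup_add)
      qed
    qed
  qed
qed

text \<open>Multiplying by \<open>x0 k\<close> changes neither the height nor the exponents of the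
  other \<open>x0 j\<close>, so the monomial criterion passes from the product to the
  factor.\<close>

lemma x0_nonzerodivisor:
  assumes "k \<notin> set js"
  shows "nonzerodivisor_mod (x0 k) (gen_ideal UNIV (I \<union> x0 ` set js))"
  unfolding nonzerodivisor_mod_def
proof (intro allI impI)
  fix g assume g: "x0 k * g \<in> gen_ideal UNIV (I \<union> x0 ` set js)"
  obtain F where F: "g = distract F" using distract_surj by blast
  have *: "\<forall>m\<in>keys (x0 k * F). height m \<in> Q \<longrightarrow> (\<exists>j\<in>set js. 0 < lookup m (j, False))"
    using g unfolding F distract_x0_mult[symmetric] distract_in_gen_ideal_iff .
  show "g \<in> gen_ideal UNIV (I \<union> x0 ` set js)"
    unfolding F distract_in_gen_ideal_iff
  proof (intro ballI impI)
    fix m assume m: "m \<in> keys F" "height m \<in> Q"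
    let ?m = "m + single (k, False) 1"
    have "?m \<in> keys (x0 k * F)" using m(1) unfolding in_keys_iff lookup_var_mult .
    moreover have "height ?m = height m" by (simp add: height_def lookup_add lookup_single)
    ultimately obtain j where "j \<in> set js" "0 < lookup ?m (j, False)" using * m(2) by metis
    moreover then have "j \<noteq> k" using assms by blast
    ultimately show "\<exists>j\<in>set js. 0 < lookup m (j, False)"
      by (auto simp: lookup_add lookup_single)
  qed
qed

text \<open>Modulo the x_{i0} each \<open>lin i j\<close> becomes x_{i1}, so the distracted monomial
  of height \<open>a\<close> becomes the plain one.\<close>

lemma x1_monomial_in_gen_ideal_iff:
  assumes "0 \<le> a"
  shows "(\<Prod>i\<in>UNIV. var (i, True) ^ nat (a $ i)) \<in> gen_ideal UNIV (I \<union> range x0) \<longleftrightarrow> a \<notin> Q"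
proof -
  let ?N = "gen_ideal UNIV (I \<union> range x0)"
  obtain js :: "'q list" where js: "set js = UNIV" using finite_list[OF finite] by blast
  define m where "m = (\<Sum>i\<in>UNIV. single (i, True) (nat (a $ i)))"
  have m: "lookup m (i, b) = (if b then nat (a $ i) else 0)" for i b
  proof -
    have "lookup m (i, b) = (\<Sum>k\<in>UNIV. if k = i then (if b then nat (a $ i) else 0) else 0)"
      unfolding m_def lookup_sum by (rule sum.cong) (auto simp: lookup_single when_def)
    then show ?thesis by simp
  qed
  have hm: "height m = a" using assms by (simp add: height_def m vec_eq_iff less_eq_vec_def)
  have "distract_mono m = distract (single m 1)" by (simp add: distract_single)
  then have "distract_mono m \<in> ?N \<longleftrightarrow> a \<notin> Q"
    using distract_in_gen_ideal_iff[of "single m 1" js] by (simp add: js hm m)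
  moreover have "distract_mono m - (\<Prod>i\<in>UNIV. var (i, True) ^ nat (a $ i)) \<in> ?N"
  proof -
    have "lin i j - var (i, True) \<in> ?N" for i j
    proof -
      have "x0 i \<in> ?N" using gen_ideal_superset[of "I \<union> range x0" UNIV] by blast
      then have "(- const (c j)) * x0 i \<in> ?N" by (rule ideal_UNIV_mult(1)[OF ideal_of_gen_ideal])
      then show ?thesis by (simp add: lin_def)
    qed
    then have "(\<Prod>i\<in>UNIV. \<Prod>j<nat (a $ i). lin i j) - (\<Prod>i\<in>UNIV. \<Prod>j<nat (a $ i). var (i, True)) \<in> ?N"
      by (intro ideal_cong_prod[OF ideal_of_gen_ideal])
    then show ?thesis by (simp add: distract_mono_def m)
  qed
  ultimately show ?thesis using ideal_UNIV_mem_cong[OF ideal_of_gen_ideal] by blast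
qed

section \<open>Difference function and depth for the grid points\<close>

lemma difference_pts: "difference (hilbert_fun pts) = indicator Q"
proof -
  obtain js :: "'q list" where js: "set js = UNIV" "distinct js" using finite_distinct_list[OF finite] by blast
  have "difference (hilbert_fun pts) =
      indicator {a. 0 \<le> a \<and> (\<Prod>i\<in>UNIV. (var (i, True) :: ('q, 'k) cox) ^ nat (a $ i)) \<notin> gen_ideal UNIV (I \<union> range x0)}"
  proof (rule hilbert_difference_regular[OF js(2,1) var_in_forms var_in_forms])
    fix i ks assume "suffix (i # ks) js"
    then have "i \<notin> set ks" using js(2) by (auto simp: suffix_def)
    then show "nonzerodivisor_mod (x0 i) (gen_ideal UNIV (I \<union> x0 ` set ks))" by (rule x0_nonzerodivisor)
  next
    fix i b
    have "var (i, b) - const (if b then 1 else 0) * var (i, True) \<in> gen_ideal UNIV (I \<union> range x0)"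
      using gen_ideal_superset[of "I \<union> range x0" UNIV] ideal_ofD(2)[OF ideal_of_gen_ideal] by auto
    then show "\<exists>d. var (i, b) - const d * var (i, True) \<in> gen_ideal UNIV (I \<union> range x0)" by blast
  qed
  also have "{a. 0 \<le> a \<and> (\<Prod>i\<in>UNIV. (var (i, True) :: ('q, 'k) cox) ^ nat (a $ i)) \<notin> gen_ideal UNIV (I \<union> range x0)} = Q"
  proof (rule Set.set_eqI)
    show "a \<in> {a. 0 \<le> a \<and> (\<Prod>i\<in>UNIV. (var (i, True) :: ('q, 'k) cox) ^ nat (a $ i)) \<notin> gen_ideal UNIV (I \<union> range x0)} \<longleftrightarrow> a \<in> Q" for a
      using x1_monomial_in_gen_ideal_iff[of a] Q_nonneg[of a] by (cases "0 \<le> a") auto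
  qed
  finally show ?thesis .
qed

lemma ACM_pts: "ACM pts"
proof -
  let ?N = "gen_ideal UNIV (I \<union> range x0)"
  obtain js :: "'q list" where js: "set js = UNIV" "distinct js" using finite_distinct_list[OF finite] by blast
  then have len: "length js = CARD('q)" using distinct_card by fastforce
  have vars: "\<exists>n. var (i, b) ^ n \<in> ?N" for i b
  proof (cases b)
    case False
    then have "var (i, b) ^ 1 \<in> ?N" using gen_ideal_superset[of "I \<union> range x0" UNIV] by auto
    then show ?thesis by blast
  next
    case True
    \<comment> \<open>\<open>Q\<close> is finite, so some multiple of each basis vector lies outside
      it, which makes x_{i1} nilpotent.\<close>
    have "inj (\<lambda>n. axis i (int n))" by (rule injI) (metis axis_nth of_nat_eq_iff)
    then have "infinite (range (\<lambda>n. axis i (int n)))" by (simp add: finite_image_iff)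
    then have "\<not> range (\<lambda>n. axis i (int n)) \<subseteq> Q" using finite_subset[OF _ finite_Q] by blast
    then obtain n where n: "axis i (int n) \<notin> Q" by blast
    have "(\<Prod>k\<in>UNIV. (var (k, True) :: ('q, 'k) cox) ^ nat (axis i (int n) $ k)) = (\<Prod>k\<in>UNIV. if k = i then var (i, True) ^ n else 1)"
      by (rule prod.cong) (auto simp: axis_def)
    moreover have "(\<Prod>k\<in>UNIV. var (k, True) ^ nat (axis i (int n) $ k)) \<in> ?N"
      using n by (subst x1_monomial_in_gen_ideal_iff) (auto simp: axis_def less_eq_vec_def)
    ultimately show ?thesis using True by (intro exI[of _ n]) simp
  qed
  \<comment> \<open>A longer regular sequence would make the Koszul complex of the x_{i0} exact in
    degree 0 as well, and 1 would lie in the ideal.\<close>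
  have le: "length fs \<le> CARD('q)" if fs: "set fs \<subseteq> var_ideal" "regular_seq I fs" for fs
  proof (rule ccontr)
    assume "\<not> length fs \<le> CARD('q)"
    then have "koszul_exact (map x0 js) 0 I"
      using fs var_ideal_radical[OF ideal_of_gen_ideal vars]
      by (intro koszul_exact_regular_seq[OF ideal_I fs(2)]) (auto simp: js len)
    then have "1 \<in> gen_ideal UNIV (I \<union> set (map x0 js))" by (rule koszul_exact_0[OF ideal_I])
    then show False using one_notin_gen_ideal_vars by (simp add: js)
  qed
  have "regular_seq I (map x0 js)"
    unfolding regular_seq_def
  proof (intro conjI allI impI)
    show "gen_ideal UNIV (I \<union> set (map x0 js)) \<noteq> UNIV" using one_notin_gen_ideal_vars by (auto simp: js)
    fix k g assume k: "k < length (map x0 js)"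
      and g: "map x0 js ! k * g \<in> gen_ideal UNIV (I \<union> set (take k (map x0 js)))"
    have "js ! k \<notin> set (take k js)" using k js(2) by (auto simp: in_set_conv_nth nth_eq_iff_index_eq)
    from x0_nonzerodivisor[OF this] show "g \<in> gen_ideal UNIV (I \<union> set (take k (map x0 js)))"
      using g k by (simp add: nonzerodivisor_mod_def take_map)
  qed
  moreover have "set (map x0 js) \<subseteq> var_ideal"
    unfolding var_ideal_def by (auto intro!: subsetD[OF gen_ideal_superset])
  ultimately have ex: "enat CARD('q) \<in> {enat (length fs) | fs. set fs \<subseteq> var_ideal \<and> regular_seq I fs}"
    using len by (intro CollectI exI[of _ "map x0 js"]) auto
  have "depth var_ideal I = enat CARD('q)"
    unfolding depth_def
  proof (rule antisym)
    show "Sup {enat (length fs) | fs. set fs \<subseteq> var_ideal \<and> regular_seq I fs} \<le> enat CARD('q)"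
      by (rule Sup_least) (use le in auto)
    show "enat CARD('q) \<le> Sup {enat (length fs) | fs. set fs \<subseteq> var_ideal \<and> regular_seq I fs}"
      by (rule Sup_upper[OF ex])
  qed
  then show ?thesis by (simp add: ACM_def krull_dim_I)
qed

end

theorem quasi_rectangular_realizable:
  fixes Q :: "(int ^ 'q::finite) set"
  assumes inf: "infinite (UNIV :: 'k::field set)" and Q: "quasi_rectangular Q" "Q \<noteq> {}"
  shows "\<exists>X :: ('q, 'k) ideal_sheaf. zero_dimensional X \<and> ACM X \<and> difference (hilbert_fun X) = indicator Q"
proof -
  have "infinite (UNIV - {0 :: 'k})" using inf by simp
  then obtain c :: "nat \<Rightarrow> 'k" where c: "inj c" "range c \<subseteq> UNIV - {0}" using infinite_countable_subset by blast
  obtain R where R: "finite R" "\<forall>r\<in>R. 0 \<le> r" "Q = (\<Union>r\<in>R. {0..r})" using Q(1) by (auto simp: quasi_rectangular_def)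
  have "grid c Q"
  proof
    show "finite Q" using R finite_int_box by auto
    show "a \<in> Q" if "b \<in> Q" "0 \<le> a" "a \<le> b" for a b using that R(3) by (auto intro: order_trans)
    show "0 \<le> a" if "a \<in> Q" for a using that R(3) by auto
    show "c j \<noteq> 0" for j using c(2) by blast
  qed (use c Q in auto)
  then interpret grid c Q .
  show ?thesis using zero_dimensional_pts ACM_pts difference_pts by blast
qed

theorem corollary6p7:
  assumes "infinite (UNIV :: 'k::field set)"
  shows "(\<forall>X :: ('q::finite, 'k) ideal_sheaf. zero_dimensional X \<and> ACM X \<longrightarrow>
            (\<exists>Q. quasi_rectangular Q \<and> difference (hilbert_fun X) = indicator Q)) \<and>
         (\<forall>Q :: (int ^ 'q) set. quasi_rectangular Q \<and> Q \<noteq> {} \<longrightarrow>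
            (\<exists>X :: ('q, 'k) ideal_sheaf. zero_dimensional X \<and> ACM X \<and>
               difference (hilbert_fun X) = indicator Q))"
  using ACM_difference_quasi_rectangular[OF assms] quasi_rectangular_realizable[OF assms] by blast

end
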